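(* Assume $\alpha\in\mathbb N=\{1,2,3,\dots\}$ and that $\theta-2\delta+j\beta\equiv0\ \mathrm{mod}\ \pi$ for some integer $j\in\{1,\dots,2\alpha-2\}$. Let $$(a_{2k},b_{2k})=\big(\mathbf x(s_1/\mathbf q^{k}),\mathbf y(s_1/\mathbf q^{k})\big)\ (1\le k\le\alpha-1),\qquad(a_{2k+1},b_{2k+1})=\big(\mathbf x(s_1/\mathbf q^{k+1}),\mathbf y(s_1/\mathbf q^{k})\big)\ (0\le k\le\alpha-1).$$ Then there exist functions $A_1,\dots,A_{2\alpha-1}$, each an affine function of $(u,v)$, such that for all $(u,v)\in\mathbb R_+^2$ $$\mathbb P_{(u,v)}(T<\infty)=\sum_{k=1}^{2\alpha-1}A_k(u,v)\exp(a_ku+b_kv).$$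
   Context: Parameters. $\Sigma=(\sigma_{ij})_{1\le i,j\le 2}$ is a real symmetric positive-definite matrix, $\mu=(\mu_1,\mu_2)$ with $\mu_1,\mu_2>0$, $r_1,r_2\in\mathbb R$, $R^1=(1,-r_1)$, $R^2=(-r_2,1)$, and $R$ is the matrix with columns $R^1,R^2$. The angles $\beta\in(0,\pi)$, $\theta\in(0,\beta)$, $\delta,\varepsilon\in(0,\pi)$ are defined by $$\cos\beta=\frac{-\sigma_{12}}{\sqrt{\sigma_{11}\sigma_{22}}},\quad \tan\theta=\frac{\mu_2\sqrt{\det\Sigma}}{\sigma_{22}\mu_1-\sigma_{12}\mu_2},\quad \tan\delta=\frac{-\sqrt{\det\Sigma}}{r_2\sigma_{22}+\sigma_{12}},\quad \tan\varepsilon=\frac{-\sqrt{\det\Sigma}}{\sigma_{11}r_1+\sigma_{12}}$$ (an angle is $\pi/2$ when the denominator of its tangent is zero), and $\alpha:=\frac{\delta+\varepsilon-\pi}{\beta}$. Process. $Z=(Z_t)_{0\le t\le T}$ is the Brownian motion in the quadrant $\mathbb R_+^2$ ($\mathbb R_+=[0,\infty)$) with covariance matrix $\Sigma$ and drift $\mu$, obliquely reflected along $R^1$ on $\{0\}\times\mathbb R_+$ and along $R^2$ on $\mathbb R_+\times\{0\}$, and absorbed at the vertex $0$: under $\mathbb P_{(u,v)}$, $Z_t=(u,v)+W_t+\mu t+RL_t\in\mathbb R_+^2$ up to time $T$, where $W$ is a centred Brownian motion with covariance $\Sigma$ started at $0$, $L=(L^1,L^2)$ is adapted with continuous nondecreasing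 components started at $0$, $L^i$ increases only when the $i$-th coordinate of $Z$ is $0$, and $T=\inf\{t>0: Z_t=0\}$ is the hitting time of the vertex ($T=0$ if $(u,v)=(0,0)$). For $\alpha\ge1$ this process exists and is unique in law. Uniformization. Put $x^\pm=\frac{(\mu_2\sigma_{12}-\mu_1\sigma_{22})\pm\sqrt{(\mu_2\sigma_{12}-\mu_1\sigma_{22})^2+\det(\Sigma)\mu_2^2}}{\det\Sigma}$, $y^\pm=\frac{(\mu_1\sigma_{12}-\mu_2\sigma_{11})\pm\sqrt{(\mu_1\sigma_{12}-\mu_2\sigma_{11})^2+\det(\Sigma)\mu_1^2}}{\det\Sigma}$, and for $s\in\mathbb C^*$ $$\mathbf x(s)=\tfrac{x^++x^-}{2}+\tfrac{x^+-x^-}{4}\big(s+\tfrac1s\big),\qquad \mathbf y(s)=\tfrac{y^++y^-}{2}+\tfrac{y^+-y^-}{4}\big(\tfrac{s}{e^{i\beta}}+\tfrac{e^{i\beta}}{s}\big).$$ Also $\mathbf q=e^{2i\beta}$, $s_1=e^{i(\theta+2\varepsilon)}$. *)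

theory Defs
  imports "HOL-Probability.Probability"
begin

section \<open>Brownian motion with a covariance matrix\<close>

text \<open>A centred Brownian motion started at the origin, relative to a filtration \<open>F\<close>, with
  nondegenerate covariance matrix \<open>\<Sigma>\<close>. Only times \<open>t \<ge> 0\<close> matter. That the increments are
  centred Gaussian vectors with covariance \<open>(t - s) \<Sigma>\<close> is expressed by the law of their nonzero
  linear functionals. Paths are continuous everywhere, not just almost surely, so that
  hitting events are measurable without completing the probability space.\<close>

definition brownian_motion_cov ::
    "'w measure \<Rightarrow> (real \<Rightarrow> 'w measure) \<Rightarrow> real^2^2 \<Rightarrow> (real \<Rightarrow> 'w \<Rightarrow> real^2) \<Rightarrow> bool" where
  "brownian_motion_cov M F \<Sigma> W \<longleftrightarrow>
     prob_space M \<and> filtration (space M) F \<and> (\<forall>t. subalgebra M (F t)) \<and>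
     (\<forall>t\<ge>0. W t \<in> borel_measurable (F t)) \<and>
     (\<forall>\<omega>\<in>space M. W 0 \<omega> = 0 \<and> continuous_on {0..} (\<lambda>t. W t \<omega>)) \<and>
     (\<forall>s t. 0 \<le> s \<longrightarrow> s < t \<longrightarrow>
        prob_space.indep_set M (sets (F s))
          (sets (vimage_algebra (space M) (\<lambda>\<omega>. W t \<omega> - W s \<omega>) borel)) \<and>
        (\<forall>c. c \<noteq> 0 \<longrightarrow>
          distributed M lborel (\<lambda>\<omega>. c \<bullet> (W t \<omega> - W s \<omega>))
            (normal_density 0 (sqrt ((t - s) * (c \<bullet> (\<Sigma> *v c)))))))"

section \<open>Obliquely reflected Brownian motion absorbed at the vertex\<close>

definition quadrant :: "(real^2) set" where
  "quadrant = {z. 0 \<le> z $ 1 \<and> 0 \<le> z $ 2}"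

definition reflection_matrix :: "real \<Rightarrow> real \<Rightarrow> real^2^2" where
  "reflection_matrix r1 r2 = transpose (vector [vector [1, - r1], vector [- r2, 1]])"

definition vertex_time :: "real^2 \<Rightarrow> (real \<Rightarrow> 'w \<Rightarrow> real^2) \<Rightarrow> 'w \<Rightarrow> ereal" where
  "vertex_time z Z \<omega> = (if z = 0 then 0 else Inf {ereal t |t. 0 < t \<and> Z t \<omega> = 0})"

text \<open>\<open>absorbed_rbm \<Sigma> \<mu> r1 r2 z M F W L Z\<close>: on the filtered probability space \<open>(M, F)\<close>, the process
  \<open>Z\<close> started at \<open>z\<close> is driven by the Brownian motion \<open>W\<close> with pushing process \<open>L\<close> up to the
  hitting time of the vertex, and stays at the vertex from then on. The last conjunct says that
  the \<open>i\<close>-th component of \<open>L\<close> increases only when the \<open>i\<close>-th coordinate of \<open>Z\<close> is zero.\<close>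

definition absorbed_rbm ::
    "real^2^2 \<Rightarrow> real^2 \<Rightarrow> real \<Rightarrow> real \<Rightarrow> real^2 \<Rightarrow> 'w measure \<Rightarrow> (real \<Rightarrow> 'w measure) \<Rightarrow>
     (real \<Rightarrow> 'w \<Rightarrow> real^2) \<Rightarrow> (real \<Rightarrow> 'w \<Rightarrow> real^2) \<Rightarrow> (real \<Rightarrow> 'w \<Rightarrow> real^2) \<Rightarrow> bool" where
  "absorbed_rbm \<Sigma> \<mu> r1 r2 z M F W L Z \<longleftrightarrow>
     brownian_motion_cov M F \<Sigma> W \<and>
     (\<forall>t\<ge>0. Z t \<in> borel_measurable (F t) \<and> L t \<in> borel_measurable (F t)) \<and>
     (\<forall>\<omega>\<in>space M.
        continuous_on {0..} (\<lambda>t. Z t \<omega>) \<and>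
        (\<forall>t\<ge>0. ereal t \<le> vertex_time z Z \<omega> \<longrightarrow>
           Z t \<omega> = z + W t \<omega> + t *\<^sub>R \<mu> + reflection_matrix r1 r2 *v L t \<omega> \<and>
           Z t \<omega> \<in> quadrant) \<and>
        (\<forall>t\<ge>0. vertex_time z Z \<omega> \<le> ereal t \<longrightarrow> Z t \<omega> = 0) \<and>
        L 0 \<omega> = 0 \<and> continuous_on {0..} (\<lambda>t. L t \<omega>) \<and>
        (\<forall>i. mono_on {0..} (\<lambda>t. L t \<omega> $ i)) \<and>
        (\<forall>i s t. 0 \<le> s \<longrightarrow> s \<le> t \<longrightarrow> (\<forall>r\<in>{s..t}. 0 < Z r \<omega> $ i) \<longrightarrow> L s \<omega> $ i = L t \<omega> $ i))"

section \<open>Angles and uniformization\<close>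

text \<open>The angle has tangent \<open>p / q\<close>, and is a right angle if \<open>q = 0\<close>.\<close>

definition has_tangent :: "real \<Rightarrow> real \<Rightarrow> real \<Rightarrow> bool" where
  "has_tangent \<phi> p q \<longleftrightarrow> (if q = 0 then \<phi> = pi / 2 else tan \<phi> = p / q)"

text \<open>The branch points; the sign \<open>e = 1\<close> or \<open>e = -1\<close> selects \<open>x\<^sup>+\<close> or \<open>x\<^sup>-\<close>
  (respectively \<open>y\<^sup>+\<close> or \<open>y\<^sup>-\<close>).\<close>

definition x_branch :: "real^2^2 \<Rightarrow> real^2 \<Rightarrow> real \<Rightarrow> real" where
  "x_branch \<Sigma> \<mu> e =
     ((\<mu>$2 * \<Sigma>$1$2 - \<mu>$1 * \<Sigma>$2$2)
       + e * sqrt ((\<mu>$2 * \<Sigma>$1$2 - \<mu>$1 * \<Sigma>$2$2)\<^sup>2 + det \<Sigma> * (\<mu>$2)\<^sup>2)) / det \<Sigma>"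

definition y_branch :: "real^2^2 \<Rightarrow> real^2 \<Rightarrow> real \<Rightarrow> real" where
  "y_branch \<Sigma> \<mu> e =
     ((\<mu>$1 * \<Sigma>$1$2 - \<mu>$2 * \<Sigma>$1$1)
       + e * sqrt ((\<mu>$1 * \<Sigma>$1$2 - \<mu>$2 * \<Sigma>$1$1)\<^sup>2 + det \<Sigma> * (\<mu>$1)\<^sup>2)) / det \<Sigma>"

definition x_unif :: "real^2^2 \<Rightarrow> real^2 \<Rightarrow> complex \<Rightarrow> complex" where
  "x_unif \<Sigma> \<mu> s =
     of_real ((x_branch \<Sigma> \<mu> 1 + x_branch \<Sigma> \<mu> (-1)) / 2)
     + of_real ((x_branch \<Sigma> \<mu> 1 - x_branch \<Sigma> \<mu> (-1)) / 4) * (s + 1 / s)"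

definition y_unif :: "real^2^2 \<Rightarrow> real^2 \<Rightarrow> real \<Rightarrow> complex \<Rightarrow> complex" where
  "y_unif \<Sigma> \<mu> \<beta> s =
     of_real ((y_branch \<Sigma> \<mu> 1 + y_branch \<Sigma> \<mu> (-1)) / 2)
     + of_real ((y_branch \<Sigma> \<mu> 1 - y_branch \<Sigma> \<mu> (-1)) / 4) * (s / cis \<beta> + cis \<beta> / s)"

end

theory Submission
  imports Defs
begin

text \<open>The probability of hitting the vertex is found by guessing it. Let \<open>G\<close> be the generator
\<open>f \<mapsto> (1/2) \<Sum> \<Sigma>\<^sub>j\<^sub>k \<partial>\<^sub>j \<partial>\<^sub>k f + \<mu> \<bullet> \<nabla>f\<close> of the free motion. If \<open>f\<close> is bounded and smooth on
the quadrant, \<open>G f = 0\<close>, the derivative of \<open>f\<close> along \<open>R\<^sup>j\<close> vanishes on the axis \<open>z\<^sub>j = 0\<close>,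
and \<open>f\<close> tends to \<open>0\<close> at infinity, then \<open>f(Z\<^sub>t)\<close> has constant expectation. On the event
\<open>T < \<infinity>\<close> the process ends in \<open>0\<close>, on the complement it is far away at suitable late times, so
\<open>f(z) = f(0) P\<^sub>z(T < \<infinity>)\<close> (\<open>hitting_probability\<close>), and the probability is \<open>f(z) / f(0)\<close> as soon as
\<open>f(0) \<noteq> 0\<close>. 

The constant expectation comes from a second-order Taylor expansion of \<open>f\<close> along a fine time grid
(\<open>dynkin_le\<close>), in place of Ito's formula: the Gaussian moments of an increment produce \<open>G f\<close>, and
the pushing process contributes only when the path is close to an axis, where the derivative of \<open>f\<close>
in the direction of the push is close to \<open>0\<close>. Transience follows from the same inequality
applied to \<open>- exp (p \<bullet> z)\<close> for a suitable \<open>p < 0\<close> (\<open>occupation_small\<close>); such a \<open>p\<close> exists because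
\<open>\<alpha> > 1\<close> forces \<open>r\<^sub>1 r\<^sub>2 > 1\<close> with \<open>r\<^sub>1, r\<^sub>2 > 0\<close> (\<open>reflection_strong\<close>), that is, both
reflections push strongly towards the vertex.

The function \<open>f\<close> is built from exponentials \<open>exp (p \<bullet> z)\<close>. Such an exponential is
annihilated by \<open>G\<close> exactly when \<open>p\<close> lies on an ellipse, parametrized by an angle \<open>w\<close>; with
\<open>p(w)\<close> also the derivative \<open>(p'(w) \<bullet> z) exp (p(w) \<bullet> z)\<close> is annihilated. The boundary condition on an axis
links two points of the ellipse that share the coordinate still visible there, namely \<open>w\<close> and its reflection
\<open>- w\<close> (horizontal axis) or \<open>2 \<beta> - w\<close> (vertical axis). Alternating the two reflections gives a chain of
\<open>2 \<alpha> - 1\<close> points, at whose two ends the exponential satisfies one of the boundary conditions by itself.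
Resonance says \<open>\<theta> + 2 \<epsilon> = \<pi> + l \<beta>\<close> for an integer \<open>l\<close> with \<open>2 \<le> l \<le> 2 \<alpha> - 1\<close>
(\<open>resonance_index\<close>); then the chain folds: its points \<open>l - 1\<close> and \<open>l\<close> coincide, and so on
outwards, in a fixed point of one of the reflections. Coefficients \<open>C\<^sub>r + D\<^sub>r p'(w\<^sub>r) \<bullet> z\<close> can be chosen
recursively along the longer half of the folded chain, starting at the fold
(\<open>chain_solution\<close>): the affine parts \<open>D\<^sub>r\<close> vanish
once the end of the shorter half is passed, so that at the far end only a pure exponential remains, and this one satisfies
the last boundary condition.

Finally \<open>f(0) \<noteq> 0\<close>: otherwise a maximum principle (\<open>zero_at_vertex_imp_zero\<close>) forces \<open>f = 0\<close> on the
quadrant, against the linear independence of affine functions times distinct exponentials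
(\<open>affexp_independent\<close>).\<close>


section \<open>Moments and independence of Brownian increments\<close>

lemma normal_moments:
  assumes "prob_space M" and s: "0 < \<sigma>" and D: "distributed M lborel X (normal_density 0 \<sigma>)"
  shows "integrable M X" "(\<integral>\<omega>. X \<omega> \<partial>M) = 0"
    "integrable M (\<lambda>\<omega>. (X \<omega>)\<^sup>2)" "(\<integral>\<omega>. (X \<omega>)\<^sup>2 \<partial>M) = \<sigma>\<^sup>2"
    "integrable M (\<lambda>\<omega>. \<bar>X \<omega>\<bar> ^ 3)" "(\<integral>\<omega>. \<bar>X \<omega>\<bar> ^ 3 \<partial>M) \<le> 2 * \<sigma> ^ 3"
proof -
  interpret prob_space M by fact
  show 1: "integrable M X"
    using distributed_integrable_var[OF D] integrable_normal_moment[OF s, of 0 1] by simp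
  show 2: "(\<integral>\<omega>. X \<omega> \<partial>M) = 0"
    using normal_distributed_expectation[OF s D] .
  show "integrable M (\<lambda>\<omega>. (X \<omega>)\<^sup>2)"
    using distributed_integrable[OF D, of "\<lambda>x. x\<^sup>2"] integrable_normal_moment[OF s, of 0 2] by simp
  show "(\<integral>\<omega>. (X \<omega>)\<^sup>2 \<partial>M) = \<sigma>\<^sup>2"
    using normal_distributed_variance[OF s D] 2 by simp
  show "integrable M (\<lambda>\<omega>. \<bar>X \<omega>\<bar> ^ 3)"
    using distributed_integrable[OF D, of "\<lambda>x. \<bar>x\<bar>^3"] integrable_normal_moment_abs[OF s, of 0 3] by simp
  have "(\<integral>\<omega>. \<bar>X \<omega>\<bar> ^ 3 \<partial>M) = 2 * \<sigma> ^ 3 * sqrt (2 / pi)"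
    using distributed_integral[OF D, of "\<lambda>x. \<bar>x\<bar>^3"] integral_normal_moment_abs_odd[OF s, of 0 1]
    by (simp add: numeral_3_eq_3 mult_ac)
  moreover have "sqrt (2 / pi) \<le> 1" using pi_ge_two by simp
  ultimately show "(\<integral>\<omega>. \<bar>X \<omega>\<bar> ^ 3 \<partial>M) \<le> 2 * \<sigma> ^ 3"
    using s mult_left_mono[of "sqrt (2 / pi)" 1 "2*\<sigma>^3"] by simp
qed

lemma (in prob_space) indep_set_mono:
  assumes "indep_set A B" "A' \<subseteq> A" "B' \<subseteq> B"
  shows "indep_set A' B'"
  using assms unfolding indep_sets2_eq by blast

lemma cube_sum_le: "0 \<le> p \<Longrightarrow> 0 \<le> q \<Longrightarrow> (p + q) ^ 3 \<le> 4 * (p ^ 3 + q ^ 3)" for p q :: real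
proof -
  assume "0 \<le> p" "0 \<le> q"
  then have "0 \<le> 3 * (p + q) * (p - q)\<^sup>2" by simp
  moreover have "4 * (p ^ 3 + q ^ 3) - (p + q) ^ 3 = 3 * (p + q) * (p - q)\<^sup>2"
    by (simp add: power3_eq_cube power2_eq_square algebra_simps)
  ultimately show ?thesis by linarith
qed

locale brownian =
  fixes M :: "'w measure" and F :: "real \<Rightarrow> 'w measure" and \<Sigma> :: "real^2^2"
    and W :: "real \<Rightarrow> 'w \<Rightarrow> real^2"
  assumes bm: "brownian_motion_cov M F \<Sigma> W"
    and symmetric: "transpose \<Sigma> = \<Sigma>"
    and positive_definite: "\<And>c. c \<noteq> 0 \<Longrightarrow> 0 < c \<bullet> (\<Sigma> *v c)"
begin

sublocale prob_space M
  using bm by (simp add: brownian_motion_cov_def)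

lemma space_F: "space (F t) = space M" and sets_F: "sets (F t) \<subseteq> sets M"
  using bm by (auto simp: brownian_motion_cov_def subalgebra_def)

lemma measurable_F: "X \<in> measurable (F t) N \<Longrightarrow> X \<in> measurable M N"
  by (rule measurable_from_subalg[of M "F t"]) (simp_all add: subalgebra_def space_F sets_F)

lemma W_measurable: "0 \<le> t \<Longrightarrow> W t \<in> borel_measurable M"
  by (rule measurable_F[of _ t]) (use bm in \<open>auto simp: brownian_motion_cov_def\<close>)

lemma W_continuous: "\<omega> \<in> space M \<Longrightarrow> continuous_on {0..} (\<lambda>t. W t \<omega>)"
  and W_0: "\<omega> \<in> space M \<Longrightarrow> W 0 \<omega> = 0"
  using bm by (auto simp: brownian_motion_cov_def)

lemma increment_distributed:
  assumes "0 \<le> s" "s < t" "c \<noteq> 0"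
  shows "distributed M lborel (\<lambda>\<omega>. c \<bullet> (W t \<omega> - W s \<omega>))
            (normal_density 0 (sqrt ((t - s) * (c \<bullet> (\<Sigma> *v c)))))"
  using bm assms by (auto simp: brownian_motion_cov_def)

lemmas increment_moments =
  normal_moments[OF prob_space_axioms _ increment_distributed]

lemma increment_sd_pos: "s < t \<Longrightarrow> c \<noteq> 0 \<Longrightarrow> 0 < sqrt ((t - s) * (c \<bullet> (\<Sigma> *v c)))"
  using positive_definite[of c] by simp

lemma sigma_sym: "\<Sigma> $ j $ k = \<Sigma> $ k $ j"
  using arg_cong[OF symmetric, of "\<lambda>A. A $ k $ j"] by (simp add: transpose_def)

lemma axis_form: "axis j 1 \<bullet> (\<Sigma> *v axis k 1) = \<Sigma> $ j $ k"
  by (simp add: inner_axis' matrix_vector_mul_component inner_axis)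

lemma increment_integrable_moment:
  assumes "0 \<le> s" "s < t"
  shows "integrable M (\<lambda>\<omega>. (W t \<omega> - W s \<omega>) $ j)" "expectation (\<lambda>\<omega>. (W t \<omega> - W s \<omega>) $ j) = 0"
  using increment_moments(1,2)[OF increment_sd_pos assms, of "axis j 1"] assms
  by (simp_all add: inner_axis' axis_eq_0_iff)

text \<open>The definition of Brownian motion only gives the laws of linear functionals, so the mixed moment is
recovered by polarization from the functional \<open>w \<mapsto> w\<^sub>j + w\<^sub>k\<close>.\<close>

lemma increment_covariance:
  assumes "0 \<le> s" "s < t"
  shows "integrable M (\<lambda>\<omega>. (W t \<omega> - W s \<omega>) $ j * (W t \<omega> - W s \<omega>) $ k)" (is ?I)
    "expectation (\<lambda>\<omega>. (W t \<omega> - W s \<omega>) $ j * (W t \<omega> - W s \<omega>) $ k) = (t - s) * \<Sigma> $ j $ k" (is ?E)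
proof -
  let ?X = "\<lambda>j \<omega>. (W t \<omega> - W s \<omega>) $ j"
  have sq: "integrable M (\<lambda>\<omega>. (?X j \<omega>)\<^sup>2)" "expectation (\<lambda>\<omega>. (?X j \<omega>)\<^sup>2) = (t - s) * \<Sigma> $ j $ j" for j
    using increment_moments(3,4)[OF increment_sd_pos assms, of "axis j 1"] assms
      positive_definite[of "axis j 1"]
    by (simp_all add: inner_axis' axis_eq_0_iff matrix_vector_mul_component inner_axis)
  have "?I \<and> ?E"
  proof (cases "j = k")
    case True
    then show ?thesis using sq[of k] by (simp add: power2_eq_square)
  next
    case False
    define c where "c = axis j 1 + (axis k 1 :: real^2)"
    have c: "c \<noteq> 0"
    proof
      assume "c = 0"
      then have "c $ j = 0" by simp
      then show False using False by (simp add: c_def axis_def)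
    qed
    have cX: "c \<bullet> (W t \<omega> - W s \<omega>) = ?X j \<omega> + ?X k \<omega>" for \<omega>
      by (simp add: c_def inner_add_left inner_axis')
    have cc: "c \<bullet> (\<Sigma> *v c) = \<Sigma> $ j $ j + 2 * \<Sigma> $ j $ k + \<Sigma> $ k $ k"
      by (simp add: c_def inner_add_left matrix_vector_right_distrib inner_add_right axis_form sigma_sym[of k j])
    have csq: "integrable M (\<lambda>\<omega>. (?X j \<omega> + ?X k \<omega>)\<^sup>2)"
      "expectation (\<lambda>\<omega>. (?X j \<omega> + ?X k \<omega>)\<^sup>2) = (t - s) * (\<Sigma> $ j $ j + 2 * \<Sigma> $ j $ k + \<Sigma> $ k $ k)"
      using increment_moments(3,4)[OF increment_sd_pos assms c] assms c positive_definite[OF c]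
      unfolding cX cc by simp_all
    have eq: "(\<lambda>\<omega>. ?X j \<omega> * ?X k \<omega>) = (\<lambda>\<omega>. ((?X j \<omega> + ?X k \<omega>)\<^sup>2 - (?X j \<omega>)\<^sup>2 - (?X k \<omega>)\<^sup>2) / 2)"
      by (rule ext) (simp add: power2_eq_square field_simps)
    have ?I unfolding eq by (intro integrable_divide Bochner_Integration.integrable_diff csq sq)
    moreover have ?E
      unfolding eq integral_divide_zero
        Bochner_Integration.integral_diff[OF Bochner_Integration.integrable_diff[OF csq(1) sq(1)] sq(1)]
        Bochner_Integration.integral_diff[OF csq(1) sq(1)] csq(2) sq(2)
      by (simp add: field_simps)
    ultimately show ?thesis ..
  qed
  then show ?I ?E by auto
qed

text \<open>The power \<open>3/2\<close> of the time step makes the third-order terms summable over a grid: \<open>n\<close> steps of length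
\<open>1/n\<close> contribute \<open>O(1/\<surd>n)\<close>.\<close>

lemma increment_cubed:
  assumes "0 \<le> s" "s < t"
  shows "integrable M (\<lambda>\<omega>. norm (W t \<omega> - W s \<omega>) ^ 3)" (is ?I)
    "expectation (\<lambda>\<omega>. norm (W t \<omega> - W s \<omega>) ^ 3) \<le> 8 * (sqrt (\<Sigma>$1$1) ^ 3 + sqrt (\<Sigma>$2$2) ^ 3) * sqrt (t - s) ^ 3" (is ?E)
proof -
  let ?X = "\<lambda>j \<omega>. (W t \<omega> - W s \<omega>) $ j"
  have i: "integrable M (\<lambda>\<omega>. \<bar>?X j \<omega>\<bar> ^ 3)"
     and e: "expectation (\<lambda>\<omega>. \<bar>?X j \<omega>\<bar> ^ 3) \<le> 2 * (sqrt (t - s) ^ 3 * sqrt (\<Sigma>$j$j) ^ 3)" for j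
    using increment_moments(5,6)[OF increment_sd_pos assms, of "axis j 1"] assms
    by (simp_all add: inner_axis' axis_eq_0_iff matrix_vector_mul_component inner_axis real_sqrt_mult power_mult_distrib)
  have b: "norm (x::real^2) ^ 3 \<le> 4 * (\<bar>x $ 1\<bar> ^ 3 + \<bar>x $ 2\<bar> ^ 3)" for x
  proof -
    have "norm x \<le> \<bar>x $ 1\<bar> + \<bar>x $ 2\<bar>"
      using norm_le_l1_cart[of x] by (simp add: sum_2)
    then have "norm x ^ 3 \<le> (\<bar>x $ 1\<bar> + \<bar>x $ 2\<bar>) ^ 3" by (intro power_mono) auto
    also have "\<dots> \<le> 4 * (\<bar>x $ 1\<bar> ^ 3 + \<bar>x $ 2\<bar> ^ 3)" by (rule cube_sum_le) auto
    finally show ?thesis .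
  qed
  have m: "W t \<in> borel_measurable M" "W s \<in> borel_measurable M" using W_measurable assms by auto
  have i4: "integrable M (\<lambda>\<omega>. 4 * (\<bar>?X 1 \<omega>\<bar> ^ 3 + \<bar>?X 2 \<omega>\<bar> ^ 3))"
    using i by (intro integrable_mult_right integrable_add) auto
  show ?I
    by (rule Bochner_Integration.integrable_bound[OF i4]) (use m b[of "W t _ - W s _"] in \<open>auto intro!: AE_I2\<close>)
  then have "expectation (\<lambda>\<omega>. norm (W t \<omega> - W s \<omega>) ^ 3) \<le> expectation (\<lambda>\<omega>. 4 * (\<bar>?X 1 \<omega>\<bar> ^ 3 + \<bar>?X 2 \<omega>\<bar> ^ 3))"
    by (intro integral_mono i4 b)
  also have "\<dots> = 4 * (expectation (\<lambda>\<omega>. \<bar>?X 1 \<omega>\<bar> ^ 3) + expectation (\<lambda>\<omega>. \<bar>?X 2 \<omega>\<bar> ^ 3))"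
    using i by simp
  also have "\<dots> \<le> 8 * (sqrt (\<Sigma>$1$1) ^ 3 + sqrt (\<Sigma>$2$2) ^ 3) * sqrt (t - s) ^ 3"
    using e[of 1] e[of 2] by (simp add: algebra_simps)
  finally show ?E .
qed

lemma increment_independent:
  fixes X :: "'w \<Rightarrow> real"
  assumes "0 \<le> s" "s < t" and X: "X \<in> borel_measurable (F s)" and bound: "\<And>\<omega>. \<omega> \<in> space M \<Longrightarrow> \<bar>X \<omega>\<bar> \<le> B"
    and h: "h \<in> borel_measurable borel" and int: "integrable M (\<lambda>\<omega>. h (W t \<omega> - W s \<omega>))"
  shows "integrable M (\<lambda>\<omega>. X \<omega> * h (W t \<omega> - W s \<omega>))"
    "expectation (\<lambda>\<omega>. X \<omega> * h (W t \<omega> - W s \<omega>)) = expectation X * expectation (\<lambda>\<omega>. h (W t \<omega> - W s \<omega>))"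
proof -
  let ?D = "\<lambda>\<omega>. W t \<omega> - W s \<omega>"
  have D: "?D \<in> borel_measurable M" using W_measurable assms by auto
  have XM: "X \<in> borel_measurable M" using measurable_F[OF X] .
  have iX: "integrable M X"
    by (rule integrable_const_bound[where B = B]) (use bound XM in auto)
  have ind: "indep_set (sets (F s)) (sets (vimage_algebra (space M) ?D borel))"
    using bm assms(1,2) by (auto simp: brownian_motion_cov_def)
  have "indep_var borel X borel (\<lambda>\<omega>. h (?D \<omega>))"
    unfolding indep_var_eq
  proof (intro conjI)
    show "random_variable borel X" by fact
    show "random_variable borel (\<lambda>\<omega>. h (?D \<omega>))" using D h by measurable
    have a: "sigma_sets (space M) {X -` A \<inter> space M |A. A \<in> sets borel} \<subseteq> sets (F s)"
    proof -
      have "{X -` A \<inter> space M |A. A \<in> sets borel} \<subseteq> sets (F s)"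
        using measurable_sets[OF X] by (auto simp: space_F)
      from sets.sigma_sets_subset[OF this] show ?thesis by (simp add: space_F)
    qed
    have b: "sigma_sets (space M) {(\<lambda>\<omega>. h (?D \<omega>)) -` A \<inter> space M |A. A \<in> sets borel} \<subseteq> sets (vimage_algebra (space M) ?D borel)"
    proof -
      have "(\<lambda>\<omega>. h (?D \<omega>)) \<in> borel_measurable (vimage_algebra (space M) ?D borel)"
        by (rule measurable_compose[OF measurable_vimage_algebra1 h]) auto
      then have "{(\<lambda>\<omega>. h (?D \<omega>)) -` A \<inter> space M |A. A \<in> sets borel} \<subseteq> sets (vimage_algebra (space M) ?D borel)"
        using measurable_sets[of "\<lambda>\<omega>. h (?D \<omega>)" "vimage_algebra (space M) ?D borel" borel] by auto
      from sets.sigma_sets_subset[OF this] show ?thesis by simp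
    qed
    show "indep_set (sigma_sets (space M) {X -` A \<inter> space M |A. A \<in> sets borel})
     (sigma_sets (space M) {(\<lambda>\<omega>. h (?D \<omega>)) -` A \<inter> space M |A. A \<in> sets borel})"
      using ind a b by (rule indep_set_mono)
  qed
  from indep_var_integrable[OF this iX int] indep_var_lebesgue_integral[OF this iX int]
  show "integrable M (\<lambda>\<omega>. X \<omega> * h (?D \<omega>))"
    "expectation (\<lambda>\<omega>. X \<omega> * h (?D \<omega>)) = expectation X * expectation (\<lambda>\<omega>. h (?D \<omega>))" by auto
qed

end

section \<open>Test functions and one step of the process\<close>

text \<open>The properties of a smooth function that the expansion along a grid uses, with the gradient
\<open>g\<close> and the Hessian \<open>H\<close> as data. The bounds are required on the quadrant only, because the exponentials of interest
grow outside; continuity on the whole plane is a convenience for measurability.\<close>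

definition taylor_bounded ::
    "real \<Rightarrow> (real^2 \<Rightarrow> real) \<Rightarrow> (real^2 \<Rightarrow> real^2) \<Rightarrow> (real^2 \<Rightarrow> real^2^2) \<Rightarrow> bool" where
  "taylor_bounded K f g H \<longleftrightarrow>
     0 \<le> K \<and> continuous_on UNIV f \<and> continuous_on UNIV g \<and> (\<forall>j k. continuous_on UNIV (\<lambda>z. H z $ j $ k)) \<and>
     (\<forall>z\<in>quadrant. \<bar>f z\<bar> \<le> K \<and> norm (g z) \<le> K \<and> (\<forall>x y. \<bar>x \<bullet> (H z *v y)\<bar> \<le> K * norm x * norm y) \<and>
       (\<forall>z'\<in>quadrant. norm (g z' - g z) \<le> K * norm (z' - z) \<and>
         \<bar>f z' - f z - g z \<bullet> (z' - z) - (z' - z) \<bullet> (H z *v (z' - z)) / 2\<bar> \<le> K * norm (z' - z) ^ 3))"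

definition generator :: "real^2^2 \<Rightarrow> real^2 \<Rightarrow> (real^2 \<Rightarrow> real^2) \<Rightarrow> (real^2 \<Rightarrow> real^2^2) \<Rightarrow> real^2 \<Rightarrow> real" where
  "generator \<Sigma> \<mu> g H z = g z \<bullet> \<mu> + (\<Sum>j\<in>UNIV. \<Sum>k\<in>UNIV. \<Sigma> $ j $ k * H z $ j $ k) / 2"

definition refl_dir :: "real \<Rightarrow> real \<Rightarrow> 2 \<Rightarrow> real^2" where
  "refl_dir r1 r2 j = column j (reflection_matrix r1 r2)"

lemma refl_dir_simps: "refl_dir r1 r2 1 = vector [1, - r1]" "refl_dir r1 r2 2 = vector [- r2, 1]"
  by (simp_all add: refl_dir_def reflection_matrix_def column_def transpose_def vec_eq_iff forall_2)

lemma reflection_matrix_mult: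
  "reflection_matrix r1 r2 *v l = l $ 1 *\<^sub>R refl_dir r1 r2 1 + l $ 2 *\<^sub>R refl_dir r1 r2 2"
  by (simp add: matrix_mult_sum sum_2 scalar_mult_eq_scaleR refl_dir_def)

lemma taylor_boundedD:
  assumes "taylor_bounded K f g H"
  shows "0 \<le> K" "continuous_on UNIV f" "continuous_on UNIV g" "continuous_on UNIV (\<lambda>z. H z $ j $ k)"
    "z \<in> quadrant \<Longrightarrow> \<bar>f z\<bar> \<le> K" "z \<in> quadrant \<Longrightarrow> norm (g z) \<le> K"
    "z \<in> quadrant \<Longrightarrow> \<bar>x \<bullet> (H z *v y)\<bar> \<le> K * norm x * norm y"
    "z \<in> quadrant \<Longrightarrow> z' \<in> quadrant \<Longrightarrow> norm (g z' - g z) \<le> K * norm (z' - z)"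
    "z \<in> quadrant \<Longrightarrow> z' \<in> quadrant \<Longrightarrow>
       \<bar>f z' - f z - g z \<bullet> (z' - z) - (z' - z) \<bullet> (H z *v (z' - z)) / 2\<bar> \<le> K * norm (z' - z) ^ 3"
  using assms unfolding taylor_bounded_def by blast+

lemma taylor_bounded_inner: "taylor_bounded K f g H \<Longrightarrow> z \<in> quadrant \<Longrightarrow> \<bar>g z \<bullet> v\<bar> \<le> K * norm v"
  using taylor_boundedD(6)[of K f g H z] Cauchy_Schwarz_ineq2[of "g z" v]
    mult_right_mono[of "norm (g z)" K "norm v"] by fastforce

lemma taylor_bounded_generator:
  assumes "taylor_bounded K f g H"
  obtains K' where "0 \<le> K'" "\<And>z. z \<in> quadrant \<Longrightarrow> \<bar>generator \<Sigma> \<mu> g H z\<bar> \<le> K'"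
proof -
  have K: "0 \<le> K" using taylor_boundedD(1)[OF assms] .
  define K' where "K' = K * norm \<mu> + (\<Sum>j\<in>UNIV. \<Sum>k\<in>UNIV. \<bar>\<Sigma> $ j $ k\<bar> * K)"
  have "0 \<le> K'" unfolding K'_def using K by (intro add_nonneg_nonneg mult_nonneg_nonneg sum_nonneg) auto
  moreover have "\<bar>generator \<Sigma> \<mu> g H z\<bar> \<le> K'" if "z \<in> quadrant" for z
  proof -
    have H: "\<bar>H z $ j $ k\<bar> \<le> K" for j k
      using taylor_boundedD(7)[OF assms that, of "axis j 1" "axis k 1"]
      by (simp add: inner_axis' matrix_vector_mul_component inner_axis)
    have "\<bar>\<Sum>j\<in>UNIV. \<Sum>k\<in>UNIV. \<Sigma> $ j $ k * H z $ j $ k\<bar> \<le> (\<Sum>j\<in>UNIV. \<Sum>k\<in>UNIV. \<bar>\<Sigma> $ j $ k\<bar> * K)"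
      by (intro order_trans[OF sum_abs] sum_mono) (simp add: abs_mult H mult_left_mono)
    then show ?thesis
      using taylor_bounded_inner[OF assms that, of \<mu>] unfolding generator_def K'_def by linarith
  qed
  ultimately show ?thesis by (rule that)
qed

text \<open>What is left of an increment of \<open>f\<close> after the terms driven by the Brownian increment \<open>w\<close> and by the
drift over a time step \<open>h\<close> have been removed.\<close>

definition step_rest :: "real^2 \<Rightarrow> (real^2 \<Rightarrow> real) \<Rightarrow> (real^2 \<Rightarrow> real^2) \<Rightarrow> (real^2 \<Rightarrow> real^2^2) \<Rightarrow>
    real \<Rightarrow> real^2 \<Rightarrow> real^2 \<Rightarrow> real^2 \<Rightarrow> real" where
  "step_rest \<mu> f g H h w z z' = f z' - f z - g z \<bullet> w - w \<bullet> (H z *v w) / 2 - h * (g z \<bullet> \<mu>)"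

text \<open>Only the first-order effect of the pushes \<open>l1, l2\<close> survives at leading order; all other terms are of order
three in \<open>w\<close> or contain the factor \<open>S\<close> together with another small factor.\<close>

lemma step_rest_push:
  assumes tb: "taylor_bounded K f g H" and q: "z \<in> quadrant" "z' \<in> quadrant"
    and h: "0 \<le> h" and l: "0 \<le> l1" "0 \<le> l2"
    and inc: "z' - z = w + (h *\<^sub>R \<mu> + (l1 *\<^sub>R R1 + l2 *\<^sub>R R2))"
  defines "c \<equiv> norm \<mu> + norm R1 + norm R2" and "S \<equiv> h + l1 + l2"
  shows "step_rest \<mu> f g H h w z z' \<le> l1 * (g z \<bullet> R1) + l2 * (g z \<bullet> R2)
           + K * c * norm w * S + K * c ^ 2 * S ^ 2 + 4 * K * norm w ^ 3 + 4 * K * c ^ 3 * S ^ 3"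
proof -
  define V where "V = h *\<^sub>R \<mu> + (l1 *\<^sub>R R1 + l2 *\<^sub>R R2)"
  have K: "0 \<le> K" using taylor_boundedD(1)[OF tb] .
  have S: "0 \<le> S" and c: "0 \<le> c" using h l by (auto simp: S_def c_def)
  have "norm V \<le> norm (h *\<^sub>R \<mu>) + (norm (l1 *\<^sub>R R1) + norm (l2 *\<^sub>R R2))"
    unfolding V_def by (intro order_trans[OF norm_triangle_ineq] add_mono order_refl)
  also have "\<dots> = h * norm \<mu> + (l1 * norm R1 + l2 * norm R2)" using h l by simp
  also have "\<dots> \<le> S * norm \<mu> + (S * norm R1 + S * norm R2)"
    using h l by (intro add_mono mult_right_mono) (auto simp: S_def)
  also have "\<dots> = c * S" by (simp add: c_def algebra_simps)
  finally have V: "norm V \<le> c * S" .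
  have "norm (z' - z) \<le> norm w + c * S"
    unfolding inc using norm_triangle_ineq[of w V] V by (simp add: V_def)
  then have "norm (z' - z) ^ 3 \<le> (norm w + c * S) ^ 3" by (intro power_mono) auto
  also have "\<dots> \<le> 4 * (norm w ^ 3 + (c * S) ^ 3)" using c S by (intro cube_sum_le) auto
  finally have cube: "K * norm (z' - z) ^ 3 \<le> K * (4 * (norm w ^ 3 + (c * S) ^ 3))"
    using K by (rule mult_left_mono)
  have wV: "\<bar>w \<bullet> (H z *v V)\<bar> \<le> K * norm w * (c * S)" 
    using order_trans[OF taylor_boundedD(7)[OF tb q(1), of w V] mult_left_mono[OF V, of "K * norm w"]] K by simp
  have "\<bar>V \<bullet> (H z *v w)\<bar> \<le> K * norm V * norm w" by (rule taylor_boundedD(7)[OF tb q(1)])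
  also have "\<dots> = K * norm w * norm V" by simp
  also have "\<dots> \<le> K * norm w * (c * S)" using K V by (intro mult_left_mono) auto
  finally have Vw: "\<bar>V \<bullet> (H z *v w)\<bar> \<le> K * norm w * (c * S)" .
  have "\<bar>V \<bullet> (H z *v V)\<bar> \<le> K * norm V * norm V" by (rule taylor_boundedD(7)[OF tb q(1)])
  also have "\<dots> \<le> K * (c * S) * (c * S)" using K V c S by (intro mult_mono) auto
  finally have VV: "\<bar>V \<bullet> (H z *v V)\<bar> \<le> K * (c * S)\<^sup>2" by (simp add: power2_eq_square mult_ac)
  have z': "z' - z = w + V" using inc by (simp add: V_def)
  have "f z' - f z - g z \<bullet> (w + V) - (w + V) \<bullet> (H z *v (w + V)) / 2 \<le> K * norm (z' - z) ^ 3"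
    using taylor_boundedD(9)[OF tb q] unfolding z' by linarith
  moreover have "(w + V) \<bullet> (H z *v (w + V)) = w \<bullet> (H z *v w) + w \<bullet> (H z *v V) + V \<bullet> (H z *v w) + V \<bullet> (H z *v V)"
    by (simp add: matrix_vector_right_distrib inner_add_left inner_add_right)
  moreover have "g z \<bullet> (w + V) = g z \<bullet> w + h * (g z \<bullet> \<mu>) + l1 * (g z \<bullet> R1) + l2 * (g z \<bullet> R2)"
    by (simp add: V_def inner_add_right)
  moreover have "K * (c * S)\<^sup>2 \<ge> 0" using K by simp
  ultimately have "step_rest \<mu> f g H h w z z' \<le> l1 * (g z \<bullet> R1) + l2 * (g z \<bullet> R2)
     + K * norm w * (c * S) + K * (c * S)\<^sup>2 + K * (4 * (norm w ^ 3 + (c * S) ^ 3))"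
    using cube wV Vw VV unfolding step_rest_def by linarith
  then show ?thesis by (simp add: power_mult_distrib algebra_simps)
qed

lemma step_rest_rough:
  assumes tb: "taylor_bounded K f g H" and q: "z \<in> quadrant" "z' \<in> quadrant"
    and h: "0 \<le> h"
  shows "step_rest \<mu> f g H h w z z' \<le> f z' - f z + K * norm w + K * norm w ^ 2 + h * K * norm \<mu>"
proof -
  have "\<bar>g z \<bullet> w\<bar> \<le> K * norm w" "\<bar>g z \<bullet> \<mu>\<bar> \<le> K * norm \<mu>" using taylor_bounded_inner[OF tb q(1)] by auto
  moreover have "\<bar>w \<bullet> (H z *v w)\<bar> \<le> K * norm w ^ 2"
    using taylor_boundedD(7)[OF tb q(1), of w w] by (simp add: power2_eq_square mult_ac)
  moreover have "- (h * (g z \<bullet> \<mu>)) \<le> h * (K * norm \<mu>)"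
    using h calculation(2) mult_left_mono[of "- (g z \<bullet> \<mu>)" "K * norm \<mu>" h] by simp
  moreover have "0 \<le> K * norm w ^ 2" using taylor_boundedD(1)[OF tb] by simp
  ultimately show ?thesis unfolding step_rest_def by (simp add: mult_ac)
qed

text \<open>This lemma and the next two handle sums over a grid that stop at a random index: \<open>G i\<close> says that the
sum is still running at index \<open>i\<close>. Here at most one step begins inside and ends outside; it costs \<open>y\<close>.\<close>

lemma sum_until_exit_le:
  fixes \<rho> a b :: "nat \<Rightarrow> real"
  assumes dec: "\<And>i. i < n \<Longrightarrow> G (Suc i) \<Longrightarrow> G i"
    and good: "\<And>i. i < n \<Longrightarrow> G (Suc i) \<Longrightarrow> \<rho> i \<le> a i + b i"
    and bad: "\<And>i. i < n \<Longrightarrow> G i \<Longrightarrow> \<not> G (Suc i) \<Longrightarrow> \<rho> i \<le> y + b i"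
    and pos: "\<And>i. 0 \<le> b i" "0 \<le> y"
  shows "(\<Sum>i<n. of_bool (G i) * \<rho> i) \<le> y + (\<Sum>i<n. of_bool (G (Suc i)) * a i) + (\<Sum>i<n. b i)"
proof -
  have "m \<le> n \<Longrightarrow> (\<Sum>i<m. of_bool (G i) * \<rho> i) \<le>
      (if G m then 0 else y) + (\<Sum>i<m. of_bool (G (Suc i)) * a i) + (\<Sum>i<m. b i)" for m
  proof (induction m)
    case 0
    then show ?case using pos by simp
  next
    case (Suc m)
    then show ?case using dec[of m] good[of m] bad[of m] pos(1)[of m] pos(2)
      by (cases "G m"; cases "G (Suc m)") auto
  qed
  from this[of n] show ?thesis using pos(2) by (auto split: if_splits)
qed

lemma sum_until_exit_increments:
  fixes \<Lambda> :: "nat \<Rightarrow> real"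
  assumes dec: "\<And>i. i < n \<Longrightarrow> G (Suc i) \<Longrightarrow> G i"
    and le: "\<And>i. i \<le> n \<Longrightarrow> G i \<Longrightarrow> \<Lambda> i \<le> N" and pos: "0 \<le> \<Lambda> 0" "0 \<le> N"
  shows "(\<Sum>i<n. of_bool (G (Suc i)) * (\<Lambda> (Suc i) - \<Lambda> i)) \<le> N"
proof -
  have "m \<le> n \<Longrightarrow> (\<Sum>i<m. of_bool (G (Suc i)) * (\<Lambda> (Suc i) - \<Lambda> i)) \<le> (if G m then \<Lambda> m else N)" for m
  proof (induction m)
    case 0
    then show ?case using pos by simp
  next
    case (Suc m)
    then show ?case using dec[of m] le[of m] le[of "Suc m"]
      by (cases "G m"; cases "G (Suc m)") auto
  qed
  from this[of n] show ?thesis using le[of n] by (auto split: if_splits)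
qed

lemma sum_until_exit_telescope:
  fixes x :: "nat \<Rightarrow> real"
  assumes dec: "\<And>i. i < n \<Longrightarrow> G (Suc i) \<Longrightarrow> G i"
  shows "\<exists>k\<le>n. (\<Sum>i<n. of_bool (G i) * (x (Suc i) - x i)) = x k - x 0"
proof -
  have "m \<le> n \<Longrightarrow> \<exists>k\<le>m. (G m \<longrightarrow> k = m) \<and> (\<Sum>i<m. of_bool (G i) * (x (Suc i) - x i)) = x k - x 0" for m
  proof (induction m)
    case 0
    then show ?case by simp
  next
    case (Suc m)
    then obtain k where "k \<le> m" "G m \<longrightarrow> k = m" "(\<Sum>i<m. of_bool (G i) * (x (Suc i) - x i)) = x k - x 0"
      by auto
    then show ?case using dec[of m] Suc.prems
      by (cases "G m") (auto intro: exI[of _ "Suc m"] exI[of _ k])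
  qed
  from this[of n] show ?thesis by auto
qed

section \<open>Paths of the absorbed process\<close>

locale absorbed_process = brownian M F \<Sigma> W
  for M :: "'w measure" and F :: "real \<Rightarrow> 'w measure" and \<Sigma> :: "real^2^2" and W :: "real \<Rightarrow> 'w \<Rightarrow> real^2" +
  fixes \<mu> :: "real^2" and r1 r2 :: real and z0 :: "real^2" and L Z :: "real \<Rightarrow> 'w \<Rightarrow> real^2"
  assumes rbm: "absorbed_rbm \<Sigma> \<mu> r1 r2 z0 M F W L Z" and start_nonzero: "z0 \<noteq> 0"
begin

lemma Z_measurable: "0 \<le> t \<Longrightarrow> Z t \<in> borel_measurable (F t)"
  and L_measurable: "0 \<le> t \<Longrightarrow> L t \<in> borel_measurable (F t)"
  using rbm unfolding absorbed_rbm_def by blast+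

lemma Z_continuous: "\<omega> \<in> space M \<Longrightarrow> continuous_on {0..} (\<lambda>t. Z t \<omega>)"
  and L_continuous: "\<omega> \<in> space M \<Longrightarrow> continuous_on {0..} (\<lambda>t. L t \<omega>)"
  and L_start: "\<omega> \<in> space M \<Longrightarrow> L 0 \<omega> = 0"
  using rbm unfolding absorbed_rbm_def by blast+

lemma L_mono: "\<omega> \<in> space M \<Longrightarrow> 0 \<le> s \<Longrightarrow> s \<le> t \<Longrightarrow> L s \<omega> $ j \<le> L t \<omega> $ j"
proof -
  assume "\<omega> \<in> space M" "0 \<le> s" "s \<le> t"
  then have "mono_on {0..} (\<lambda>t. L t \<omega> $ j)" using rbm unfolding absorbed_rbm_def by blast
  then show ?thesis by (rule mono_onD) (use \<open>0 \<le> s\<close> \<open>s \<le> t\<close> in auto)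
qed

lemma L_nonneg: "\<omega> \<in> space M \<Longrightarrow> 0 \<le> t \<Longrightarrow> 0 \<le> L t \<omega> $ j"
  using L_mono[of \<omega> 0 t j] L_start by simp

lemma L_flat: "\<omega> \<in> space M \<Longrightarrow> 0 \<le> s \<Longrightarrow> s \<le> t \<Longrightarrow> (\<And>r. r \<in> {s..t} \<Longrightarrow> 0 < Z r \<omega> $ j) \<Longrightarrow>
    L s \<omega> $ j = L t \<omega> $ j"
  using rbm unfolding absorbed_rbm_def by blast

lemma Z_before: "\<omega> \<in> space M \<Longrightarrow> 0 \<le> t \<Longrightarrow> ereal t \<le> vertex_time z0 Z \<omega> \<Longrightarrow>
    Z t \<omega> = z0 + W t \<omega> + t *\<^sub>R \<mu> + reflection_matrix r1 r2 *v L t \<omega> \<and> Z t \<omega> \<in> quadrant"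
  using rbm unfolding absorbed_rbm_def by blast

lemma Z_after: "\<omega> \<in> space M \<Longrightarrow> 0 \<le> t \<Longrightarrow> vertex_time z0 Z \<omega> \<le> ereal t \<Longrightarrow> Z t \<omega> = 0"
  using rbm unfolding absorbed_rbm_def by blast

lemma vertex_time_nonneg: "0 \<le> vertex_time z0 Z \<omega>"
  unfolding vertex_time_def by (auto intro!: Inf_greatest simp: zero_ereal_def)

lemma Z_start: "\<omega> \<in> space M \<Longrightarrow> Z 0 \<omega> = z0"
  using Z_before[of \<omega> 0] vertex_time_nonneg[of \<omega>] by (simp add: zero_ereal_def W_0 L_start)

lemma vertex_time_le: "\<omega> \<in> space M \<Longrightarrow> 0 \<le> s \<Longrightarrow> Z s \<omega> = 0 \<Longrightarrow> vertex_time z0 Z \<omega> \<le> ereal s"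
  using Z_start[of \<omega>] start_nonzero
  unfolding vertex_time_def by (auto intro!: Inf_lower simp: less_le)

lemma Z_absorbed: "\<omega> \<in> space M \<Longrightarrow> 0 \<le> s \<Longrightarrow> s \<le> t \<Longrightarrow> Z s \<omega> = 0 \<Longrightarrow> Z t \<omega> = 0"
  by (rule Z_after) (auto intro: order_trans[OF vertex_time_le[of \<omega> s]])

lemma zero_in_quadrant: "0 \<in> quadrant" by (simp add: quadrant_def)

lemma Z_quadrant: "\<omega> \<in> space M \<Longrightarrow> 0 \<le> t \<Longrightarrow> Z t \<omega> \<in> quadrant"
  using Z_before[of \<omega> t] Z_after[of \<omega> t] zero_in_quadrant by (metis linear)

lemma Z_nonzero_time: "\<omega> \<in> space M \<Longrightarrow> 0 \<le> t \<Longrightarrow> Z t \<omega> \<noteq> 0 \<Longrightarrow> ereal t \<le> vertex_time z0 Z \<omega>"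
  using Z_after[of \<omega> t] by (metis linear)

text \<open>Since the process stays at the vertex after hitting it, integer times suffice; this makes the event measurable.\<close>

lemma hit_iff: "\<omega> \<in> space M \<Longrightarrow> vertex_time z0 Z \<omega> < \<infinity> \<longleftrightarrow> (\<exists>n::nat. Z (real n) \<omega> = 0)"
proof
  assume "\<omega> \<in> space M" "vertex_time z0 Z \<omega> < \<infinity>"
  moreover obtain n :: nat where "vertex_time z0 Z \<omega> \<le> ereal (real n)"
    using \<open>vertex_time z0 Z \<omega> < \<infinity>\<close> 
    by (cases "vertex_time z0 Z \<omega>") (use real_arch_simple vertex_time_nonneg[of \<omega>] in \<open>auto\<close>)
  ultimately show "\<exists>n::nat. Z (real n) \<omega> = 0" using Z_after[of \<omega> "real n"] by auto
next
  assume "\<omega> \<in> space M" "\<exists>n::nat. Z (real n) \<omega> = 0"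
  then show "vertex_time z0 Z \<omega> < \<infinity>" using vertex_time_le
    by (metis ereal_less_PInfty less_ereal.simps(4) of_nat_0_le_iff order_le_less_trans)
qed

lemma Z_increment:
  assumes "\<omega> \<in> space M" "0 \<le> s" "s \<le> t" "Z t \<omega> \<noteq> 0"
  shows "Z t \<omega> - Z s \<omega> = (W t \<omega> - W s \<omega>) + ((t - s) *\<^sub>R \<mu> +
    ((L t \<omega> $ 1 - L s \<omega> $ 1) *\<^sub>R refl_dir r1 r2 1 + (L t \<omega> $ 2 - L s \<omega> $ 2) *\<^sub>R refl_dir r1 r2 2))"
proof -
  have t: "ereal t \<le> vertex_time z0 Z \<omega>" using Z_nonzero_time assms by simp
  have s: "ereal s \<le> vertex_time z0 Z \<omega>" using t assms(3) by (meson ereal_less_eq(3) order_trans)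
  show ?thesis using Z_before[OF assms(1) _ t] Z_before[OF assms(1,2) s] assms
    by (simp add: reflection_matrix_mult algebra_simps)
qed

lemma L_increase:
  assumes "\<omega> \<in> space M" "0 \<le> s" "s \<le> t" "L s \<omega> $ j \<noteq> L t \<omega> $ j"
  obtains r where "r \<in> {s..t}" "Z r \<omega> \<in> quadrant" "Z r \<omega> $ j = 0"
proof -
  obtain r where r: "r \<in> {s..t}" "\<not> 0 < Z r \<omega> $ j" using L_flat[OF assms(1-3), of j] assms(4) by blast
  moreover have q: "Z r \<omega> \<in> quadrant" using Z_quadrant[OF assms(1), of r] r assms by auto
  moreover have "0 \<le> Z r \<omega> $ j" using q exhaust_2[of j] by (auto simp: quadrant_def)
  ultimately show ?thesis by (intro that[of r]) auto
qed

definition push :: "real \<Rightarrow> 'w \<Rightarrow> real" where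
  "push t \<omega> = L t \<omega> $ 1 + L t \<omega> $ 2"

lemma push_nonneg: "\<omega> \<in> space M \<Longrightarrow> 0 \<le> t \<Longrightarrow> 0 \<le> push t \<omega>"
  using L_nonneg[of \<omega> t] by (simp add: push_def)

lemma push_mono: "\<omega> \<in> space M \<Longrightarrow> 0 \<le> s \<Longrightarrow> s \<le> t \<Longrightarrow> push s \<omega> \<le> push t \<omega>"
  using L_mono[of \<omega> s t] unfolding push_def by (intro add_mono) auto

end

section \<open>Dynkin's inequality along a time grid\<close>

text \<open>The time interval from \<open>s0\<close> to \<open>t\<close> is divided into \<open>n\<close> steps. To keep all sums integrable, the sum over
the steps is stopped when the vertex has been hit or when the accumulated push exceeds a level \<open>N\<close>
(\<open>alive\<close>); both are decided by the past, so the martingale part keeps mean zero.\<close>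

locale dynkin = absorbed_process +
  fixes K :: real and f :: "real^2 \<Rightarrow> real" and g :: "real^2 \<Rightarrow> real^2" and H :: "real^2 \<Rightarrow> real^2^2"
    and s0 t :: real
  assumes tb: "taylor_bounded K f g H"
    and boundary: "\<And>z j. z \<in> quadrant \<Longrightarrow> z $ j = 0 \<Longrightarrow> g z \<bullet> refl_dir r1 r2 j \<le> 0"
    and s0: "0 \<le> s0" and s0_less: "s0 < t"
begin

definition tick :: "nat \<Rightarrow> nat \<Rightarrow> real" where
  "tick n i = s0 + real i * ((t - s0) / real n)"

definition alive :: "real \<Rightarrow> nat \<Rightarrow> 'a \<Rightarrow> nat \<Rightarrow> bool" where
  "alive N n \<omega> i \<longleftrightarrow> Z (tick n i) \<omega> \<noteq> 0 \<and> push (tick n i) \<omega> \<le> N"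

definition dW :: "nat \<Rightarrow> nat \<Rightarrow> 'a \<Rightarrow> real^2" where
  "dW n i \<omega> = W (tick n (Suc i)) \<omega> - W (tick n i) \<omega>"

definition rest :: "nat \<Rightarrow> 'a \<Rightarrow> nat \<Rightarrow> real" where
  "rest n \<omega> i = step_rest \<mu> f g H ((t - s0) / real n) (dW n i \<omega>) (Z (tick n i) \<omega>) (Z (tick n (Suc i)) \<omega>)"

lemma K_nonneg: "0 \<le> K" using taylor_boundedD(1)[OF tb] .

lemma tick_0: "tick n 0 = s0" and tick_n: "0 < n \<Longrightarrow> tick n n = t"
  by (simp_all add: tick_def)

lemma tick_Suc: "tick n (Suc i) = tick n i + (t - s0) / real n"
  by (simp add: tick_def distrib_right add_divide_distrib)

lemma tick_mono: "i \<le> j \<Longrightarrow> tick n i \<le> tick n j"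
  using s0_less unfolding tick_def by (intro add_left_mono mult_right_mono) auto

lemma tick_nonneg: "0 \<le> tick n i"
  using tick_mono[of 0 i n] s0 by (simp add: tick_0)

lemma tick_le: "0 < n \<Longrightarrow> i \<le> n \<Longrightarrow> tick n i \<le> t"
  using tick_mono[of i n n] by (simp add: tick_n)

lemma tick_less: "0 < n \<Longrightarrow> tick n i < tick n (Suc i)"
  using s0_less by (simp add: tick_Suc)

lemma alive_dec: "\<omega> \<in> space M \<Longrightarrow> alive N n \<omega> (Suc i) \<Longrightarrow> alive N n \<omega> i"
proof -
  assume \<omega>: "\<omega> \<in> space M" and a: "alive N n \<omega> (Suc i)"
  have t: "tick n i \<le> tick n (Suc i)" using tick_mono by simp
  show ?thesis using a Z_absorbed[OF \<omega> tick_nonneg t] push_mono[OF \<omega> tick_nonneg t]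
    unfolding alive_def by auto
qed

definition drift_const :: real where
  "drift_const = norm \<mu> + norm (refl_dir r1 r2 1) + norm (refl_dir r1 r2 2)"

definition dS :: "nat \<Rightarrow> 'a \<Rightarrow> nat \<Rightarrow> real" where
  "dS n \<omega> i = (t - s0) / real n + (push (tick n (Suc i)) \<omega> - push (tick n i) \<omega>)"

lemma drift_const_nonneg: "0 \<le> drift_const"
  by (simp add: drift_const_def)

lemma dS_nonneg: "\<omega> \<in> space M \<Longrightarrow> 0 \<le> dS n \<omega> i"
  using push_mono[OF _ tick_nonneg tick_mono[of i "Suc i" n], of \<omega>] s0_less unfolding dS_def by simp

lemma sum_dS:
  assumes "\<omega> \<in> space M" "0 < n" "0 \<le> N"
  shows "(\<Sum>i<n. of_bool (alive N n \<omega> (Suc i)) * dS n \<omega> i) \<le> (t - s0) + N"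
proof -
  have "(\<Sum>i<n. of_bool (alive N n \<omega> (Suc i)) * (push (tick n (Suc i)) \<omega> - push (tick n i) \<omega>)) \<le> N"
  proof (rule sum_until_exit_increments)
    show "alive N n \<omega> i" if "alive N n \<omega> (Suc i)" for i using alive_dec[OF assms(1) that] .
    show "push (tick n i) \<omega> \<le> N" if "alive N n \<omega> i" for i using that by (simp add: alive_def)
    show "0 \<le> push (tick n 0) \<omega>" using push_nonneg[OF assms(1) tick_nonneg] .
  qed (rule assms)
  moreover have "(\<Sum>i<n. of_bool (alive N n \<omega> (Suc i)) * ((t - s0) / real n)) \<le> (\<Sum>i<n. (t - s0) / real n)"
    using s0_less by (intro sum_mono) auto
  moreover have "(\<Sum>i<n. (t - s0) / real n) = t - s0" using assms by simp
  ultimately show ?thesis unfolding dS_def by (simp only: distrib_left sum.distrib)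
qed

text \<open>The key estimate. If the push at axis \<open>j\<close> grows during the step, the path visits this axis at
some time \<open>r\<close> of the step, and there the derivative of \<open>f\<close> along \<open>R\<^sup>j\<close> is nonpositive. At the beginning of the step it is
therefore at most the variation \<open>\<kappa>\<close> of the gradient times the length of \<open>R\<^sup>j\<close>.\<close>

lemma rest_good:
  assumes \<omega>: "\<omega> \<in> space M" and n: "0 < n" and alive: "Z (tick n (Suc i)) \<omega> \<noteq> 0"
    and near: "\<And>r. r \<in> {tick n i..tick n (Suc i)} \<Longrightarrow> norm (g (Z (tick n i) \<omega>) - g (Z r \<omega>)) \<le> \<kappa>"
    and c: "c = drift_const"
  shows "rest n \<omega> i \<le> \<kappa> * c * dS n \<omega> i + K * c * norm (dW n i \<omega>) * dS n \<omega> i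
    + K * c ^ 2 * dS n \<omega> i ^ 2 + 4 * K * norm (dW n i \<omega>) ^ 3 + 4 * K * c ^ 3 * dS n \<omega> i ^ 3"
proof -
  let ?s = "tick n i" and ?t = "tick n (Suc i)"
  let ?l = "\<lambda>j. L ?t \<omega> $ j - L ?s \<omega> $ j"
  have st: "0 \<le> ?s" "?s \<le> ?t" using tick_nonneg tick_mono[of i "Suc i" n] by auto
  have l: "0 \<le> ?l j" for j using L_mono[OF \<omega> st] by simp
  have q: "Z ?s \<omega> \<in> quadrant" "Z ?t \<omega> \<in> quadrant" using Z_quadrant[OF \<omega>] st by auto
  have h: "?t - ?s = (t - s0) / real n" "0 \<le> (t - s0) / real n" using s0_less by (auto simp: tick_Suc)
  have \<kappa>: "0 \<le> \<kappa>" using near[of ?s] st by auto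
  have push: "?l j * (g (Z ?s \<omega>) \<bullet> refl_dir r1 r2 j) \<le> ?l j * (\<kappa> * drift_const)" for j
  proof (cases "?l j = 0")
    case False
    then obtain r where r: "r \<in> {?s..?t}" "Z r \<omega> \<in> quadrant" "Z r \<omega> $ j = 0"
      using L_increase[OF \<omega> st, of j] by auto
    have "g (Z ?s \<omega>) \<bullet> refl_dir r1 r2 j = g (Z r \<omega>) \<bullet> refl_dir r1 r2 j + (g (Z ?s \<omega>) - g (Z r \<omega>)) \<bullet> refl_dir r1 r2 j"
      by (simp add: inner_diff_left)
    also have "\<dots> \<le> 0 + norm (g (Z ?s \<omega>) - g (Z r \<omega>)) * norm (refl_dir r1 r2 j)"
      by (intro add_mono boundary r norm_cauchy_schwarz)
    also have "\<dots> \<le> 0 + (\<kappa>) * drift_const"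
    proof (intro add_left_mono mult_mono)
      show "norm (g (Z ?s \<omega>) - g (Z r \<omega>)) \<le> \<kappa>" using near[OF r(1)] .
      show "norm (refl_dir r1 r2 j) \<le> drift_const" using exhaust_2[of j] by (auto simp: drift_const_def)
    qed (use K_nonneg \<kappa> in auto)
    finally show ?thesis using l[of j] by (intro mult_left_mono) auto
  qed auto
  have "rest n \<omega> i \<le> ?l 1 * (g (Z ?s \<omega>) \<bullet> refl_dir r1 r2 1) + ?l 2 * (g (Z ?s \<omega>) \<bullet> refl_dir r1 r2 2)
     + K * c * norm (dW n i \<omega>) * dS n \<omega> i + K * c ^ 2 * dS n \<omega> i ^ 2 + 4 * K * norm (dW n i \<omega>) ^ 3 + 4 * K * c ^ 3 * dS n \<omega> i ^ 3"
    using step_rest_push[OF tb q h(2) l[of 1] l[of 2], of "dW n i \<omega>" \<mu> "refl_dir r1 r2 1" "refl_dir r1 r2 2"]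
      Z_increment[OF \<omega> st alive]
    unfolding rest_def dS_def push_def c drift_const_def dW_def h(1)
    by (simp add: algebra_simps)
  moreover have "(?l 1 + ?l 2) * (\<kappa> * c) \<le> dS n \<omega> i * (\<kappa> * c)"
    using K_nonneg \<kappa> drift_const_nonneg h(2) c by (intro mult_right_mono mult_nonneg_nonneg) (auto simp: dS_def push_def)
  ultimately show ?thesis using push[of 1] push[of 2] unfolding c by (simp add: algebra_simps)
qed

lemma increment_f_le:
  assumes "z \<in> quadrant" "z' \<in> quadrant" "norm (z' - z) \<le> \<eta>" "\<eta> \<le> 1"
  shows "f z' - f z \<le> 3 * K * \<eta>"
proof -
  let ?d = "norm (z' - z)"
  have d: "?d \<le> \<eta>" "?d ^ 2 \<le> \<eta>" "?d ^ 3 \<le> \<eta>"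
    using assms power_decreasing[of 1 2 ?d] power_decreasing[of 1 3 ?d] by auto
  have "f z' - f z \<le> g z \<bullet> (z' - z) + (z' - z) \<bullet> (H z *v (z' - z)) / 2 + K * ?d ^ 3"
    using taylor_boundedD(9)[OF tb assms(1,2)] by linarith
  moreover have "g z \<bullet> (z' - z) \<le> K * ?d" using taylor_bounded_inner[OF tb assms(1), of "z' - z"] by linarith
  moreover have "(z' - z) \<bullet> (H z *v (z' - z)) / 2 \<le> K * ?d ^ 2"
    using taylor_boundedD(7)[OF tb assms(1), of "z' - z" "z' - z"] by (simp add: power2_eq_square mult_ac)
  moreover have "K * ?d \<le> K * \<eta>" "K * ?d ^ 2 \<le> K * \<eta>" "K * ?d ^ 3 \<le> K * \<eta>"
    using d K_nonneg by (auto intro: mult_left_mono)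
  ultimately show ?thesis by linarith
qed

lemma mesh_small: "0 < \<eta> \<Longrightarrow> \<forall>\<^sub>F n in sequentially. (t - s0) / real n \<le> \<eta>"
  using order_tendstoD(2)[OF lim_const_over_n[of "t - s0"], of \<eta>] by (auto elim: eventually_mono)

lemma oscillation:
  fixes X :: "real \<Rightarrow> 'z :: real_normed_vector"
  assumes X: "continuous_on {0..} X" and \<eta>: "0 < \<eta>"
  shows "\<forall>\<^sub>F n in sequentially. \<forall>i<n. \<forall>r\<in>{tick n i..tick n (Suc i)}. norm (X r - X (tick n i)) \<le> \<eta>"
proof -
  have "uniformly_continuous_on {s0..t} X"
    using s0 by (intro compact_uniformly_continuous continuous_on_subset[OF X]) auto
  then obtain d where d: "0 < d" "\<And>x y. x \<in> {s0..t} \<Longrightarrow> y \<in> {s0..t} \<Longrightarrow> dist y x < d \<Longrightarrow> dist (X y) (X x) < \<eta>"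
    using \<eta> unfolding uniformly_continuous_on_def by meson
  have "0 < d / 2" using d by simp
  from mesh_small[OF this] eventually_gt_at_top[of 0] show ?thesis
  proof eventually_elim
    case (elim n)
    show ?case
    proof (intro allI impI ballI)
      fix i r assume i: "i < n" and r: "r \<in> {tick n i..tick n (Suc i)}"
      have "tick n i \<in> {s0..t}" "r \<in> {s0..t}"
        using tick_mono[of 0 i n] tick_le[of n "Suc i"] tick_mono[of i "Suc i" n] i r elim by (auto simp: tick_0)
      moreover have "r - tick n i \<le> (t - s0) / real n" using r by (simp add: tick_Suc)
      then have "r - tick n i \<le> d / 2" using elim(1) by linarith
      then have "dist r (tick n i) < d" using r d(1) by (simp add: dist_real_def)
      ultimately have "dist (X r) (X (tick n i)) < \<eta>" by (intro d)
      then show "norm (X r - X (tick n i)) \<le> \<eta>" by (simp add: dist_norm)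
    qed
  qed
qed

text \<open>The first estimate holds for all grids and supplies a dominating constant, the second one says that only the cubes matter
in the limit. Both come from \<open>rest_good\<close>: for the first, \<open>\<kappa> = 2 K\<close>; for the second, \<open>\<kappa>\<close> and all increments are
small by uniform continuity of the path. The steps contribute at most \<open>(t - s0) + N\<close> to the sum of the \<open>dS\<close>.\<close>

lemma sum_rest_bounded:
  assumes N: "0 \<le> N"
  obtains C where "0 \<le> C" and
    "\<And>\<omega> n. \<omega> \<in> space M \<Longrightarrow> 0 < n \<Longrightarrow>
       (\<Sum>i<n. of_bool (alive N n \<omega> i) * rest n \<omega> i) \<le> C + C * (\<Sum>i<n. norm (dW n i \<omega>) ^ 3)"
    and
    "\<And>\<omega> \<eta>. \<omega> \<in> space M \<Longrightarrow> 0 < \<eta> \<Longrightarrow> \<forall>\<^sub>F n in sequentially.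
       (\<Sum>i<n. of_bool (alive N n \<omega> i) * rest n \<omega> i) \<le> \<eta> + C * (\<Sum>i<n. norm (dW n i \<omega>) ^ 3)"
proof -
  define c where "c = drift_const"
  define B where "B = N + (t - s0) + 1"
  define b where "b = K * c * B + 6 * K"
  define a where "a = 2 * K * c + K * c + K * c ^ 2 * B + 4 * K * c ^ 3 * B ^ 2"
  define y where "y = 4 * K + (t - s0) * K * norm \<mu>"
  define C where "C = y + a * (t - s0 + N) + b"
  have K: "0 \<le> K" using K_nonneg .
  have c: "0 \<le> c" using drift_const_nonneg by (simp add: c_def)
  have T: "0 \<le> t - s0" using s0_less by simp
  have B: "1 \<le> B" using N T by (simp add: B_def)
  have a: "0 \<le> a" and b: "0 \<le> b" and y: "0 \<le> y"
    using K c B T unfolding a_def b_def y_def by (auto intro!: add_nonneg_nonneg mult_nonneg_nonneg)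
  have aT: "0 \<le> a * (t - s0 + N)" and KcB: "0 \<le> K * c * B" using a T N K c B by auto
  have C: "0 \<le> C" "b \<le> C" "4 * K \<le> C"
    using aT KcB b y K unfolding C_def b_def by linarith+
  have h_le: "(t - s0) / real n \<le> t - s0" if "0 < n" for n :: nat
    using that T mult_left_mono[of 1 "real n" "t - s0"] by (simp add: field_simps)
  have coarse: "(\<Sum>i<n. of_bool (alive N n \<omega> i) * rest n \<omega> i) \<le> C + C * (\<Sum>i<n. norm (dW n i \<omega>) ^ 3)"
    if \<omega>: "\<omega> \<in> space M" and n: "0 < n" for \<omega> n
  proof -
    have "(\<Sum>i<n. of_bool (alive N n \<omega> i) * rest n \<omega> i) \<le>
      y + (\<Sum>i<n. of_bool (alive N n \<omega> (Suc i)) * (a * dS n \<omega> i)) + (\<Sum>i<n. b * norm (dW n i \<omega>) ^ 3)"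
    proof (rule sum_until_exit_le)
      show "alive N n \<omega> i" if "alive N n \<omega> (Suc i)" for i using alive_dec[OF \<omega> that] .
      show "rest n \<omega> i \<le> a * dS n \<omega> i + b * norm (dW n i \<omega>) ^ 3" if al: "alive N n \<omega> (Suc i)" for i
      proof -
        define S where "S = dS n \<omega> i"
        define w where "w = norm (dW n i \<omega>)"
        have w: "0 \<le> w" by (simp add: w_def)
        have S: "0 \<le> S" "S \<le> B"
          using dS_nonneg[OF \<omega>] al push_nonneg[OF \<omega> tick_nonneg, of n i] h_le[OF n]
          unfolding S_def B_def dS_def alive_def by auto
        have "rest n \<omega> i \<le> 2 * K * c * S + K * c * w * S + K * c ^ 2 * S ^ 2 + 4 * K * w ^ 3 + 4 * K * c ^ 3 * S ^ 3"
          unfolding S_def w_def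
        proof (rule rest_good[OF \<omega> n _ _ c_def])
          show "Z (tick n (Suc i)) \<omega> \<noteq> 0" using al by (simp add: alive_def)
          fix r assume "r \<in> {tick n i..tick n (Suc i)}"
          then have "0 \<le> r" using tick_nonneg[of n i] by auto
          then show "norm (g (Z (tick n i) \<omega>) - g (Z r \<omega>)) \<le> 2 * K"
            using norm_triangle_ineq4[of "g (Z (tick n i) \<omega>)" "g (Z r \<omega>)"]
              taylor_boundedD(6)[OF tb Z_quadrant[OF \<omega> tick_nonneg], of n i] taylor_boundedD(6)[OF tb Z_quadrant[OF \<omega>], of r] 
            by linarith
        qed
        moreover have "w * S \<le> S + B * w ^ 3"
        proof (cases "w \<le> 1")
          case True
          then have "w * S \<le> 1 * S" using S by (intro mult_right_mono) auto
          moreover have "0 \<le> B * w ^ 3" using w B by simp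
          ultimately show ?thesis by simp
        next
          case False
          then have "w ^ 1 \<le> w ^ 3" by (intro power_increasing) auto
          then have "w * S \<le> w ^ 3 * B" using S w by (intro mult_mono) auto
          then show ?thesis using S by (simp add: mult.commute)
        qed
        then have "K * c * w * S \<le> K * c * (S + B * w ^ 3)"
          using K c mult_left_mono[of "w * S" "S + B * w ^ 3" "K * c"] by (simp add: mult.assoc)
        moreover have "S ^ 2 \<le> B * S" using S by (simp add: power2_eq_square mult_right_mono)
        then have "K * c ^ 2 * S ^ 2 \<le> K * c ^ 2 * (B * S)" using K c by (intro mult_left_mono) auto
        moreover have "S ^ 3 \<le> B ^ 2 * S"
          using S power_mono[of S B 2] mult_right_mono[of "S ^ 2" "B ^ 2" S] by (simp add: power3_eq_cube power2_eq_square)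
        then have "4 * K * c ^ 3 * S ^ 3 \<le> 4 * K * c ^ 3 * (B ^ 2 * S)" using K c by (intro mult_left_mono) auto
        moreover have "0 \<le> K * w ^ 3" using K w by simp
        ultimately have "rest n \<omega> i \<le> a * S + b * w ^ 3"
          unfolding a_def b_def by (simp add: algebra_simps)
        then show ?thesis by (simp add: S_def w_def)
      qed
      show "rest n \<omega> i \<le> y + b * norm (dW n i \<omega>) ^ 3" for i
      proof -
        define w where "w = norm (dW n i \<omega>)"
        have w: "0 \<le> w" by (simp add: w_def)
        have q: "Z (tick n j) \<omega> \<in> quadrant" for j using Z_quadrant[OF \<omega> tick_nonneg] .
        have "rest n \<omega> i \<le> (f (Z (tick n (Suc i)) \<omega>) - f (Z (tick n i) \<omega>)) + K * w + K * w ^ 2 + (t - s0) / real n * K * norm \<mu>"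
          unfolding rest_def w_def using T by (intro step_rest_rough[OF tb q q]) simp
        moreover have "f (Z (tick n (Suc i)) \<omega>) - f (Z (tick n i) \<omega>) \<le> 2 * K"
          using taylor_boundedD(5)[OF tb q, of i] taylor_boundedD(5)[OF tb q, of "Suc i"] by linarith
        moreover have "(t - s0) / real n * K * norm \<mu> \<le> (t - s0) * K * norm \<mu>"
          using h_le[OF n] K by (intro mult_right_mono) auto
        moreover have "w \<le> 1 + w ^ 3"
          using w power_increasing[of 1 3 w] by (cases "w \<le> 1") (auto intro: add_increasing add_increasing2)
        then have "K * w \<le> K * (1 + w ^ 3)" using K by (rule mult_left_mono)
        moreover have "w ^ 2 \<le> 1 + w ^ 3"
          using w power_increasing[of 2 3 w] power_le_one[of w 2] by (cases "w \<le> 1") (auto intro: add_increasing add_increasing2)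
        then have "K * w ^ 2 \<le> K * (1 + w ^ 3)" using K by (rule mult_left_mono)
        moreover have "0 \<le> K * c * B * w ^ 3" "0 \<le> K * w ^ 3" using K c B w by auto
        ultimately have "rest n \<omega> i \<le> y + b * w ^ 3"
          unfolding y_def b_def by (simp add: algebra_simps)
        then show ?thesis by (simp add: w_def)
      qed
    qed (use b y in auto)
    also have "(\<Sum>i<n. of_bool (alive N n \<omega> (Suc i)) * (a * dS n \<omega> i)) = a * (\<Sum>i<n. of_bool (alive N n \<omega> (Suc i)) * dS n \<omega> i)"
      by (simp only: sum_distrib_left mult_ac)
    also have "(\<Sum>i<n. b * norm (dW n i \<omega>) ^ 3) = b * (\<Sum>i<n. norm (dW n i \<omega>) ^ 3)"
      by (simp add: sum_distrib_left)
    finally have "(\<Sum>i<n. of_bool (alive N n \<omega> i) * rest n \<omega> i) \<le>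
      y + a * (\<Sum>i<n. of_bool (alive N n \<omega> (Suc i)) * dS n \<omega> i) + b * (\<Sum>i<n. norm (dW n i \<omega>) ^ 3)" .
    moreover have "a * (\<Sum>i<n. of_bool (alive N n \<omega> (Suc i)) * dS n \<omega> i) \<le> a * (t - s0 + N)"
      using sum_dS[OF \<omega> n N] a by (intro mult_left_mono) auto
    moreover have "b * (\<Sum>i<n. norm (dW n i \<omega>) ^ 3) \<le> C * (\<Sum>i<n. norm (dW n i \<omega>) ^ 3)" 
      using C by (intro mult_right_mono sum_nonneg) auto
    ultimately show ?thesis using b by (simp add: C_def)
  qed
  have fine: "\<forall>\<^sub>F n in sequentially.
       (\<Sum>i<n. of_bool (alive N n \<omega> i) * rest n \<omega> i) \<le> \<eta>0 + C * (\<Sum>i<n. norm (dW n i \<omega>) ^ 3)"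
    if \<omega>: "\<omega> \<in> space M" and \<eta>0: "0 < \<eta>0" for \<omega> \<eta>0
  proof -
    define a2 where "a2 = 2 * K * c + 2 * K * c ^ 2 + 16 * K * c ^ 3"
    define y2 where "y2 = 5 * K + K * norm \<mu>"
    define \<eta> where "\<eta> = min 1 (\<eta>0 / (y2 + a2 * (t - s0 + N) + 1))"
    have a2: "0 \<le> a2" and y2: "0 \<le> y2" using K c by (auto simp: a2_def y2_def)
    have tot: "0 \<le> y2 + a2 * (t - s0 + N)" using a2 y2 T N by simp
    then have \<eta>: "0 < \<eta>" "\<eta> \<le> 1" using \<eta>0 by (auto simp: \<eta>_def)
    have "\<eta> * (y2 + a2 * (t - s0 + N)) \<le> \<eta> * (y2 + a2 * (t - s0 + N) + 1)" using \<eta> by simp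
    also have "\<dots> \<le> (\<eta>0 / (y2 + a2 * (t - s0 + N) + 1)) * (y2 + a2 * (t - s0 + N) + 1)"
      using tot by (intro mult_right_mono) (auto simp: \<eta>_def)
    also have "\<dots> = \<eta>0" using tot by simp
    finally have \<eta>_small: "\<eta> * (y2 + a2 * (t - s0 + N)) \<le> \<eta>0" .
    have push_cont: "continuous_on {0..} (\<lambda>t. push t \<omega>)"
      unfolding push_def by (intro continuous_intros L_continuous \<omega>)
    from oscillation[OF Z_continuous[OF \<omega>] \<eta>(1)] oscillation[OF W_continuous[OF \<omega>] \<eta>(1)] oscillation[OF push_cont \<eta>(1)]
      eventually_gt_at_top[of 0] mesh_small[OF \<eta>(1)]
    show ?thesis
    proof eventually_elim
      case (elim n)
      then have n: "0 < n" and h: "(t - s0) / real n \<le> \<eta>"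
        and oscZ: "\<And>i r. i < n \<Longrightarrow> r \<in> {tick n i..tick n (Suc i)} \<Longrightarrow> norm (Z r \<omega> - Z (tick n i) \<omega>) \<le> \<eta>"
        and oscW: "\<And>i r. i < n \<Longrightarrow> r \<in> {tick n i..tick n (Suc i)} \<Longrightarrow> norm (W r \<omega> - W (tick n i) \<omega>) \<le> \<eta>"
        and oscP: "\<And>i r. i < n \<Longrightarrow> r \<in> {tick n i..tick n (Suc i)} \<Longrightarrow> norm (push r \<omega> - push (tick n i) \<omega>) \<le> \<eta>"
        by auto
      have last: "tick n (Suc i) \<in> {tick n i..tick n (Suc i)}" for i using tick_mono[of i "Suc i" n] by auto
      have q: "Z (tick n j) \<omega> \<in> quadrant" for j using Z_quadrant[OF \<omega> tick_nonneg] .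
      have w_le: "norm (dW n i \<omega>) \<le> \<eta>" if "i < n" for i
        using oscW[OF that last] by (simp add: dW_def)
      have "(\<Sum>i<n. of_bool (alive N n \<omega> i) * rest n \<omega> i) \<le>
        \<eta> * y2 + (\<Sum>i<n. of_bool (alive N n \<omega> (Suc i)) * (\<eta> * a2 * dS n \<omega> i)) + (\<Sum>i<n. 4 * K * norm (dW n i \<omega>) ^ 3)"
      proof (rule sum_until_exit_le)
        show "alive N n \<omega> i" if "alive N n \<omega> (Suc i)" for i using alive_dec[OF \<omega> that] .
        show "rest n \<omega> i \<le> \<eta> * a2 * dS n \<omega> i + 4 * K * norm (dW n i \<omega>) ^ 3"
          if i: "i < n" and al: "alive N n \<omega> (Suc i)" for i
        proof -
          define S where "S = dS n \<omega> i"
          define w where "w = norm (dW n i \<omega>)"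
          have w: "0 \<le> w" "w \<le> \<eta>" using w_le[OF i] by (auto simp: w_def)
          have S: "0 \<le> S" "S \<le> 2 * \<eta>"
            using dS_nonneg[OF \<omega>] oscP[OF i last] h unfolding S_def dS_def by auto
          have "rest n \<omega> i \<le> K * \<eta> * c * S + K * c * w * S + K * c ^ 2 * S ^ 2 + 4 * K * w ^ 3 + 4 * K * c ^ 3 * S ^ 3"
            unfolding S_def w_def
          proof (rule rest_good[OF \<omega> n _ _ c_def])
            show "Z (tick n (Suc i)) \<omega> \<noteq> 0" using al by (simp add: alive_def)
            fix r assume r: "r \<in> {tick n i..tick n (Suc i)}"
            then have "0 \<le> r" using tick_nonneg[of n i] by auto
            then have "norm (g (Z r \<omega>) - g (Z (tick n i) \<omega>)) \<le> K * norm (Z r \<omega> - Z (tick n i) \<omega>)"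
              using taylor_boundedD(8)[OF tb q Z_quadrant[OF \<omega>]] by auto
            also have "\<dots> \<le> K * \<eta>" using oscZ[OF i r] K by (intro mult_left_mono) auto
            finally show "norm (g (Z (tick n i) \<omega>) - g (Z r \<omega>)) \<le> K * \<eta>"
              by (simp add: norm_minus_commute)
          qed
          moreover have "K * c * w * S \<le> K * c * \<eta> * S" 
            using K c w S by (intro mult_right_mono mult_left_mono) auto
          moreover have "S ^ 2 \<le> 2 * \<eta> * S" using S by (simp add: power2_eq_square mult_right_mono)
          then have "K * c ^ 2 * S ^ 2 \<le> K * c ^ 2 * (2 * \<eta> * S)" using K c by (intro mult_left_mono) auto
          moreover have "S ^ 3 \<le> 4 * \<eta> * S"
          proof -
            have "S ^ 2 \<le> (2 * \<eta>) ^ 2" using S by (intro power_mono) auto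
            also have "\<dots> \<le> 4 * \<eta>" using \<eta> by (simp add: power2_eq_square)
            finally have "S ^ 2 * S \<le> 4 * \<eta> * S" using S by (intro mult_right_mono) auto
            then show ?thesis by (simp add: power3_eq_cube power2_eq_square)
          qed
          then have "4 * K * c ^ 3 * S ^ 3 \<le> 4 * K * c ^ 3 * (4 * \<eta> * S)" using K c by (intro mult_left_mono) auto
          ultimately have "rest n \<omega> i \<le> \<eta> * a2 * S + 4 * K * w ^ 3"
            unfolding a2_def by (simp add: algebra_simps)
          then show ?thesis by (simp add: S_def w_def)
        qed
        show "rest n \<omega> i \<le> \<eta> * y2 + 4 * K * norm (dW n i \<omega>) ^ 3" if i: "i < n" for i
        proof -
          define w where "w = norm (dW n i \<omega>)"
          have w: "0 \<le> w" "w \<le> \<eta>" using w_le[OF i] by (auto simp: w_def)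
          have "rest n \<omega> i \<le> (f (Z (tick n (Suc i)) \<omega>) - f (Z (tick n i) \<omega>)) + K * w + K * w ^ 2 + (t - s0) / real n * K * norm \<mu>"
            unfolding rest_def w_def using T by (intro step_rest_rough[OF tb q q]) simp
          moreover have "f (Z (tick n (Suc i)) \<omega>) - f (Z (tick n i) \<omega>) \<le> 3 * K * \<eta>"
            using oscZ[OF i last] \<eta> by (intro increment_f_le[OF q q]) auto
          moreover have "(t - s0) / real n * K * norm \<mu> \<le> \<eta> * K * norm \<mu>"
            using h K by (intro mult_right_mono) auto
          moreover have "w ^ 2 \<le> \<eta>" using w \<eta> power_decreasing[of 1 2 w] by auto
          then have "K * w \<le> K * \<eta>" "K * w ^ 2 \<le> K * \<eta>"
            using K w by (auto intro: mult_left_mono)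
          moreover have "0 \<le> K * w ^ 3" using K w by auto
          ultimately have "rest n \<omega> i \<le> \<eta> * y2 + 4 * K * w ^ 3"
            unfolding y2_def by (simp add: algebra_simps)
          then show ?thesis by (simp add: w_def)
        qed
      qed (use \<eta> y2 K in auto)
      also have "(\<Sum>i<n. of_bool (alive N n \<omega> (Suc i)) * (\<eta> * a2 * dS n \<omega> i)) = \<eta> * a2 * (\<Sum>i<n. of_bool (alive N n \<omega> (Suc i)) * dS n \<omega> i)"
        by (simp only: sum_distrib_left mult_ac)
      also have "(\<Sum>i<n. 4 * K * norm (dW n i \<omega>) ^ 3) = 4 * K * (\<Sum>i<n. norm (dW n i \<omega>) ^ 3)"
        by (simp add: sum_distrib_left)
      finally have "(\<Sum>i<n. of_bool (alive N n \<omega> i) * rest n \<omega> i) \<le>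
        \<eta> * y2 + \<eta> * a2 * (\<Sum>i<n. of_bool (alive N n \<omega> (Suc i)) * dS n \<omega> i) + 4 * K * (\<Sum>i<n. norm (dW n i \<omega>) ^ 3)" .
      moreover have "\<eta> * a2 * (\<Sum>i<n. of_bool (alive N n \<omega> (Suc i)) * dS n \<omega> i) \<le> \<eta> * a2 * (t - s0 + N)"
        using sum_dS[OF \<omega> n N] a2 \<eta> by (intro mult_left_mono) auto
      moreover have "4 * K * (\<Sum>i<n. norm (dW n i \<omega>) ^ 3) \<le> C * (\<Sum>i<n. norm (dW n i \<omega>) ^ 3)" 
        using C by (intro mult_right_mono sum_nonneg) auto
      ultimately show ?case using \<eta>_small by (simp add: algebra_simps)
    qed
  qed
  show ?thesis using that[OF \<open>0 \<le> C\<close> coarse fine] by blast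
qed

end

context absorbed_process begin

lemma Z_borel: "0 \<le> s \<Longrightarrow> Z s \<in> borel_measurable M"
  using measurable_F Z_measurable by blast

lemma push_measurable: "0 \<le> s \<Longrightarrow> push s \<in> borel_measurable (F s)"
  unfolding push_def
  by (intro borel_measurable_add borel_measurable_continuous_on[OF _ L_measurable] continuous_intros)

lemma push_borel: "0 \<le> s \<Longrightarrow> push s \<in> borel_measurable M"
  using measurable_F push_measurable by blast

lemma integrable_of_Z:
  fixes \<phi> :: "real^2 \<Rightarrow> real"
  assumes s: "0 \<le> s" and \<phi>: "continuous_on UNIV \<phi>" "\<And>z. z \<in> quadrant \<Longrightarrow> \<bar>\<phi> z\<bar> \<le> B"
    and X: "X \<in> borel_measurable M" "\<And>\<omega>. \<omega> \<in> space M \<Longrightarrow> \<bar>X \<omega>\<bar> \<le> 1"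
  shows "integrable M (\<lambda>\<omega>. X \<omega> * \<phi> (Z s \<omega>))"
proof (rule integrable_const_bound[where B = B])
  have "(\<lambda>\<omega>. \<phi> (Z s \<omega>)) \<in> borel_measurable M"
    using borel_measurable_continuous_on[OF \<phi>(1) Z_borel[OF s]] .
  then show "(\<lambda>\<omega>. X \<omega> * \<phi> (Z s \<omega>)) \<in> borel_measurable M" using X by measurable
  show "AE \<omega> in M. norm (X \<omega> * \<phi> (Z s \<omega>)) \<le> B"
  proof (rule AE_I2)
    fix \<omega> assume \<omega>: "\<omega> \<in> space M"
    have "\<bar>X \<omega>\<bar> * \<bar>\<phi> (Z s \<omega>)\<bar> \<le> 1 * B"
      using \<phi>(2)[OF Z_quadrant[OF \<omega> s]] X(2)[OF \<omega>] by (intro mult_mono) auto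
    then show "norm (X \<omega> * \<phi> (Z s \<omega>)) \<le> B" by (simp add: abs_mult)
  qed
qed

lemma nonzero_measurable: "0 \<le> s \<Longrightarrow> (\<lambda>\<omega>. of_bool (Z s \<omega> \<noteq> 0) :: real) \<in> borel_measurable M"
  using Z_borel[of s] by measurable

end

context dynkin begin

lemma alive_measurable: "(\<lambda>\<omega>. of_bool (alive N n \<omega> i) :: real) \<in> borel_measurable (F (tick n i))"
proof -
  have [measurable]: "Z (tick n i) \<in> borel_measurable (F (tick n i))"
    and [measurable]: "push (tick n i) \<in> borel_measurable (F (tick n i))"
    using Z_measurable push_measurable tick_nonneg by auto
  show ?thesis unfolding alive_def by measurable
qed

lemma alive_borel: "(\<lambda>\<omega>. of_bool (alive N n \<omega> i) :: real) \<in> borel_measurable M"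
  using measurable_F alive_measurable by blast

lemma continuous_g: "continuous_on UNIV (\<lambda>z. g z $ j)"
  using taylor_boundedD(3)[OF tb] by (intro continuous_intros)

lemma g_bound: "z \<in> quadrant \<Longrightarrow> \<bar>g z $ j\<bar> \<le> K"
  using taylor_boundedD(6)[OF tb] component_le_norm_cart[of "g z" j] by fastforce

lemma H_bound: "z \<in> quadrant \<Longrightarrow> \<bar>H z $ j $ k\<bar> \<le> K"
  using taylor_boundedD(7)[OF tb, of z "axis j 1" "axis k 1"]
  by (simp add: inner_axis' matrix_vector_mul_component inner_axis)

lemma continuous_generator: "continuous_on UNIV (generator \<Sigma> \<mu> g H)"
  unfolding generator_def
  by (intro continuous_on_add continuous_on_divide continuous_on_mult continuous_on_inner continuous_on_const
      continuous_on_sum taylor_boundedD(3,4)[OF tb]) simp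

text \<open>The part of an increment of \<open>f\<close> that has mean zero given the past: linear in the Brownian increment, or quadratic
and compensated by its covariance.\<close>

definition mart :: "real \<Rightarrow> nat \<Rightarrow> nat \<Rightarrow> 'a \<Rightarrow> real" where
  "mart N n i \<omega> =
     (\<Sum>j\<in>UNIV. of_bool (alive N n \<omega> i) * g (Z (tick n i) \<omega>) $ j * dW n i \<omega> $ j) +
     (\<Sum>j\<in>UNIV. \<Sum>k\<in>UNIV. of_bool (alive N n \<omega> i) * H (Z (tick n i) \<omega>) $ j $ k
        * (dW n i \<omega> $ j * dW n i \<omega> $ k - (t - s0) / real n * \<Sigma> $ j $ k)) / 2"

lemma adapted_bounded:
  fixes \<phi> :: "real^2 \<Rightarrow> real"
  assumes \<phi>: "continuous_on UNIV \<phi>" "\<And>z. z \<in> quadrant \<Longrightarrow> \<bar>\<phi> z\<bar> \<le> B"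
  shows "(\<lambda>\<omega>. of_bool (alive N n \<omega> i) * \<phi> (Z (tick n i) \<omega>)) \<in> borel_measurable (F (tick n i))"
    "\<omega> \<in> space M \<Longrightarrow> \<bar>of_bool (alive N n \<omega> i) * \<phi> (Z (tick n i) \<omega>)\<bar> \<le> B"
proof -
  have "(\<lambda>\<omega>. \<phi> (Z (tick n i) \<omega>)) \<in> borel_measurable (F (tick n i))"
    using borel_measurable_continuous_on[OF \<phi>(1) Z_measurable[OF tick_nonneg]] .
  then show "(\<lambda>\<omega>. of_bool (alive N n \<omega> i) * \<phi> (Z (tick n i) \<omega>)) \<in> borel_measurable (F (tick n i))"
    using alive_measurable by measurable
  show "\<bar>of_bool (alive N n \<omega> i) * \<phi> (Z (tick n i) \<omega>)\<bar> \<le> B" if "\<omega> \<in> space M"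
    using \<phi>(2)[OF Z_quadrant[OF that tick_nonneg], of n i] by (auto simp: of_bool_def)
qed

lemma mart_mean:
  assumes n: "0 < n"
  shows "integrable M (mart N n i)" "expectation (mart N n i) = 0"
proof -
  let ?h = "(t - s0) / real n"
  let ?I = "\<lambda>\<omega>. of_bool (alive N n \<omega> i) :: real"
  have ts: "0 \<le> tick n i" "tick n i < tick n (Suc i)" and h: "tick n (Suc i) - tick n i = ?h"
    using tick_nonneg tick_less[OF n] by (auto simp: tick_Suc)
  have lin: "integrable M (\<lambda>\<omega>. ?I \<omega> * g (Z (tick n i) \<omega>) $ j * dW n i \<omega> $ j)"
    "expectation (\<lambda>\<omega>. ?I \<omega> * g (Z (tick n i) \<omega>) $ j * dW n i \<omega> $ j) = 0" for j
    using increment_independent[OF ts adapted_bounded[OF continuous_g[of j] g_bound[of _ j], where N = N and n = n and i = i], where h = "\<lambda>x. x $ j"]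
      increment_integrable_moment[OF ts, of j]
    unfolding dW_def by auto
  have quad: "integrable M (\<lambda>\<omega>. ?I \<omega> * H (Z (tick n i) \<omega>) $ j $ k
        * (dW n i \<omega> $ j * dW n i \<omega> $ k - ?h * \<Sigma> $ j $ k))"
    "expectation (\<lambda>\<omega>. ?I \<omega> * H (Z (tick n i) \<omega>) $ j $ k
        * (dW n i \<omega> $ j * dW n i \<omega> $ k - ?h * \<Sigma> $ j $ k)) = 0" for j k
  proof -
    have int: "integrable M (\<lambda>\<omega>. dW n i \<omega> $ j * dW n i \<omega> $ k - ?h * \<Sigma> $ j $ k)"
      unfolding dW_def by (intro Bochner_Integration.integrable_diff increment_covariance[OF ts]) auto
    have "expectation (\<lambda>\<omega>. dW n i \<omega> $ j * dW n i \<omega> $ k - ?h * \<Sigma> $ j $ k) = 0"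
      unfolding dW_def
      by (subst Bochner_Integration.integral_diff[OF increment_covariance(1)[OF ts]])
        (use increment_covariance(2)[OF ts] prob_space in \<open>auto simp: h\<close>)
    then show "integrable M (\<lambda>\<omega>. ?I \<omega> * H (Z (tick n i) \<omega>) $ j $ k
        * (dW n i \<omega> $ j * dW n i \<omega> $ k - ?h * \<Sigma> $ j $ k))"
      "expectation (\<lambda>\<omega>. ?I \<omega> * H (Z (tick n i) \<omega>) $ j $ k
        * (dW n i \<omega> $ j * dW n i \<omega> $ k - ?h * \<Sigma> $ j $ k)) = 0"
      using increment_independent[OF ts adapted_bounded[OF taylor_boundedD(4)[OF tb, of j k] H_bound[of _ j k], where N = N and n = n and i = i],
          where h = "\<lambda>x. x $ j * x $ k - ?h * \<Sigma> $ j $ k"] int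
      unfolding dW_def by auto
  qed
  show "integrable M (mart N n i)"
    unfolding mart_def by (intro Bochner_Integration.integrable_add Bochner_Integration.integrable_sum integrable_divide lin quad)
  show "expectation (mart N n i) = 0"
    unfolding mart_def
    by (simp only: Bochner_Integration.integral_add Bochner_Integration.integrable_sum integrable_divide lin(1) quad(1)
        Bochner_Integration.integral_sum integral_divide_zero lin(2) quad(2)) simp
qed

lemma step_decomposition:
  "of_bool (alive N n \<omega> i) * (f (Z (tick n (Suc i)) \<omega>) - f (Z (tick n i) \<omega>)) =
     of_bool (alive N n \<omega> i) * rest n \<omega> i + mart N n i \<omega>
     + (t - s0) / real n * (of_bool (alive N n \<omega> i) * generator \<Sigma> \<mu> g H (Z (tick n i) \<omega>))"
proof (cases "alive N n \<omega> i")
  case True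
  have "g z \<bullet> w = (\<Sum>j\<in>UNIV. g z $ j * w $ j)" for z w by (simp add: inner_vec_def)
  moreover have "w \<bullet> (H z *v w) = (\<Sum>j\<in>UNIV. \<Sum>k\<in>UNIV. H z $ j $ k * (w $ j * w $ k))" for z w
    by (simp add: inner_vec_def matrix_vector_mult_def sum_2 algebra_simps)
  ultimately show ?thesis using True
    unfolding rest_def step_rest_def mart_def generator_def
    by (simp add: sum_2 algebra_simps add_divide_distrib diff_divide_distrib)
next
  case False
  then show ?thesis by (simp add: mart_def)
qed

lemma increment_integrable:
  "integrable M (\<lambda>\<omega>. of_bool (alive N n \<omega> i) * (f (Z (tick n (Suc i)) \<omega>) - f (Z (tick n i) \<omega>)))"
  using integrable_of_Z[OF tick_nonneg[of n "Suc i"] taylor_boundedD(2,5)[OF tb] alive_borel[of N n i]]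
    integrable_of_Z[OF tick_nonneg[of n i] taylor_boundedD(2,5)[OF tb] alive_borel[of N n i]]
  unfolding right_diff_distrib by (intro Bochner_Integration.integrable_diff) auto

lemma generator_integrable:
  assumes "0 \<le> s" "X \<in> borel_measurable M" "\<And>\<omega>. \<omega> \<in> space M \<Longrightarrow> \<bar>X \<omega>\<bar> \<le> 1"
  shows "integrable M (\<lambda>\<omega>. X \<omega> * generator \<Sigma> \<mu> g H (Z s \<omega>))"
proof -
  obtain K' where "\<And>z. z \<in> quadrant \<Longrightarrow> \<bar>generator \<Sigma> \<mu> g H z\<bar> \<le> K'"
    using taylor_bounded_generator[OF tb] by metis
  from integrable_of_Z[OF assms(1) continuous_generator this assms(2,3)] show ?thesis .
qed

lemma rest_integrable:
  assumes "0 < n" shows "integrable M (\<lambda>\<omega>. of_bool (alive N n \<omega> i) * rest n \<omega> i)"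
proof -
  have eq: "(\<lambda>\<omega>. of_bool (alive N n \<omega> i) * rest n \<omega> i) =
    (\<lambda>\<omega>. of_bool (alive N n \<omega> i) * (f (Z (tick n (Suc i)) \<omega>) - f (Z (tick n i) \<omega>)) - mart N n i \<omega>
     - (t - s0) / real n * (of_bool (alive N n \<omega> i) * generator \<Sigma> \<mu> g H (Z (tick n i) \<omega>)))"
  proof
    fix \<omega> show "of_bool (alive N n \<omega> i) * rest n \<omega> i =
      of_bool (alive N n \<omega> i) * (f (Z (tick n (Suc i)) \<omega>) - f (Z (tick n i) \<omega>)) - mart N n i \<omega>
      - (t - s0) / real n * (of_bool (alive N n \<omega> i) * generator \<Sigma> \<mu> g H (Z (tick n i) \<omega>))"
      using step_decomposition[of N n \<omega> i] by linarith
  qed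
  show ?thesis unfolding eq
    by (intro Bochner_Integration.integrable_diff increment_integrable mart_mean[OF assms] integrable_mult_right
      generator_integrable tick_nonneg alive_borel) auto
qed

lemma increment_mean:
  assumes "0 < n"
  shows "expectation (\<lambda>\<omega>. \<Sum>i<n. of_bool (alive N n \<omega> i) * (f (Z (tick n (Suc i)) \<omega>) - f (Z (tick n i) \<omega>))) =
    expectation (\<lambda>\<omega>. \<Sum>i<n. of_bool (alive N n \<omega> i) * rest n \<omega> i)
    + (\<Sum>i<n. (t - s0) / real n * expectation (\<lambda>\<omega>. of_bool (alive N n \<omega> i) * generator \<Sigma> \<mu> g H (Z (tick n i) \<omega>)))"
proof -
  have G: "integrable M (\<lambda>\<omega>. (t - s0) / real n * (of_bool (alive N n \<omega> i) * generator \<Sigma> \<mu> g H (Z (tick n i) \<omega>)))" for i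
    by (intro integrable_mult_right generator_integrable tick_nonneg alive_borel) auto
  have "expectation (\<lambda>\<omega>. of_bool (alive N n \<omega> i) * (f (Z (tick n (Suc i)) \<omega>) - f (Z (tick n i) \<omega>))) =
      expectation (\<lambda>\<omega>. of_bool (alive N n \<omega> i) * rest n \<omega> i) +
      (t - s0) / real n * expectation (\<lambda>\<omega>. of_bool (alive N n \<omega> i) * generator \<Sigma> \<mu> g H (Z (tick n i) \<omega>))" for i
    unfolding step_decomposition
    using Bochner_Integration.integral_add[OF Bochner_Integration.integrable_add[OF rest_integrable[OF assms, of N i] mart_mean(1)[OF assms]] G]
      Bochner_Integration.integral_add[OF rest_integrable[OF assms, of N i] mart_mean(1)[OF assms]] mart_mean(2)[OF assms, of N i]
    by simp
  then show ?thesis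
    by (simp only: Bochner_Integration.integral_sum increment_integrable rest_integrable[OF assms] sum.distrib)
qed

text \<open>Domination is not available for the sum of remainders itself, because the Brownian increments are unbounded. After
subtracting the cubes, whose expectation tends to zero, the positive part is bounded and tends to zero on every path.\<close>

lemma rest_vanishes:
  assumes N: "0 \<le> N" and e: "0 < e"
  shows "\<forall>\<^sub>F n in sequentially. expectation (\<lambda>\<omega>. \<Sum>i<n. of_bool (alive N n \<omega> i) * rest n \<omega> i) \<le> e"
proof -
  let ?Q = "\<lambda>n \<omega>. \<Sum>i<n. of_bool (alive N n \<omega> i) * rest n \<omega> i"
  let ?V = "\<lambda>n \<omega>. \<Sum>i<n. norm (dW n i \<omega>) ^ 3"
  let ?h = "\<lambda>n. (t - s0) / real n"
  obtain C where C: "0 \<le> C"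
    and coarse: "\<And>\<omega> n. \<omega> \<in> space M \<Longrightarrow> 0 < n \<Longrightarrow> ?Q n \<omega> \<le> C + C * ?V n \<omega>"
    and fine: "\<And>\<omega> \<eta>. \<omega> \<in> space M \<Longrightarrow> 0 < \<eta> \<Longrightarrow> \<forall>\<^sub>F n in sequentially. ?Q n \<omega> \<le> \<eta> + C * ?V n \<omega>"
    by (rule sum_rest_bounded[OF N]) blast
  have Qi: "integrable M (?Q n)" if "0 < n" for n
    using rest_integrable[OF that] by (intro Bochner_Integration.integrable_sum)
  define c3 where "c3 = 8 * (sqrt (\<Sigma>$1$1) ^ 3 + sqrt (\<Sigma>$2$2) ^ 3)"
  have cube: "integrable M (\<lambda>\<omega>. norm (dW n i \<omega>) ^ 3)" "expectation (\<lambda>\<omega>. norm (dW n i \<omega>) ^ 3) \<le> c3 * sqrt (?h n) ^ 3"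
    if "0 < n" for n i
    using increment_cubed[OF tick_nonneg tick_less[OF that], of i]
    unfolding dW_def c3_def by (simp_all add: tick_Suc)
  have Vi: "integrable M (?V n)" if "0 < n" for n using cube[OF that] by (intro Bochner_Integration.integrable_sum)
  have EV: "expectation (?V n) \<le> c3 * (t - s0) * sqrt (?h n)" if n: "0 < n" for n
  proof -
    have "expectation (?V n) = (\<Sum>i<n. expectation (\<lambda>\<omega>. norm (dW n i \<omega>) ^ 3))"
      using cube[OF n] by (intro Bochner_Integration.integral_sum)
    also have "\<dots> \<le> (\<Sum>i<n. c3 * sqrt (?h n) ^ 3)" using cube[OF n] by (intro sum_mono)
    also have "\<dots> = real n * (c3 * (?h n * sqrt (?h n)))"
      using s0_less by (simp add: power3_eq_cube)
    also have "\<dots> = c3 * (t - s0) * sqrt (?h n)" using n by simp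
    finally show ?thesis .
  qed
  define Y where "Y n \<omega> = max 0 (?Q n \<omega> - C * ?V n \<omega>)" for n \<omega>
  have Yi: "integrable M (Y n)" if "0 < n" for n
    unfolding Y_def using Qi[OF that] Vi[OF that] by (intro integrable_max) auto
  have "(\<lambda>n. expectation (\<lambda>\<omega>. Y (Suc n) \<omega>)) \<longlonglongrightarrow> expectation (\<lambda>\<omega>. 0)"
  proof (rule integral_dominated_convergence[where w = "\<lambda>_. C"])
    show "AE \<omega> in M. (\<lambda>n. Y (Suc n) \<omega>) \<longlonglongrightarrow> 0"
    proof (rule AE_I2)
      fix \<omega> assume \<omega>: "\<omega> \<in> space M"
      have "(\<lambda>n. Y n \<omega>) \<longlonglongrightarrow> 0"
      proof (rule tendstoI)
        fix \<eta> :: real assume "0 < \<eta>"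
        then have "0 < \<eta> / 2" by simp
        from fine[OF \<omega> this] show "\<forall>\<^sub>F n in sequentially. dist (Y n \<omega>) 0 < \<eta>"
        proof eventually_elim
          case (elim n)
          have "max 0 (q - v) < \<eta>" if "q \<le> \<eta> / 2 + v" for q v :: real using that \<open>0 < \<eta>\<close> by auto
          from this[OF elim] show ?case unfolding Y_def dist_real_def by (simp only: diff_zero abs_of_nonneg max.cobounded1)
        qed
      qed
      then show "(\<lambda>n. Y (Suc n) \<omega>) \<longlonglongrightarrow> 0" by (rule LIMSEQ_Suc)
    qed
    show "AE \<omega> in M. norm (Y (Suc n) \<omega>) \<le> C" for n
    proof (rule AE_I2)
      fix \<omega> assume \<omega>: "\<omega> \<in> space M"
      have "norm (max 0 (q - v)) \<le> C" if "q \<le> C + v" for q v :: real using that C by auto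
      from this[OF coarse[OF \<omega>, of "Suc n"]] show "norm (Y (Suc n) \<omega>) \<le> C" unfolding Y_def by simp
    qed
  qed (use Yi in auto)
  then have "(\<lambda>n. expectation (Y n)) \<longlonglongrightarrow> 0" using filterlim_sequentially_Suc[of "\<lambda>n. expectation (Y n)" "nhds 0"] by simp
  moreover have "(\<lambda>n. C * (c3 * (t - s0) * sqrt (?h n))) \<longlonglongrightarrow> C * (c3 * (t - s0) * sqrt 0)"
    by (intro tendsto_intros lim_const_over_n)
  ultimately have "(\<lambda>n. expectation (Y n) + C * (c3 * (t - s0) * sqrt (?h n))) \<longlonglongrightarrow> 0 + C * (c3 * (t - s0) * sqrt 0)"
    by (rule tendsto_add)
  then have "\<forall>\<^sub>F n in sequentially. expectation (Y n) + C * (c3 * (t - s0) * sqrt (?h n)) < e"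
    using e by (intro order_tendstoD) auto
  then show ?thesis using eventually_gt_at_top[of 0]
  proof eventually_elim
    case (elim n)
    have "expectation (?Q n) \<le> expectation (\<lambda>\<omega>. Y n \<omega> + C * ?V n \<omega>)"
      using elim by (intro integral_mono Qi Bochner_Integration.integrable_add integrable_mult_right Yi Vi) (auto simp: Y_def)
    also have "\<dots> = expectation (Y n) + C * expectation (?V n)"
      using elim by (simp add: Yi Vi)
    also have "\<dots> \<le> expectation (Y n) + C * (c3 * (t - s0) * sqrt (?h n))"
      using EV elim C by (intro add_left_mono mult_left_mono) auto
    finally show ?case using elim by simp
  qed
qed

lemma push_tail: "(\<lambda>N. expectation (\<lambda>\<omega>. of_bool (real N < push t \<omega>) :: real)) \<longlonglongrightarrow> 0"
proof -
  have t: "0 \<le> t" using s0 s0_less by simp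
  have [measurable]: "push t \<in> borel_measurable M" using push_borel[OF t] .
  have "(\<lambda>N. expectation (\<lambda>\<omega>. of_bool (real N < push t \<omega>) :: real)) \<longlonglongrightarrow> expectation (\<lambda>\<omega>. 0)"
  proof (rule integral_dominated_convergence[where w = "\<lambda>_. 1"])
    show "AE \<omega> in M. (\<lambda>N. of_bool (real N < push t \<omega>)) \<longlonglongrightarrow> (0::real)"
    proof (rule AE_I2, rule tendsto_eventually)
      fix \<omega>
      obtain N0 :: nat where "push t \<omega> \<le> real N0" using real_arch_simple by blast
      then show "\<forall>\<^sub>F N in sequentially. of_bool (real N < push t \<omega>) = (0::real)"
        by (intro eventually_sequentiallyI[of N0]) auto
    qed
  qed auto
  then show ?thesis by simp
qed

text \<open>The inequality form serves both purposes: with \<open>b = 0\<close>, applied to \<open>f\<close> and to \<open>- f\<close>, it gives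
constancy of the expectation, and with \<open>b < 0\<close> it bounds the time spent near the vertex. Stopping at push level
\<open>N\<close> changes each expectation by a multiple of the probability that the push exceeds \<open>N\<close>, which tends to zero.\<close>

lemma dynkin_le:
  assumes b: "\<And>s. s0 \<le> s \<Longrightarrow> s \<le> t \<Longrightarrow> expectation (\<lambda>\<omega>. of_bool (Z s \<omega> \<noteq> 0) * generator \<Sigma> \<mu> g H (Z s \<omega>)) \<le> b"
  shows "expectation (\<lambda>\<omega>. f (Z t \<omega>)) \<le> expectation (\<lambda>\<omega>. f (Z s0 \<omega>)) + b * (t - s0)"
proof -
  have t: "0 \<le> t" using s0 s0_less by simp
  have fi: "integrable M (\<lambda>\<omega>. f (Z s \<omega>))" if "0 \<le> s" for s
    using integrable_of_Z[OF that taylor_boundedD(2,5)[OF tb], of "\<lambda>_. 1"] by simp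
  obtain K' where K': "0 \<le> K'" "\<And>z. z \<in> quadrant \<Longrightarrow> \<bar>generator \<Sigma> \<mu> g H z\<bar> \<le> K'"
    using taylor_bounded_generator[OF tb] by metis
  have [measurable]: "push t \<in> borel_measurable M" using push_borel[OF t] .
  define p where "p N = expectation (\<lambda>\<omega>. of_bool (N < push t \<omega>) :: real)" for N
  have pI: "integrable M (\<lambda>\<omega>. of_bool (N < push t \<omega>) :: real)" for N
    by (rule integrable_const_bound[where B = 1]) auto
  have main: "expectation (\<lambda>\<omega>. f (Z t \<omega>)) - expectation (\<lambda>\<omega>. f (Z s0 \<omega>)) \<le> (4 * K + (t - s0) * K') * p N + b * (t - s0)"
    if N: "0 \<le> N" for N
  proof (rule field_le_epsilon)
    fix e :: real assume "0 < e"
    have "\<exists>n>0. expectation (\<lambda>\<omega>. \<Sum>i<n. of_bool (alive N n \<omega> i) * rest n \<omega> i) \<le> e"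
      using eventually_happens'[OF sequentially_bot eventually_conj[OF rest_vanishes[OF N \<open>0 < e\<close>] eventually_gt_at_top[of 0]]]
      by auto
    then obtain n where n: "0 < n" and rest: "expectation (\<lambda>\<omega>. \<Sum>i<n. of_bool (alive N n \<omega> i) * rest n \<omega> i) \<le> e"
      by auto
    let ?D = "\<lambda>\<omega>. \<Sum>i<n. of_bool (alive N n \<omega> i) * (f (Z (tick n (Suc i)) \<omega>) - f (Z (tick n i) \<omega>))"
    have Di: "integrable M ?D" by (intro Bochner_Integration.integrable_sum increment_integrable)
    \<comment> \<open>below the level \<open>N\<close> the sum telescopes, since steps after absorption vanish; above it, bounds by \<open>K\<close> suffice\<close>
    have path: "f (Z t \<omega>) - f (Z s0 \<omega>) \<le> ?D \<omega> + 4 * K * of_bool (N < push t \<omega>)" if \<omega>: "\<omega> \<in> space M" for \<omega>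
    proof (cases "push t \<omega> \<le> N")
      case True
      have "of_bool (alive N n \<omega> i) * (f (Z (tick n (Suc i)) \<omega>) - f (Z (tick n i) \<omega>)) =
          f (Z (tick n (Suc i)) \<omega>) - f (Z (tick n i) \<omega>)" if "i < n" for i
      proof (cases "Z (tick n i) \<omega> = 0")
        case True
        then show ?thesis using Z_absorbed[OF \<omega> tick_nonneg tick_mono[of i "Suc i" n]] by simp
      next
        case False
        then show ?thesis using True push_mono[OF \<omega> tick_nonneg tick_le[OF n, of i]] that by (simp add: alive_def)
      qed
      then have "?D \<omega> = (\<Sum>i<n. f (Z (tick n (Suc i)) \<omega>) - f (Z (tick n i) \<omega>))" by (intro sum.cong) auto
      also have "\<dots> = f (Z t \<omega>) - f (Z s0 \<omega>)"
        using sum_lessThan_telescope[of "\<lambda>i. f (Z (tick n i) \<omega>)" n] n by (simp add: tick_0 tick_n)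
      finally show ?thesis using True by simp
    next
      case False
      obtain k where "?D \<omega> = f (Z (tick n k) \<omega>) - f (Z (tick n 0) \<omega>)"
        using sum_until_exit_telescope[of n "alive N n \<omega>" "\<lambda>i. f (Z (tick n i) \<omega>)"] alive_dec[OF \<omega>] by blast
      moreover have "\<bar>f (Z s \<omega>)\<bar> \<le> K" if "0 \<le> s" for s
        using taylor_boundedD(5)[OF tb Z_quadrant[OF \<omega> that]] .
      from this[OF tick_nonneg, of n k] this[OF tick_nonneg, of n 0] this[OF t] this[OF s0]
      have "- K \<le> f (Z (tick n k) \<omega>)" "f (Z (tick n 0) \<omega>) \<le> K" "f (Z t \<omega>) \<le> K" "- K \<le> f (Z s0 \<omega>)" by auto
      ultimately show ?thesis using False by simp
    qed
    have "expectation (\<lambda>\<omega>. f (Z t \<omega>) - f (Z s0 \<omega>)) \<le> expectation (\<lambda>\<omega>. ?D \<omega> + 4 * K * of_bool (N < push t \<omega>))"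
      using path by (intro integral_mono Bochner_Integration.integrable_diff Bochner_Integration.integrable_add
          integrable_mult_right fi t s0 Di pI)
    then have "expectation (\<lambda>\<omega>. f (Z t \<omega>)) - expectation (\<lambda>\<omega>. f (Z s0 \<omega>)) \<le> expectation ?D + 4 * K * p N"
      using fi[OF t] fi[OF s0] Di pI unfolding p_def by simp
    also have "expectation ?D \<le> e + (\<Sum>i<n. (t - s0) / real n * (b + K' * p N))"
      unfolding increment_mean[OF n]
    proof (intro add_mono rest sum_mono mult_left_mono)
      fix i assume "i \<in> {..<n}"
      then have i: "s0 \<le> tick n i" "tick n i \<le> t" using tick_mono[of 0 i n] tick_le[OF n, of i] by (auto simp: tick_0)
      let ?G = "\<lambda>\<omega>. generator \<Sigma> \<mu> g H (Z (tick n i) \<omega>)"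
      have I: "integrable M (\<lambda>\<omega>. of_bool (Z (tick n i) \<omega> \<noteq> 0) * ?G \<omega>)"
        by (intro generator_integrable tick_nonneg nonzero_measurable) auto
      have "expectation (\<lambda>\<omega>. of_bool (alive N n \<omega> i) * ?G \<omega>)
        \<le> expectation (\<lambda>\<omega>. of_bool (Z (tick n i) \<omega> \<noteq> 0) * ?G \<omega> + K' * of_bool (N < push t \<omega>))"
      proof (intro integral_mono Bochner_Integration.integrable_add integrable_mult_right I pI generator_integrable tick_nonneg alive_borel)
        fix \<omega> assume \<omega>: "\<omega> \<in> space M"
        show "of_bool (alive N n \<omega> i) * ?G \<omega> \<le> of_bool (Z (tick n i) \<omega> \<noteq> 0) * ?G \<omega> + K' * of_bool (N < push t \<omega>)"
        proof (cases "push (tick n i) \<omega> \<le> N")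
          case True
          then show ?thesis using K' by (simp add: alive_def)
        next
          case False
          then have "N < push t \<omega>" using push_mono[OF \<omega> tick_nonneg i(2)] by simp
          then show ?thesis using False K'(1) K'(2)[OF Z_quadrant[OF \<omega> tick_nonneg], of n i]
            by (auto simp: alive_def of_bool_def)
        qed
      qed auto
      also have "\<dots> = expectation (\<lambda>\<omega>. of_bool (Z (tick n i) \<omega> \<noteq> 0) * ?G \<omega>) + K' * p N"
        using I pI unfolding p_def by simp
      finally show "expectation (\<lambda>\<omega>. of_bool (alive N n \<omega> i) * ?G \<omega>) \<le> b + K' * p N"
        using b[OF i] by simp
    qed (use s0_less in auto)
    also have "(\<Sum>i<n. (t - s0) / real n * (b + K' * p N)) = (t - s0) * (b + K' * p N)" using n by simp
    finally show "expectation (\<lambda>\<omega>. f (Z t \<omega>)) - expectation (\<lambda>\<omega>. f (Z s0 \<omega>)) \<le> (4 * K + (t - s0) * K') * p N + b * (t - s0) + e"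
      by (simp add: algebra_simps)
  qed
  have "(\<lambda>N. (4 * K + (t - s0) * K') * p (real N) + b * (t - s0)) \<longlonglongrightarrow> (4 * K + (t - s0) * K') * 0 + b * (t - s0)"
    using push_tail unfolding p_def by (intro tendsto_intros)
  then have "expectation (\<lambda>\<omega>. f (Z t \<omega>)) - expectation (\<lambda>\<omega>. f (Z s0 \<omega>)) \<le> (4 * K + (t - s0) * K') * 0 + b * (t - s0)"
    by (rule tendsto_lowerbound[OF _ always_eventually]) (use main in auto)
  then show ?thesis by simp
qed

end

section \<open>Affine functions times exponentials\<close>

lemma quadrant_convex: "z \<in> quadrant \<Longrightarrow> z' \<in> quadrant \<Longrightarrow> 0 \<le> s \<Longrightarrow> s \<le> 1 \<Longrightarrow> z + s *\<^sub>R (z' - z) \<in> quadrant"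
proof -
  assume a: "z \<in> quadrant" "z' \<in> quadrant" "0 \<le> s" "s \<le> 1"
  have "x + s * (y - x) = (1 - s) * x + s * y" for x y :: real by (simp add: algebra_simps)
  then show ?thesis using a by (auto simp: quadrant_def)
qed

lemma quadrant_norm_le: "z \<in> quadrant \<Longrightarrow> norm z \<le> z $ 1 + z $ 2"
  using norm_le_l1_cart[of z] by (auto simp: sum_2 quadrant_def)

text \<open>Affine functions enter because, at resonance, two exponents collide and the coefficients of a plain
sum of exponentials degenerate to a derivative with respect to the exponent.\<close>

definition affexp :: "real \<Rightarrow> real^2 \<Rightarrow> real^2 \<Rightarrow> real^2 \<Rightarrow> real" where
  "affexp c d p z = (c + d \<bullet> z) * exp (p \<bullet> z)"

definition affexp_grad :: "real \<Rightarrow> real^2 \<Rightarrow> real^2 \<Rightarrow> real^2 \<Rightarrow> real^2" where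
  "affexp_grad c d p z = exp (p \<bullet> z) *\<^sub>R (d + (c + d \<bullet> z) *\<^sub>R p)"

definition affexp_hess :: "real \<Rightarrow> real^2 \<Rightarrow> real^2 \<Rightarrow> real^2 \<Rightarrow> real^2^2" where
  "affexp_hess c d p z = (\<chi> j k. exp (p \<bullet> z) * (d $ j * p $ k + p $ j * d $ k + (c + d \<bullet> z) * (p $ j * p $ k)))"

lemma affexp_hess_form:
  "x \<bullet> (affexp_hess c d p z *v y) = exp (p \<bullet> z) * ((d \<bullet> x) * (p \<bullet> y) + (p \<bullet> x) * (d \<bullet> y) + (c + d \<bullet> z) * ((p \<bullet> x) * (p \<bullet> y)))"
  by (simp add: affexp_hess_def inner_vec_def matrix_vector_mult_def sum_2) (simp add: algebra_simps)

lemma generator_affexp: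
  assumes "transpose \<Sigma> = \<Sigma>"
  shows "generator \<Sigma> \<mu> (affexp_grad c d p) (affexp_hess c d p) z =
    exp (p \<bullet> z) * ((c + d \<bullet> z) * (p \<bullet> (\<Sigma> *v p) / 2 + p \<bullet> \<mu>) + d \<bullet> (\<Sigma> *v p + \<mu>))"
proof -
  have s: "\<Sigma> $ 2 $ 1 = \<Sigma> $ 1 $ 2"
    using arg_cong[OF assms, of "\<lambda>A. A $ 1 $ 2"] by (simp add: transpose_def)
  show ?thesis
    unfolding generator_def affexp_grad_def affexp_hess_def
    by (simp add: inner_vec_def matrix_vector_mult_def sum_2 s field_simps)
qed

lemma affexp_decay:
  assumes p: "p $ 1 < 0" "p $ 2 < 0"
  obtains C m where "0 < m" "0 \<le> C" "\<And>z. z \<in> quadrant \<Longrightarrow> \<bar>affexp c d p z\<bar> \<le> C * exp (- m * (z $ 1 + z $ 2))"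
proof -
  define m where "m = min (- p $ 1) (- p $ 2) / 2"
  define C where "C = \<bar>c\<bar> + norm d / m"
  have m: "0 < m" "p $ 1 \<le> - 2 * m" "p $ 2 \<le> - 2 * m" using p by (auto simp: m_def min_def)
  have "\<bar>affexp c d p z\<bar> \<le> C * exp (- m * (z $ 1 + z $ 2))" if z: "z \<in> quadrant" for z
  proof -
    define S where "S = z $ 1 + z $ 2"
    have S: "0 \<le> S" "norm z \<le> S" using z quadrant_norm_le[OF z] by (auto simp: S_def quadrant_def)
    have "p \<bullet> z \<le> - 2 * m * z $ 1 + - 2 * m * z $ 2"
      using m z unfolding inner_vec_def sum_2 inner_real_def quadrant_def by (intro add_mono mult_right_mono) auto
    then have e: "exp (p \<bullet> z) \<le> exp (- m * S) * exp (- m * S)"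
      by (simp add: S_def algebra_simps flip: exp_add)
    have "\<bar>c + d \<bullet> z\<bar> \<le> \<bar>c\<bar> + norm d * S"
      using Cauchy_Schwarz_ineq2[of d z] mult_left_mono[OF S(2), of "norm d"] by force
    moreover have "S * exp (- m * S) \<le> 1 / m"
    proof -
      have "m * S \<le> exp (m * S)" using exp_ge_add_one_self[of "m * S"] by linarith
      then show ?thesis using m by (simp add: exp_minus field_simps)
    qed
    moreover have "exp (- m * S) \<le> 1" using m S by simp
    ultimately have "\<bar>c + d \<bullet> z\<bar> * exp (- m * S) \<le> C"
    proof -
      have "\<bar>c + d \<bullet> z\<bar> * exp (- m * S) \<le> (\<bar>c\<bar> + norm d * S) * exp (- m * S)"
        using \<open>\<bar>c + d \<bullet> z\<bar> \<le> \<bar>c\<bar> + norm d * S\<close> by (intro mult_right_mono) auto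
      also have "\<dots> = \<bar>c\<bar> * exp (- m * S) + norm d * (S * exp (- m * S))" by (simp add: algebra_simps)
      also have "\<dots> \<le> \<bar>c\<bar> * 1 + norm d * (1 / m)"
        using \<open>S * exp (- m * S) \<le> 1 / m\<close> \<open>exp (- m * S) \<le> 1\<close> by (intro add_mono mult_left_mono) auto
      finally show ?thesis by (simp add: C_def)
    qed
    have "\<bar>affexp c d p z\<bar> = \<bar>c + d \<bullet> z\<bar> * exp (p \<bullet> z)" by (simp add: affexp_def abs_mult)
    also have "\<dots> \<le> \<bar>c + d \<bullet> z\<bar> * (exp (- m * S) * exp (- m * S))" using e by (intro mult_left_mono) auto
    also have "\<dots> = (\<bar>c + d \<bullet> z\<bar> * exp (- m * S)) * exp (- m * S)" by simp
    also have "\<dots> \<le> C * exp (- m * S)"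
      using \<open>\<bar>c + d \<bullet> z\<bar> * exp (- m * S) \<le> C\<close> by (intro mult_right_mono) auto
    finally show ?thesis by (simp add: S_def)
  qed
  moreover have "0 \<le> C" using m by (simp add: C_def)
  ultimately show ?thesis using m by (intro that[of m C]) auto
qed

lemma affexp_bounded:
  assumes "p $ 1 < 0" "p $ 2 < 0"
  shows "\<exists>B\<ge>0. \<forall>z\<in>quadrant. \<bar>affexp c d p z\<bar> \<le> B"
proof -
  obtain C m where C: "0 < m" "0 \<le> C" "\<And>z. z \<in> quadrant \<Longrightarrow> \<bar>affexp c d p z\<bar> \<le> C * exp (- m * (z $ 1 + z $ 2))"
    using affexp_decay[OF assms] by metis
  have "\<bar>affexp c d p z\<bar> \<le> C" if z: "z \<in> quadrant" for z
  proof -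
    have "exp (- m * (z $ 1 + z $ 2)) \<le> 1" using z C by (simp add: quadrant_def)
    then show ?thesis using C(3)[OF z] mult_left_mono[of "exp (- m * (z $ 1 + z $ 2))" 1 C] C(2) by linarith
  qed
  then show ?thesis using C(2) by (intro exI[of _ C]) simp
qed

text \<open>The \<open>k\<close>-th derivative of \<open>affexp\<close> along a line. Keeping the order \<open>k\<close> as an
argument allows Taylor's theorem to be applied directly.\<close>

definition affexp_line :: "real \<Rightarrow> real \<Rightarrow> real \<Rightarrow> real \<Rightarrow> nat \<Rightarrow> real \<Rightarrow> real" where
  "affexp_line A B a b k s = (real k * B * b ^ (k - 1) + (A + s * B) * b ^ k) * exp (a + s * b)"

lemma affexp_line_deriv: "(affexp_line A B a b k has_real_derivative affexp_line A B a b (Suc k) s) (at s)"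
  unfolding affexp_line_def
  by (rule derivative_eq_intros refl | (cases k; simp add: algebra_simps))+

lemma affexp_on_line: "affexp c d p (z + s *\<^sub>R w) = affexp_line (c + d \<bullet> z) (d \<bullet> w) (p \<bullet> z) (p \<bullet> w) 0 s"
  by (simp add: affexp_def affexp_line_def inner_add_right algebra_simps)

lemma exp_quadrant_le: "p $ 1 < 0 \<Longrightarrow> p $ 2 < 0 \<Longrightarrow> z \<in> quadrant \<Longrightarrow> exp (p \<bullet> z) \<le> 1"
  by (simp add: inner_vec_def sum_2 quadrant_def add_nonpos_nonpos mult_nonpos_nonneg)

lemma affexp_lipschitz:
  assumes p: "p $ 1 < 0" "p $ 2 < 0" and B: "\<And>z. z \<in> quadrant \<Longrightarrow> \<bar>affexp c d p z\<bar> \<le> B"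
    and z: "z \<in> quadrant" "z' \<in> quadrant"
  shows "\<bar>affexp c d p z' - affexp c d p z\<bar> \<le> (norm d + B * norm p) * norm (z' - z)"
proof -
  let ?w = "z' - z"
  let ?l = "affexp_line (c + d \<bullet> z) (d \<bullet> ?w) (p \<bullet> z) (p \<bullet> ?w)"
  obtain s where s: "0 < s" "s < 1" "?l 0 1 - ?l 0 0 = (1 - 0) * ?l (Suc 0) s"
    using MVT2[of 0 1 "?l 0" "?l (Suc 0)"] affexp_line_deriv by auto
  define y where "y = z + s *\<^sub>R ?w"
  have y: "y \<in> quadrant" unfolding y_def using quadrant_convex[OF z] s by auto
  have tri: "x = u + v \<Longrightarrow> \<bar>u\<bar> \<le> a \<Longrightarrow> \<bar>v\<bar> \<le> b \<Longrightarrow> y = x \<Longrightarrow> \<bar>y\<bar> \<le> a + b" for x y u v a b :: real by linarith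
  have "?l (Suc 0) s = (d \<bullet> ?w) * exp (p \<bullet> y) + affexp c d p y * (p \<bullet> ?w)"
    by (simp add: affexp_line_def affexp_def y_def inner_add_right algebra_simps)
  moreover have "\<bar>(d \<bullet> ?w) * exp (p \<bullet> y)\<bar> \<le> (norm d * norm ?w) * 1"
    unfolding abs_mult using exp_quadrant_le[OF p y] by (intro mult_mono Cauchy_Schwarz_ineq2) auto
  moreover have "\<bar>affexp c d p y * (p \<bullet> ?w)\<bar> \<le> B * (norm p * norm ?w)"
    unfolding abs_mult using B[OF y] by (intro mult_mono Cauchy_Schwarz_ineq2) auto
  moreover have "affexp c d p z' - affexp c d p z = ?l (Suc 0) s"
    using affexp_on_line[of c d p z 1 ?w] affexp_on_line[of c d p z 0 ?w] s(3) by simp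
  ultimately have "\<bar>affexp c d p z' - affexp c d p z\<bar> \<le> norm d * norm ?w * 1 + B * (norm p * norm ?w)"
    by (rule tri)
  then show ?thesis by (simp add: algebra_simps)
qed

lemma affexp_taylor:
  assumes p: "p $ 1 < 0" "p $ 2 < 0" and B: "\<And>z. z \<in> quadrant \<Longrightarrow> \<bar>affexp c d p z\<bar> \<le> B"
    and z: "z \<in> quadrant" "z' \<in> quadrant"
  shows "\<bar>affexp c d p z' - affexp c d p z - affexp_grad c d p z \<bullet> (z' - z) - (z' - z) \<bullet> (affexp_hess c d p z *v (z' - z)) / 2\<bar>
    \<le> (3 * norm d * norm p ^ 2 + B * norm p ^ 3) * norm (z' - z) ^ 3"
proof -
  let ?w = "z' - z"
  let ?l = "affexp_line (c + d \<bullet> z) (d \<bullet> ?w) (p \<bullet> z) (p \<bullet> ?w)"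
  obtain s where s: "0 < s" "s < 1" "?l 0 1 = (\<Sum>m<3. ?l m 0 / fact m * 1 ^ m) + ?l 3 s / fact 3 * 1 ^ 3"
    using Maclaurin[of 1 3 ?l "?l 0"] affexp_line_deriv by auto
  define y where "y = z + s *\<^sub>R ?w"
  have y: "y \<in> quadrant" unfolding y_def using quadrant_convex[OF z] s by auto
  have l3: "?l 3 s = 3 * (d \<bullet> ?w) * (p \<bullet> ?w) ^ 2 * exp (p \<bullet> y) + affexp c d p y * (p \<bullet> ?w) ^ 3"
    by (simp add: affexp_line_def affexp_def y_def inner_add_right algebra_simps)
  have "\<bar>3 * (d \<bullet> ?w) * (p \<bullet> ?w) ^ 2 * exp (p \<bullet> y)\<bar> \<le> 3 * (norm d * norm ?w) * (norm p * norm ?w) ^ 2 * 1"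
    unfolding abs_mult power_abs abs_numeral using exp_quadrant_le[OF p y]
    by (intro mult_mono power_mono Cauchy_Schwarz_ineq2) auto
  moreover have "\<bar>affexp c d p y * (p \<bullet> ?w) ^ 3\<bar> \<le> B * (norm p * norm ?w) ^ 3"
    unfolding abs_mult power_abs using B[OF y] by (intro mult_mono power_mono Cauchy_Schwarz_ineq2) auto
  ultimately have "\<bar>?l 3 s\<bar> \<le> 3 * (norm d * norm ?w) * (norm p * norm ?w) ^ 2 + B * (norm p * norm ?w) ^ 3"
    unfolding l3 by linarith
  also have "\<dots> = (3 * norm d * norm p ^ 2 + B * norm p ^ 3) * norm ?w ^ 3"
    by (simp add: power_mult_distrib power3_eq_cube power2_eq_square algebra_simps)
  finally have l3b: "\<bar>?l 3 s\<bar> \<le> (3 * norm d * norm p ^ 2 + B * norm p ^ 3) * norm ?w ^ 3" .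
  have "?l 0 1 = affexp c d p z'" "?l 0 0 = affexp c d p z"
    using affexp_on_line[of c d p z 1 ?w] affexp_on_line[of c d p z 0 ?w] by simp_all
  moreover have "?l 1 0 = affexp_grad c d p z \<bullet> ?w"
    by (simp add: affexp_line_def affexp_grad_def inner_add_left algebra_simps)
  moreover have "?l 2 0 = ?w \<bullet> (affexp_hess c d p z *v ?w)"
    unfolding affexp_hess_form by (simp add: affexp_line_def power2_eq_square algebra_simps)
  moreover have "?l 0 1 = ?l 0 0 + ?l 1 0 + ?l 2 0 / 2 + ?l 3 s / 6"
    using s(3) by (simp add: eval_nat_numeral)
  ultimately have "\<bar>affexp c d p z' - affexp c d p z - affexp_grad c d p z \<bullet> ?w - ?w \<bullet> (affexp_hess c d p z *v ?w) / 2\<bar> = \<bar>?l 3 s\<bar> / 6"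
    by (simp add: abs_if)
  then show ?thesis using l3b by linarith
qed

text \<open>Partial derivatives stay in the class, so bounds and Lipschitz constants of the gradient are those of the class.\<close>

lemma affexp_grad_component: "affexp_grad c d p z $ j = affexp (d $ j + c * p $ j) (p $ j *\<^sub>R d) p z"
  by (simp add: affexp_grad_def affexp_def algebra_simps)

lemma taylor_bounded_affexp:
  assumes p: "p $ 1 < 0" "p $ 2 < 0"
  obtains K where "taylor_bounded K (affexp c d p) (affexp_grad c d p) (affexp_hess c d p)"
proof -
  obtain B where B: "0 \<le> B" "\<And>z. z \<in> quadrant \<Longrightarrow> \<bar>affexp c d p z\<bar> \<le> B" using affexp_bounded[OF p, of c d] by blast
  have "\<exists>G. \<forall>j. 0 \<le> G j \<and> (\<forall>z\<in>quadrant. \<bar>affexp_grad c d p z $ j\<bar> \<le> G j)"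
    unfolding affexp_grad_component by (rule choice, rule allI, rule affexp_bounded[OF p])
  then obtain G where "\<forall>j. 0 \<le> G j \<and> (\<forall>z\<in>quadrant. \<bar>affexp_grad c d p z $ j\<bar> \<le> G j)" by (elim exE)
  then have G: "\<And>j. 0 \<le> G j" "\<And>z j. z \<in> quadrant \<Longrightarrow> \<bar>affexp_grad c d p z $ j\<bar> \<le> G j" by simp_all
  define K1 where "K1 = G 1 + G 2"
  define K2 where "K2 = (norm (p $ 1 *\<^sub>R d) + G 1 * norm p) + (norm (p $ 2 *\<^sub>R d) + G 2 * norm p)"
  define K3 where "K3 = 2 * norm d * norm p + B * norm p ^ 2"
  define K4 where "K4 = 3 * norm d * norm p ^ 2 + B * norm p ^ 3"
  define K where "K = B + K1 + K2 + K3 + K4"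
  have pos: "0 \<le> K1" "0 \<le> K2" "0 \<le> K3" "0 \<le> K4" using G(1) B(1) by (auto simp: K1_def K2_def K3_def K4_def)
  have le: "B \<le> K" "K1 \<le> K" "K2 \<le> K" "K3 \<le> K" "K4 \<le> K" "0 \<le> K" using pos B(1) by (auto simp: K_def)
  have up: "a \<le> k * b \<Longrightarrow> k \<le> K \<Longrightarrow> 0 \<le> b \<Longrightarrow> a \<le> K * b" for a b k :: real
    using mult_right_mono[of k K b] by linarith
  have "norm (affexp_grad c d p z) \<le> K1" if "z \<in> quadrant" for z
    using norm_le_l1_cart[of "affexp_grad c d p z"] G(2)[OF that, of 1] G(2)[OF that, of 2] by (simp add: sum_2 K1_def)
  then have g: "norm (affexp_grad c d p z) \<le> K" if "z \<in> quadrant" for z using that le by fastforce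
  have lip: "norm (affexp_grad c d p z' - affexp_grad c d p z) \<le> K * norm (z' - z)" if "z \<in> quadrant" "z' \<in> quadrant" for z z'
  proof (rule up[OF _ le(3)])
    have "\<bar>affexp_grad c d p z' $ j - affexp_grad c d p z $ j\<bar> \<le> (norm (p $ j *\<^sub>R d) + G j * norm p) * norm (z' - z)" for j
      using affexp_lipschitz[OF p G(2)[unfolded affexp_grad_component, of _ j] that] unfolding affexp_grad_component by blast
    from this[of 1] this[of 2]
    show "norm (affexp_grad c d p z' - affexp_grad c d p z) \<le> K2 * norm (z' - z)"
      using norm_le_l1_cart[of "affexp_grad c d p z' - affexp_grad c d p z"] by (simp add: sum_2 K2_def algebra_simps)
  qed auto
  have hess: "\<bar>x \<bullet> (affexp_hess c d p z *v y)\<bar> \<le> K * norm x * norm y" if "z \<in> quadrant" for x y z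
  proof -
    have *: "\<bar>u \<bullet> x\<bar> * \<bar>v \<bullet> y\<bar> \<le> (norm u * norm x) * (norm v * norm y)" for u v :: "real^2"
      by (intro mult_mono Cauchy_Schwarz_ineq2) auto
    have "x \<bullet> (affexp_hess c d p z *v y) = exp (p \<bullet> z) * ((d \<bullet> x) * (p \<bullet> y)) + exp (p \<bullet> z) * ((p \<bullet> x) * (d \<bullet> y)) + affexp c d p z * ((p \<bullet> x) * (p \<bullet> y))"
      unfolding affexp_hess_form affexp_def by (simp add: algebra_simps)
    moreover have "\<bar>exp (p \<bullet> z) * ((d \<bullet> x) * (p \<bullet> y))\<bar> \<le> 1 * ((norm d * norm x) * (norm p * norm y))"
      unfolding abs_mult by (rule mult_mono[OF _ *[of d p]]) (use exp_quadrant_le[OF p that] in auto)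
    moreover have "\<bar>exp (p \<bullet> z) * ((p \<bullet> x) * (d \<bullet> y))\<bar> \<le> 1 * ((norm p * norm x) * (norm d * norm y))"
      unfolding abs_mult by (rule mult_mono[OF _ *[of p d]]) (use exp_quadrant_le[OF p that] in auto)
    moreover have "\<bar>affexp c d p z * ((p \<bullet> x) * (p \<bullet> y))\<bar> \<le> B * ((norm p * norm x) * (norm p * norm y))"
      unfolding abs_mult by (rule mult_mono[OF B(2)[OF that] *[of p p] B(1)]) auto
    ultimately have "\<bar>x \<bullet> (affexp_hess c d p z *v y)\<bar> \<le> K3 * (norm x * norm y)"
      unfolding K3_def by (simp add: power2_eq_square algebra_simps)
    from up[OF this le(4)] show ?thesis by (simp add: mult.assoc)
  qed
  have tay: "\<bar>affexp c d p z' - affexp c d p z - affexp_grad c d p z \<bullet> (z' - z) - (z' - z) \<bullet> (affexp_hess c d p z *v (z' - z)) / 2\<bar>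
    \<le> K * norm (z' - z) ^ 3" if "z \<in> quadrant" "z' \<in> quadrant" for z z'
    by (rule up[OF _ le(5)]) (use affexp_taylor[OF p B(2) that] in \<open>auto simp: K4_def\<close>)
  have "taylor_bounded K (affexp c d p) (affexp_grad c d p) (affexp_hess c d p)"
    unfolding taylor_bounded_def
  proof (intro conjI ballI allI le(6) g lip hess tay)
    show "continuous_on UNIV (affexp c d p)" "continuous_on UNIV (affexp_grad c d p)"
      unfolding affexp_def affexp_grad_def by (intro continuous_intros)+
    show "continuous_on UNIV (\<lambda>z. affexp_hess c d p z $ j $ k)" for j k
      unfolding affexp_hess_def by (simp, intro continuous_intros)
    show "\<bar>affexp c d p z\<bar> \<le> K" if "z \<in> quadrant" for z using B(2)[OF that] le by linarith
  qed
  then show ?thesis by (rule that)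
qed

lemma taylor_bounded_add:
  assumes 1: "taylor_bounded K1 f1 g1 H1" and 2: "taylor_bounded K2 f2 g2 H2"
  shows "taylor_bounded (K1 + K2) (\<lambda>z. f1 z + f2 z) (\<lambda>z. g1 z + g2 z) (\<lambda>z. H1 z + H2 z)"
  unfolding taylor_bounded_def
proof (intro conjI ballI allI)
  show "0 \<le> K1 + K2" using taylor_boundedD(1)[OF 1] taylor_boundedD(1)[OF 2] by simp
  show "continuous_on UNIV (\<lambda>z. f1 z + f2 z)" "continuous_on UNIV (\<lambda>z. g1 z + g2 z)"
    using taylor_boundedD(2,3)[OF 1] taylor_boundedD(2,3)[OF 2] by (auto intro: continuous_on_add)
  show "continuous_on UNIV (\<lambda>z. (H1 z + H2 z) $ j $ k)" for j k
    using taylor_boundedD(4)[OF 1, of j k] taylor_boundedD(4)[OF 2, of j k] by (simp add: continuous_on_add)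
  fix z :: "real^2" assume z: "z \<in> quadrant"
  show "\<bar>f1 z + f2 z\<bar> \<le> K1 + K2" using taylor_boundedD(5)[OF 1 z] taylor_boundedD(5)[OF 2 z] by linarith
  show "norm (g1 z + g2 z) \<le> K1 + K2"
    using taylor_boundedD(6)[OF 1 z] taylor_boundedD(6)[OF 2 z] norm_triangle_ineq[of "g1 z" "g2 z"] by linarith
  show "\<bar>x \<bullet> ((H1 z + H2 z) *v y)\<bar> \<le> (K1 + K2) * norm x * norm y" for x y
    using taylor_boundedD(7)[OF 1 z, of x y] taylor_boundedD(7)[OF 2 z, of x y]
    by (simp add: matrix_vector_mult_add_rdistrib inner_add_right algebra_simps)
  fix z' :: "real^2" assume z': "z' \<in> quadrant"
  have "g1 z' + g2 z' - (g1 z + g2 z) = (g1 z' - g1 z) + (g2 z' - g2 z)" by simp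
  then show "norm (g1 z' + g2 z' - (g1 z + g2 z)) \<le> (K1 + K2) * norm (z' - z)"
    using taylor_boundedD(8)[OF 1 z z'] taylor_boundedD(8)[OF 2 z z'] norm_triangle_ineq[of "g1 z' - g1 z" "g2 z' - g2 z"]
    by (simp add: algebra_simps)
  show "\<bar>f1 z' + f2 z' - (f1 z + f2 z) - (g1 z + g2 z) \<bullet> (z' - z) - (z' - z) \<bullet> ((H1 z + H2 z) *v (z' - z)) / 2\<bar>
      \<le> (K1 + K2) * norm (z' - z) ^ 3"
    using taylor_boundedD(9)[OF 1 z z'] taylor_boundedD(9)[OF 2 z z']
    unfolding matrix_vector_mult_add_rdistrib inner_add_left inner_add_right add_divide_distrib distrib_right by linarith
qed

lemma taylor_bounded_scale:
  assumes 1: "taylor_bounded K f g H"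
  shows "taylor_bounded (\<bar>a\<bar> * K) (\<lambda>z. a * f z) (\<lambda>z. a *\<^sub>R g z) (\<lambda>z. a *\<^sub>R H z)"
  unfolding taylor_bounded_def
proof (intro conjI ballI allI)
  show "0 \<le> \<bar>a\<bar> * K" using taylor_boundedD(1)[OF 1] by simp
  show "continuous_on UNIV (\<lambda>z. a * f z)" "continuous_on UNIV (\<lambda>z. a *\<^sub>R g z)"
    using taylor_boundedD(2,3)[OF 1] by (auto intro: continuous_intros)
  show "continuous_on UNIV (\<lambda>z. (a *\<^sub>R H z) $ j $ k)" for j k
    using taylor_boundedD(4)[OF 1, of j k] by (simp add: continuous_on_mult_left)
  have up: "\<bar>x\<bar> \<le> K * b \<Longrightarrow> \<bar>a * x\<bar> \<le> \<bar>a\<bar> * K * b" for x b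
    by (simp add: abs_mult mult.assoc mult_left_mono)
  fix z :: "real^2" assume z: "z \<in> quadrant"
  show "\<bar>a * f z\<bar> \<le> \<bar>a\<bar> * K" using taylor_boundedD(5)[OF 1 z] by (simp add: abs_mult mult_left_mono)
  show "norm (a *\<^sub>R g z) \<le> \<bar>a\<bar> * K" using taylor_boundedD(6)[OF 1 z] by (simp add: mult_left_mono)
  show "\<bar>x \<bullet> ((a *\<^sub>R H z) *v y)\<bar> \<le> \<bar>a\<bar> * K * norm x * norm y" for x y
    using up[of "x \<bullet> (H z *v y)" "norm x * norm y"] taylor_boundedD(7)[OF 1 z, of x y]
    by (simp add: scaleR_matrix_vector_assoc[symmetric] mult.assoc)
  fix z' :: "real^2" assume z': "z' \<in> quadrant"
  have "norm (a *\<^sub>R g z' - a *\<^sub>R g z) = \<bar>a\<bar> * norm (g z' - g z)" by (simp flip: scaleR_diff_right)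
  then show "norm (a *\<^sub>R g z' - a *\<^sub>R g z) \<le> \<bar>a\<bar> * K * norm (z' - z)"
    using taylor_boundedD(8)[OF 1 z z'] by (simp add: mult.assoc mult_left_mono)
  have "a * f z' - a * f z - (a *\<^sub>R g z) \<bullet> (z' - z) - (z' - z) \<bullet> ((a *\<^sub>R H z) *v (z' - z)) / 2 =
    a * (f z' - f z - g z \<bullet> (z' - z) - (z' - z) \<bullet> (H z *v (z' - z)) / 2)"
    by (simp add: scaleR_matrix_vector_assoc[symmetric] right_diff_distrib)
  then show "\<bar>a * f z' - a * f z - (a *\<^sub>R g z) \<bullet> (z' - z) - (z' - z) \<bullet> ((a *\<^sub>R H z) *v (z' - z)) / 2\<bar>
      \<le> \<bar>a\<bar> * K * norm (z' - z) ^ 3"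
    using up[OF taylor_boundedD(9)[OF 1 z z']] by simp
qed

lemma generator_add: "generator \<Sigma> \<mu> (\<lambda>z. g1 z + g2 z) (\<lambda>z. H1 z + H2 z) z = generator \<Sigma> \<mu> g1 H1 z + generator \<Sigma> \<mu> g2 H2 z"
  by (simp add: generator_def sum_2 inner_add_left algebra_simps add_divide_distrib)

lemma generator_scale: "generator \<Sigma> \<mu> (\<lambda>z. a *\<^sub>R g z) (\<lambda>z. a *\<^sub>R H z) z = a * generator \<Sigma> \<mu> g H z"
  by (simp add: generator_def sum_2 algebra_simps add_divide_distrib)

definition vanishes_at_infinity :: "(real^2 \<Rightarrow> real) \<Rightarrow> bool" where
  "vanishes_at_infinity f \<longleftrightarrow> (\<forall>e>0. \<exists>R. \<forall>z\<in>quadrant. R \<le> z $ 1 + z $ 2 \<longrightarrow> \<bar>f z\<bar> \<le> e)"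

lemma vanishes_affexp:
  assumes "p $ 1 < 0" "p $ 2 < 0" shows "vanishes_at_infinity (affexp c d p)"
  unfolding vanishes_at_infinity_def
proof (intro allI impI)
  fix e :: real assume e: "0 < e"
  obtain C m where C: "0 < m" "0 \<le> C" "\<And>z. z \<in> quadrant \<Longrightarrow> \<bar>affexp c d p z\<bar> \<le> C * exp (- m * (z $ 1 + z $ 2))"
    using affexp_decay[OF assms] by metis
  have "((\<lambda>S. C * exp (- m * S)) \<longlongrightarrow> C * 0) at_top"
    using C(1) by (intro tendsto_intros filterlim_compose[OF exp_at_bot] filterlim_tendsto_neg_mult_at_bot[OF tendsto_const _ filterlim_ident]) auto
  then have "\<forall>\<^sub>F S in at_top. C * exp (- m * S) < e" using e by (intro order_tendstoD) auto
  then obtain R where "\<And>S. R \<le> S \<Longrightarrow> C * exp (- m * S) < e" by (auto simp: eventually_at_top_linorder)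
  then have "\<bar>affexp c d p z\<bar> \<le> e" if "z \<in> quadrant" "R \<le> z $ 1 + z $ 2" for z
    using C(3)[OF that(1)] that(2) by (meson less_imp_le order_trans)
  then show "\<exists>R. \<forall>z\<in>quadrant. R \<le> z $ 1 + z $ 2 \<longrightarrow> \<bar>affexp c d p z\<bar> \<le> e" by blast
qed

lemma vanishes_add:
  assumes "vanishes_at_infinity f1" "vanishes_at_infinity f2"
  shows "vanishes_at_infinity (\<lambda>z. f1 z + f2 z)"
  unfolding vanishes_at_infinity_def
proof (intro allI impI)
  fix e :: real assume "0 < e"
  then have "0 < e / 2" by simp
  then obtain R1 R2 where R: "\<And>z. z \<in> quadrant \<Longrightarrow> R1 \<le> z $ 1 + z $ 2 \<Longrightarrow> \<bar>f1 z\<bar> \<le> e / 2"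
    "\<And>z. z \<in> quadrant \<Longrightarrow> R2 \<le> z $ 1 + z $ 2 \<Longrightarrow> \<bar>f2 z\<bar> \<le> e / 2"
    using assms unfolding vanishes_at_infinity_def by meson
  show "\<exists>R. \<forall>z\<in>quadrant. R \<le> z $ 1 + z $ 2 \<longrightarrow> \<bar>f1 z + f2 z\<bar> \<le> e"
  proof (intro exI[of _ "max R1 R2"] ballI impI)
    fix z :: "real^2" assume "z \<in> quadrant" "max R1 R2 \<le> z $ 1 + z $ 2"
    then show "\<bar>f1 z + f2 z\<bar> \<le> e" using R[of z] by linarith
  qed
qed

lemma vanishes_scale: "vanishes_at_infinity f \<Longrightarrow> vanishes_at_infinity (\<lambda>z. a * f z)"
  unfolding vanishes_at_infinity_def
proof (intro allI impI)
  fix e :: real assume f: "\<forall>e>0. \<exists>R. \<forall>z\<in>quadrant. R \<le> z $ 1 + z $ 2 \<longrightarrow> \<bar>f z\<bar> \<le> e" and "0 < e"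
  then have "0 < e / (\<bar>a\<bar> + 1)" by (simp add: add_nonneg_pos)
  with f obtain R where R: "\<forall>z\<in>quadrant. R \<le> z $ 1 + z $ 2 \<longrightarrow> \<bar>f z\<bar> \<le> e / (\<bar>a\<bar> + 1)" by meson
  have "\<bar>a * x\<bar> \<le> e" if "\<bar>x\<bar> \<le> e / (\<bar>a\<bar> + 1)" for x
  proof -
    have "\<bar>a * x\<bar> \<le> (\<bar>a\<bar> + 1) * \<bar>x\<bar>" by (simp add: abs_mult mult_right_mono)
    also have "\<dots> \<le> (\<bar>a\<bar> + 1) * (e / (\<bar>a\<bar> + 1))" using that by (intro mult_left_mono) auto
    also have "\<dots> = e" by (simp add: add_nonneg_eq_0_iff)
    finally show ?thesis .
  qed
  then show "\<exists>R. \<forall>z\<in>quadrant. R \<le> z $ 1 + z $ 2 \<longrightarrow> \<bar>a * f z\<bar> \<le> e" using R by blast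
qed

section \<open>A maximum principle with oblique derivatives\<close>

lemma small_cubic:
  fixes a b C \<delta> :: real
  assumes \<delta>: "0 < \<delta>" and le: "\<And>s. 0 < s \<Longrightarrow> s < \<delta> \<Longrightarrow> s * a + s ^ 2 * b \<le> C * s ^ 3"
  shows "a \<le> 0" "a = 0 \<Longrightarrow> b \<le> 0"
proof -
  have ev: "\<forall>\<^sub>F s in at_right 0. 0 < s \<and> s < \<delta>"
    using \<delta> by (auto simp: eventually_at_right_less eventually_conj_iff intro: eventually_at_right_real[THEN eventually_mono])
  have "((\<lambda>s. C * s ^ 2 - s * b) \<longlongrightarrow> C * 0 ^ 2 - 0 * b) (at_right 0)"
    by (intro tendsto_intros)
  moreover have "\<forall>\<^sub>F s in at_right 0. a \<le> C * s ^ 2 - s * b"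
    using ev
  proof eventually_elim
    case (elim s)
    then have "s * a \<le> s * (C * s ^ 2 - s * b)"
      using le[of s] by (simp add: power2_eq_square power3_eq_cube algebra_simps)
    then show ?case using elim by simp
  qed
  ultimately show "a \<le> 0" by (auto dest: tendsto_lowerbound)
  assume "a = 0"
  have "((\<lambda>s. C * s) \<longlongrightarrow> C * 0) (at_right 0)"
    by (intro tendsto_intros)
  moreover have "\<forall>\<^sub>F s in at_right 0. b \<le> C * s"
    using ev
  proof eventually_elim
    case (elim s)
    then have "s ^ 2 * b \<le> s ^ 2 * (C * s)"
      using le[of s] \<open>a = 0\<close> by (simp add: power2_eq_square power3_eq_cube algebra_simps)
    then show ?case using elim by simp
  qed
  ultimately show "b \<le> 0" by (auto dest: tendsto_lowerbound)
qed

text \<open>First- and second-order conditions at a maximum, for one-sided directions, so that they also apply on the axes.\<close>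

lemma taylor_at_max:
  assumes tb: "taylor_bounded K f g H" and z: "z \<in> quadrant" and max: "\<And>y. y \<in> quadrant \<Longrightarrow> f y \<le> f z"
    and \<delta>: "0 < \<delta>" "\<And>s. 0 < s \<Longrightarrow> s < \<delta> \<Longrightarrow> z + s *\<^sub>R v \<in> quadrant"
  shows "g z \<bullet> v \<le> 0" "g z \<bullet> v = 0 \<Longrightarrow> v \<bullet> (H z *v v) \<le> 0"
proof -
  have le: "s * (g z \<bullet> v) + s ^ 2 * (v \<bullet> (H z *v v) / 2) \<le> (K * norm v ^ 3) * s ^ 3" if s: "0 < s" "s < \<delta>" for s
  proof -
    have q: "z + s *\<^sub>R v \<in> quadrant" using \<delta>(2)[OF s] .
    have "g z \<bullet> (s *\<^sub>R v) + (s *\<^sub>R v) \<bullet> (H z *v (s *\<^sub>R v)) / 2 \<le> K * norm (s *\<^sub>R v) ^ 3"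
      using taylor_boundedD(9)[OF tb z q] max[OF q] by auto
    then show ?thesis using s by (simp add: matrix_vector_mult_scaleR power2_eq_square power3_eq_cube algebra_simps)
  qed
  show "g z \<bullet> v \<le> 0" "g z \<bullet> v = 0 \<Longrightarrow> v \<bullet> (H z *v v) \<le> 0"
    using small_cubic[OF \<delta>(1) le] by auto
qed

lemma pos_def_minors:
  fixes \<Sigma> :: "real^2^2"
  assumes "transpose \<Sigma> = \<Sigma>" and pd: "\<And>c. c \<noteq> 0 \<Longrightarrow> 0 < c \<bullet> (\<Sigma> *v c)"
  shows "\<Sigma> $ 2 $ 1 = \<Sigma> $ 1 $ 2" "0 < \<Sigma> $ 1 $ 1" "0 < \<Sigma> $ 2 $ 2" "0 < \<Sigma> $ 1 $ 1 * \<Sigma> $ 2 $ 2 - (\<Sigma> $ 1 $ 2)\<^sup>2"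
proof -
  show s: "\<Sigma> $ 2 $ 1 = \<Sigma> $ 1 $ 2"
    using arg_cong[OF assms(1), of "\<lambda>A. A $ 1 $ 2"] by (simp add: transpose_def)
  have d: "0 < \<Sigma> $ j $ j" for j
    using pd[of "axis j 1"] by (simp add: axis_eq_0_iff inner_axis' matrix_vector_mul_component inner_axis)
  show "0 < \<Sigma> $ 1 $ 1" "0 < \<Sigma> $ 2 $ 2" using d by auto
  define c :: "real^2" where "c = vector [\<Sigma> $ 1 $ 2, - \<Sigma> $ 1 $ 1]"
  have c: "c $ 1 = \<Sigma> $ 1 $ 2" "c $ 2 = - \<Sigma> $ 1 $ 1" by (simp_all add: c_def)
  have "c \<noteq> 0" using c(2) d[of 1] by (metis less_irrefl neg_equal_0_iff_equal zero_index)
  then have "0 < c \<bullet> (\<Sigma> *v c)" using pd by blast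
  also have "c \<bullet> (\<Sigma> *v c) = \<Sigma> $ 1 $ 1 * (\<Sigma> $ 1 $ 1 * \<Sigma> $ 2 $ 2 - (\<Sigma> $ 1 $ 2)\<^sup>2)"
    by (simp add: inner_vec_def matrix_vector_mult_def sum_2 c s power2_eq_square algebra_simps)
  finally show "0 < \<Sigma> $ 1 $ 1 * \<Sigma> $ 2 $ 2 - (\<Sigma> $ 1 $ 2)\<^sup>2" using d[of 1] by (simp add: zero_less_mult_iff)
qed

text \<open>At an interior maximum the gradient vanishes and the Hessian is nonpositive, hence so is its trace against the positive
definite matrix \<open>\<Sigma>\<close>. At a maximum on an axis other than the vertex, \<open>R\<^sup>j\<close> points into the quadrant, so the derivative
along \<open>R\<^sup>j\<close> is nonpositive. Strict inequalities exclude both.\<close>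

lemma maximum_at_vertex:
  fixes \<Sigma> :: "real^2^2"
  assumes sym: "transpose \<Sigma> = \<Sigma>" and pd: "\<And>c. c \<noteq> 0 \<Longrightarrow> 0 < c \<bullet> (\<Sigma> *v c)"
    and tb: "taylor_bounded K f g H" and van: "vanishes_at_infinity f"
    and sub: "\<And>z. z \<in> quadrant \<Longrightarrow> 0 < generator \<Sigma> \<mu> g H z"
    and bd: "\<And>z j. z \<in> quadrant \<Longrightarrow> z $ j = 0 \<Longrightarrow> 0 < g z \<bullet> refl_dir r1 r2 j"
    and z: "z \<in> quadrant"
  shows "f z \<le> max 0 (f 0)"
proof (rule ccontr)
  assume "\<not> f z \<le> max 0 (f 0)"
  then have pos: "0 < f z" "f 0 < f z" by auto
  then have "0 < f z / 2" by simp
  then obtain R where R: "\<And>y. y \<in> quadrant \<Longrightarrow> R \<le> y $ 1 + y $ 2 \<Longrightarrow> \<bar>f y\<bar> \<le> f z / 2"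
    using van unfolding vanishes_at_infinity_def by meson
  define Q where "Q = {y. 0 \<le> y $ 1} \<inter> {y. 0 \<le> y $ 2} \<inter> {y :: real^2. y $ 1 + y $ 2 \<le> R}"
  have Q: "y \<in> Q \<longleftrightarrow> y \<in> quadrant \<and> y $ 1 + y $ 2 \<le> R" for y by (auto simp: Q_def quadrant_def)
  have "closed Q" unfolding Q_def
    by (intro closed_Int closed_Collect_le continuous_intros)
  moreover have "bounded Q"
    unfolding bounded_iff using Q quadrant_norm_le by (meson order_trans)
  ultimately have "compact Q" by (simp add: compact_eq_bounded_closed)
  moreover have zQ: "z \<in> Q" using R[OF z] pos(1) z by (cases "R \<le> z $ 1 + z $ 2") (auto simp: Q)
  ultimately obtain m where m: "m \<in> Q" "\<And>y. y \<in> Q \<Longrightarrow> f y \<le> f m"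
    using continuous_attains_sup[of Q f] continuous_on_subset[OF taylor_boundedD(2)[OF tb], of Q] by auto
  have mq: "m \<in> quadrant" using m(1) by (simp add: Q)
  have max: "f y \<le> f m" if "y \<in> quadrant" for y
  proof (cases "y \<in> Q")
    case False
    then have "\<bar>f y\<bar> \<le> f z / 2" using R[OF that] that by (auto simp: Q)
    then show ?thesis using m(2)[OF zQ] pos(1) by linarith
  qed (use m in auto)
  have "m \<noteq> 0" using m(2)[OF zQ] pos(2) by auto
  note crit = taylor_at_max[OF tb mq max]
  show False
  proof (cases "\<exists>j. m $ j = 0")
    case True
    have step: "g m \<bullet> refl_dir r1 r2 j \<le> 0" if j: "m $ j = 0" for j
    proof -
      define k :: 2 where "k = (if j = 1 then 2 else 1)"
      have k: "k \<noteq> j" "i = j \<or> i = k" for i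
        using exhaust_2[of j] exhaust_2[of i] by (auto simp: k_def)
      have "m $ k \<noteq> 0"
      proof
        assume "m $ k = 0"
        then have "m $ i = 0" for i using j k(2)[of i] by auto
        then show False using \<open>m \<noteq> 0\<close> by (simp add: vec_eq_iff)
      qed
      then have mk: "0 < m $ k" using mq exhaust_2[of k] by (auto simp: quadrant_def)
      have Rj: "refl_dir r1 r2 j $ j = 1" using exhaust_2[of j] by (auto simp: refl_dir_simps)
      let ?c = "\<bar>refl_dir r1 r2 j $ k\<bar> + 1"
      show ?thesis
      proof (rule crit(1))
        show "0 < m $ k / ?c" using mk by (simp add: add_nonneg_pos)
        fix s assume s: "0 < s" "s < m $ k / ?c"
        then have "s * ?c < m $ k" by (simp add: pos_less_divide_eq add_nonneg_pos)
        moreover have "s * \<bar>refl_dir r1 r2 j $ k\<bar> \<le> s * ?c" using s by simp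
        moreover have "- (s * refl_dir r1 r2 j $ k) \<le> s * \<bar>refl_dir r1 r2 j $ k\<bar>"
          using s mult_left_mono[of "- (refl_dir r1 r2 j $ k)" "\<bar>refl_dir r1 r2 j $ k\<bar>" s] by simp
        ultimately have "0 \<le> (m + s *\<^sub>R refl_dir r1 r2 j) $ k" by simp
        moreover have "0 \<le> (m + s *\<^sub>R refl_dir r1 r2 j) $ j" using j Rj s by simp
        ultimately show "m + s *\<^sub>R refl_dir r1 r2 j \<in> quadrant"
          unfolding quadrant_def using k(2) by (metis (mono_tags, lifting) mem_Collect_eq)
      qed
    qed
    then show False using True bd[OF mq] by fastforce
  next
    case False
    then have mp: "0 < m $ 1" "0 < m $ 2" using mq by (auto simp: quadrant_def less_le)
    have room: "\<exists>\<delta>>0. \<forall>s. 0 < s \<longrightarrow> s < \<delta> \<longrightarrow> m + s *\<^sub>R v \<in> quadrant" for v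
    proof -
      let ?c = "norm v + 1"
      have c: "0 < ?c" by (simp add: add_nonneg_pos)
      have "m + s *\<^sub>R v \<in> quadrant" if s: "0 < s" "s < min (m $ 1) (m $ 2) / ?c" for s
      proof -
        have "s * ?c < min (m $ 1) (m $ 2)" using s c by (simp only: pos_less_divide_eq)
        moreover have "s * \<bar>v $ j\<bar> \<le> s * ?c" for j using s component_le_norm_cart[of v j] by (intro mult_left_mono) auto
        moreover have "- (s * v $ j) \<le> s * \<bar>v $ j\<bar>" for j using s mult_left_mono[of "- v $ j" "\<bar>v $ j\<bar>" s] by simp
        ultimately have "- (s * v $ j) < min (m $ 1) (m $ 2)" for j by (meson le_less_trans)
        from this[of 1] this[of 2] show ?thesis by (simp add: quadrant_def)
      qed
      then show ?thesis using mp c by (intro exI[of _ "min (m $ 1) (m $ 2) / ?c"]) auto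
    qed
    have grad: "g m \<bullet> v = 0" for v
    proof (rule antisym)
      have "g m \<bullet> v \<le> 0" for v using crit(1) room[of v] by blast
      from this[of v] this[of "- v"] show "g m \<bullet> v \<le> 0" "0 \<le> g m \<bullet> v" by auto
    qed
    have hess: "v \<bullet> (H m *v v) \<le> 0" for v using crit(2) room[of v] grad by blast
    define u :: "real^2" where "u = vector [\<Sigma> $ 1 $ 1, \<Sigma> $ 1 $ 2]"
    define d where "d = \<Sigma> $ 1 $ 1 * \<Sigma> $ 2 $ 2 - (\<Sigma> $ 1 $ 2)\<^sup>2"
    have u: "u $ 1 = \<Sigma> $ 1 $ 1" "u $ 2 = \<Sigma> $ 1 $ 2" by (simp_all add: u_def)
    \<comment> \<open>completing the square writes \<open>\<Sigma>\<close> as a sum of two rank-one matrices, up to the factor \<open>\<Sigma>\<^sub>1\<^sub>1\<close>\<close>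
    have "\<Sigma> $ 1 $ 1 * (\<Sum>j\<in>UNIV. \<Sum>k\<in>UNIV. \<Sigma> $ j $ k * H m $ j $ k) = u \<bullet> (H m *v u) + d * H m $ 2 $ 2"
      by (simp add: inner_vec_def matrix_vector_mult_def sum_2 u d_def pos_def_minors(1)[OF sym pd] power2_eq_square algebra_simps)
    also have "H m $ 2 $ 2 = axis 2 1 \<bullet> (H m *v axis 2 1)"
      by (simp add: inner_axis' matrix_vector_mul_component inner_axis)
    also have "u \<bullet> (H m *v u) + d * (axis 2 1 \<bullet> (H m *v axis 2 1)) \<le> 0"
      using hess[of u] hess[of "axis 2 1"] pos_def_minors(4)[OF sym pd]
      by (intro add_nonpos_nonpos mult_nonneg_nonpos) (auto simp: d_def)
    finally have "(\<Sum>j\<in>UNIV. \<Sum>k\<in>UNIV. \<Sigma> $ j $ k * H m $ j $ k) \<le> 0"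
      using pos_def_minors(2)[OF sym pd] by (simp add: mult_le_0_iff)
    then show False using sub[OF mq] grad[of \<mu>] by (simp add: generator_def)
  qed
qed

text \<open>For such \<open>p\<close> the function \<open>exp (p \<bullet> z)\<close>, which is largest at the vertex, increases on average
both by the free motion and by the reflections. It perturbs weak inequalities in the maximum principle into strict ones, and
it shows that the process cannot stay in a bounded set without being absorbed.\<close>

definition draining_exponent :: "real^2^2 \<Rightarrow> real^2 \<Rightarrow> real \<Rightarrow> real \<Rightarrow> real^2 \<Rightarrow> bool" where
  "draining_exponent \<Sigma> \<mu> r1 r2 p \<longleftrightarrow> p $ 1 < 0 \<and> p $ 2 < 0 \<and> 0 < p \<bullet> (\<Sigma> *v p) / 2 + p \<bullet> \<mu> \<and>
     (\<forall>j. 0 < p \<bullet> refl_dir r1 r2 j)"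

text \<open>The reflection conditions for a direction \<open>- (1, s)\<close> read \<open>1 < r1 s\<close> and \<open>s < r2\<close>, which is possible exactly if
\<open>r1 r2 > 1\<close>; far out on this ray the quadratic term wins over the drift.\<close>

lemma draining_exponent_exists:
  fixes \<Sigma> :: "real^2^2"
  assumes pd: "\<And>c. c \<noteq> 0 \<Longrightarrow> 0 < c \<bullet> (\<Sigma> *v c)" and r: "0 < r1" "0 < r2" "1 < r1 * r2"
  obtains p where "draining_exponent \<Sigma> \<mu> r1 r2 p"
proof -
  define s where "s = (1 / r1 + r2) / 2"
  have s: "0 < s" "1 < r1 * s" "s < r2" using r by (auto simp: s_def field_simps)
  define e :: "real^2" where "e = vector [- 1, - s]"
  have e: "e $ 1 = - 1" "e $ 2 = - s" by (simp_all add: e_def)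
  have "e \<noteq> 0" using e(1) by (metis neg_equal_0_iff_equal one_neq_zero zero_index)
  then have E: "0 < e \<bullet> (\<Sigma> *v e)" using pd by blast
  define A where "A = e \<bullet> (\<Sigma> *v e)"
  define k where "k = 2 * (\<bar>e \<bullet> \<mu>\<bar> + 1) / A"
  have A: "0 < A" using E by (simp add: A_def)
  then have k: "0 < k" "k * A / 2 = \<bar>e \<bullet> \<mu>\<bar> + 1" by (simp_all add: k_def add_nonneg_pos)
  have "(k *\<^sub>R e) \<bullet> (\<Sigma> *v (k *\<^sub>R e)) / 2 + (k *\<^sub>R e) \<bullet> \<mu> = k * (k * A / 2 + e \<bullet> \<mu>)"
    by (simp add: matrix_vector_mult_scaleR A_def algebra_simps)
  moreover have "0 < k * (k * A / 2 + e \<bullet> \<mu>)" unfolding k(2) using k(1) by (intro mult_pos_pos) auto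
  moreover have "0 < (k *\<^sub>R e) \<bullet> refl_dir r1 r2 j" for j
    using exhaust_2[of j] k s by (auto simp: refl_dir_simps inner_vec_def sum_2 e algebra_simps)
  ultimately have "draining_exponent \<Sigma> \<mu> r1 r2 (k *\<^sub>R e)" using k s by (simp add: draining_exponent_def e)
  then show ?thesis by (rule that)
qed

lemma zero_at_vertex_imp_nonpos:
  fixes \<Sigma> :: "real^2^2"
  assumes sym: "transpose \<Sigma> = \<Sigma>" and pd: "\<And>c. c \<noteq> 0 \<Longrightarrow> 0 < c \<bullet> (\<Sigma> *v c)"
    and tb: "taylor_bounded K f g H" and van: "vanishes_at_infinity f"
    and harm: "\<And>z. z \<in> quadrant \<Longrightarrow> generator \<Sigma> \<mu> g H z = 0"
    and bd: "\<And>z j. z \<in> quadrant \<Longrightarrow> z $ j = 0 \<Longrightarrow> g z \<bullet> refl_dir r1 r2 j = 0"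
    and dr: "draining_exponent \<Sigma> \<mu> r1 r2 p" and f0: "f 0 = 0" and z: "z \<in> quadrant"
  shows "f z \<le> 0"
proof (rule ccontr)
  assume "\<not> f z \<le> 0"
  define \<eta> where "\<eta> = f z / 2"
  have \<eta>: "0 < \<eta>" using \<open>\<not> f z \<le> 0\<close> by (simp add: \<eta>_def)
  have p: "p $ 1 < 0" "p $ 2 < 0" using dr by (auto simp: draining_exponent_def)
  obtain K' where K': "taylor_bounded K' (affexp 1 0 p) (affexp_grad 1 0 p) (affexp_hess 1 0 p)"
    using taylor_bounded_affexp[OF p] by metis
  have "f z + \<eta> * affexp 1 0 p z \<le> max 0 (f 0 + \<eta> * affexp 1 0 p 0)"
  proof (rule maximum_at_vertex[OF sym pd taylor_bounded_add[OF tb taylor_bounded_scale[OF K', of \<eta>]]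
        vanishes_add[OF van vanishes_scale[OF vanishes_affexp[OF p]]] _ _ z])
    show "0 < generator \<Sigma> \<mu> (\<lambda>z. g z + \<eta> *\<^sub>R affexp_grad 1 0 p z) (\<lambda>z. H z + \<eta> *\<^sub>R affexp_hess 1 0 p z) y" if "y \<in> quadrant" for y
      unfolding generator_add generator_scale harm[OF that] generator_affexp[OF sym]
      using dr \<eta> by (simp add: draining_exponent_def)
    show "0 < (g y + \<eta> *\<^sub>R affexp_grad 1 0 p y) \<bullet> refl_dir r1 r2 j" if "y \<in> quadrant" "y $ j = 0" for y j
      using dr \<eta> by (simp add: inner_add_left bd[OF that] affexp_grad_def draining_exponent_def)
  qed
  then have "f z + \<eta> * affexp 1 0 p z \<le> \<eta>" using f0 \<eta> by (simp add: affexp_def)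
  moreover have "0 < \<eta> * affexp 1 0 p z" using \<eta> by (simp add: affexp_def)
  ultimately show False using \<eta> by (simp add: \<eta>_def)
qed

lemma zero_at_vertex_imp_zero:
  fixes \<Sigma> :: "real^2^2"
  assumes sym: "transpose \<Sigma> = \<Sigma>" and pd: "\<And>c. c \<noteq> 0 \<Longrightarrow> 0 < c \<bullet> (\<Sigma> *v c)"
    and tb: "taylor_bounded K f g H" and van: "vanishes_at_infinity f"
    and harm: "\<And>z. z \<in> quadrant \<Longrightarrow> generator \<Sigma> \<mu> g H z = 0"
    and bd: "\<And>z j. z \<in> quadrant \<Longrightarrow> z $ j = 0 \<Longrightarrow> g z \<bullet> refl_dir r1 r2 j = 0"
    and dr: "draining_exponent \<Sigma> \<mu> r1 r2 p" and f0: "f 0 = 0" and z: "z \<in> quadrant"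
  shows "f z = 0"
proof -
  have "- 1 * f z \<le> 0"
  proof (rule zero_at_vertex_imp_nonpos[OF sym pd taylor_bounded_scale[OF tb, of "- 1"] vanishes_scale[OF van] _ _ dr _ z])
    show "generator \<Sigma> \<mu> (\<lambda>z. - 1 *\<^sub>R g z) (\<lambda>z. - 1 *\<^sub>R H z) y = 0" if "y \<in> quadrant" for y
      unfolding generator_scale using harm[OF that] by simp
    show "(- 1 *\<^sub>R g y) \<bullet> refl_dir r1 r2 j = 0" if "y \<in> quadrant" "y $ j = 0" for y j
      using bd[OF that] by simp
    show "- 1 * f 0 = 0" using f0 by simp
  qed
  moreover have "f z \<le> 0"
    by (rule zero_at_vertex_imp_nonpos[OF sym pd tb van harm bd dr f0 z])
  ultimately show ?thesis by simp
qed

section \<open>Harmonic functions compute the hitting probability\<close>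

context absorbed_process begin

lemma dynkin_inequality:
  assumes tb: "taylor_bounded K f g H"
    and bd: "\<And>z j. z \<in> quadrant \<Longrightarrow> z $ j = 0 \<Longrightarrow> g z \<bullet> refl_dir r1 r2 j \<le> 0"
    and s: "0 \<le> s" "s < t"
    and b: "\<And>r. s \<le> r \<Longrightarrow> r \<le> t \<Longrightarrow> expectation (\<lambda>\<omega>. of_bool (Z r \<omega> \<noteq> 0) * generator \<Sigma> \<mu> g H (Z r \<omega>)) \<le> b"
  shows "expectation (\<lambda>\<omega>. f (Z t \<omega>)) \<le> expectation (\<lambda>\<omega>. f (Z s \<omega>)) + b * (t - s)"
proof -
  interpret dynkin M F \<Sigma> W \<mu> r1 r2 z0 L Z K f g H s t
    using tb bd s by unfold_locales auto
  show ?thesis using b by (rule dynkin_le)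
qed

lemma harmonic_mean:
  assumes tb: "taylor_bounded K f g H"
    and harm: "\<And>z. z \<in> quadrant \<Longrightarrow> generator \<Sigma> \<mu> g H z = 0"
    and bd: "\<And>z j. z \<in> quadrant \<Longrightarrow> z $ j = 0 \<Longrightarrow> g z \<bullet> refl_dir r1 r2 j = 0"
    and t: "0 \<le> t"
  shows "expectation (\<lambda>\<omega>. f (Z t \<omega>)) = f z0"
proof (cases "t = 0")
  case True
  have "expectation (\<lambda>\<omega>. f (Z 0 \<omega>)) = expectation (\<lambda>\<omega>. f z0)"
    by (intro Bochner_Integration.integral_cong) (auto simp: Z_start)
  then show ?thesis using True by (simp add: prob_space)
next
  case False
  then have t: "0 < t" using t by simp
  have start: "expectation (\<lambda>\<omega>. \<phi> (Z 0 \<omega>)) = \<phi> z0" for \<phi> :: "real^2 \<Rightarrow> real"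
  proof -
    have "expectation (\<lambda>\<omega>. \<phi> (Z 0 \<omega>)) = expectation (\<lambda>\<omega>. \<phi> z0)"
      by (intro Bochner_Integration.integral_cong) (auto simp: Z_start)
    then show ?thesis by (simp add: prob_space)
  qed
  have gen: "expectation (\<lambda>\<omega>. of_bool (Z r \<omega> \<noteq> 0) * generator \<Sigma> \<mu> g H (Z r \<omega>)) = 0" if "0 \<le> r" for r
  proof -
    have "expectation (\<lambda>\<omega>. of_bool (Z r \<omega> \<noteq> 0) * generator \<Sigma> \<mu> g H (Z r \<omega>)) = expectation (\<lambda>\<omega>. 0)"
      by (intro Bochner_Integration.integral_cong) (auto simp: harm Z_quadrant that)
    then show ?thesis by simp
  qed
  have "expectation (\<lambda>\<omega>. f (Z t \<omega>)) \<le> expectation (\<lambda>\<omega>. f (Z 0 \<omega>)) + 0 * (t - 0)"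
    by (rule dynkin_inequality[OF tb _ order_refl t]) (auto simp: bd gen)
  moreover have "expectation (\<lambda>\<omega>. - 1 * f (Z t \<omega>)) \<le> expectation (\<lambda>\<omega>. - 1 * f (Z 0 \<omega>)) + 0 * (t - 0)"
  proof (rule dynkin_inequality[OF taylor_bounded_scale[OF tb, of "- 1"] _ order_refl t])
    fix r :: real assume "0 \<le> r"
    have "expectation (\<lambda>\<omega>. of_bool (Z r \<omega> \<noteq> 0) * generator \<Sigma> \<mu> (\<lambda>z. - 1 *\<^sub>R g z) (\<lambda>z. - 1 *\<^sub>R H z) (Z r \<omega>)) = expectation (\<lambda>\<omega>. 0)"
      unfolding generator_scale
      by (intro Bochner_Integration.integral_cong) (auto simp: harm Z_quadrant \<open>0 \<le> r\<close>)
    then show "expectation (\<lambda>\<omega>. of_bool (Z r \<omega> \<noteq> 0) * generator \<Sigma> \<mu> (\<lambda>z. - 1 *\<^sub>R g z) (\<lambda>z. - 1 *\<^sub>R H z) (Z r \<omega>)) \<le> 0"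
      by simp
  qed (simp add: bd)
  ultimately show ?thesis by (simp add: start)
qed

text \<open>If the expectation were larger than \<open>c / n\<close> at all times in \<open>[n, 2 n]\<close>, then the bounded quantity \<open>- exp (p \<bullet> Z)\<close> would
decrease on average by more than its range during this time.\<close>

lemma occupation_small:
  assumes dr: "draining_exponent \<Sigma> \<mu> r1 r2 p"
  obtains c where "0 < c"
    "\<And>n::nat. 0 < n \<Longrightarrow> \<exists>s\<ge>real n. expectation (\<lambda>\<omega>. of_bool (Z s \<omega> \<noteq> 0) * affexp 1 0 p (Z s \<omega>)) \<le> c / real n"
proof -
  have p: "p $ 1 < 0" "p $ 2 < 0" using dr by (auto simp: draining_exponent_def)
  define \<kappa> where "\<kappa> = p \<bullet> (\<Sigma> *v p) / 2 + p \<bullet> \<mu>"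
  have \<kappa>: "0 < \<kappa>" using dr by (simp add: draining_exponent_def \<kappa>_def)
  obtain K where K: "taylor_bounded K (affexp (- 1) 0 p) (affexp_grad (- 1) 0 p) (affexp_hess (- 1) 0 p)"
    using taylor_bounded_affexp[OF p] by metis
  have range: "- 1 \<le> expectation (\<lambda>\<omega>. affexp (- 1) 0 p (Z s \<omega>)) \<and> expectation (\<lambda>\<omega>. affexp (- 1) 0 p (Z s \<omega>)) \<le> 0" if "0 \<le> s" for s
  proof -
    have i: "integrable M (\<lambda>\<omega>. affexp (- 1) 0 p (Z s \<omega>))"
      using integrable_of_Z[OF that taylor_boundedD(2,5)[OF K], of "\<lambda>_. 1"] by simp
    have "- 1 \<le> affexp (- 1) 0 p (Z s \<omega>)" "affexp (- 1) 0 p (Z s \<omega>) \<le> 0" if "\<omega> \<in> space M" for \<omega>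
      using exp_quadrant_le[OF p Z_quadrant[OF that \<open>0 \<le> s\<close>]] by (auto simp: affexp_def)
    note range = this
    have "expectation (\<lambda>\<omega>. - 1) \<le> expectation (\<lambda>\<omega>. affexp (- 1) 0 p (Z s \<omega>))"
      by (rule integral_mono) (use i range in auto)
    moreover have "expectation (\<lambda>\<omega>. affexp (- 1) 0 p (Z s \<omega>)) \<le> expectation (\<lambda>\<omega>. 0)"
      by (rule integral_mono) (use i range in auto)
    ultimately show ?thesis by (simp add: prob_space)
  qed
  have "\<exists>s\<ge>real n. expectation (\<lambda>\<omega>. of_bool (Z s \<omega> \<noteq> 0) * affexp 1 0 p (Z s \<omega>)) \<le> (2 / \<kappa>) / real n" if n: "0 < n" for n :: nat
  proof (rule ccontr)
    assume "\<not> ?thesis"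
    then have low: "(2 / \<kappa>) / real n \<le> expectation (\<lambda>\<omega>. of_bool (Z s \<omega> \<noteq> 0) * affexp 1 0 p (Z s \<omega>))" if "real n \<le> s" for s
      using that by (meson linear)
    have "expectation (\<lambda>\<omega>. affexp (- 1) 0 p (Z (2 * real n) \<omega>)) \<le>
      expectation (\<lambda>\<omega>. affexp (- 1) 0 p (Z (real n) \<omega>)) + (- \<kappa> * ((2 / \<kappa>) / real n)) * (2 * real n - real n)"
    proof (rule dynkin_inequality[OF K])
      show "affexp_grad (- 1) 0 p z \<bullet> refl_dir r1 r2 j \<le> 0" for z j
        using dr by (auto simp: affexp_grad_def draining_exponent_def mult_nonneg_nonneg less_imp_le)
      fix r assume r: "real n \<le> r"
      have "(\<lambda>\<omega>. of_bool (Z r \<omega> \<noteq> 0) * generator \<Sigma> \<mu> (affexp_grad (- 1) 0 p) (affexp_hess (- 1) 0 p) (Z r \<omega>)) =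
          (\<lambda>\<omega>. - \<kappa> * (of_bool (Z r \<omega> \<noteq> 0) * affexp 1 0 p (Z r \<omega>)))"
        unfolding generator_affexp[OF symmetric] by (rule ext) (simp add: affexp_def \<kappa>_def)
      then have "expectation (\<lambda>\<omega>. of_bool (Z r \<omega> \<noteq> 0) * generator \<Sigma> \<mu> (affexp_grad (- 1) 0 p) (affexp_hess (- 1) 0 p) (Z r \<omega>)) =
          - \<kappa> * expectation (\<lambda>\<omega>. of_bool (Z r \<omega> \<noteq> 0) * affexp 1 0 p (Z r \<omega>))"
        by (simp only: integral_mult_right_zero)
      also have "\<dots> \<le> - \<kappa> * ((2 / \<kappa>) / real n)" using low[OF r] \<kappa> by (intro mult_left_mono_neg) auto
      finally show "expectation (\<lambda>\<omega>. of_bool (Z r \<omega> \<noteq> 0) * generator \<Sigma> \<mu> (affexp_grad (- 1) 0 p) (affexp_hess (- 1) 0 p) (Z r \<omega>))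
          \<le> - \<kappa> * ((2 / \<kappa>) / real n)" .
    qed (use n in auto)
    then have "expectation (\<lambda>\<omega>. affexp (- 1) 0 p (Z (2 * real n) \<omega>)) \<le> expectation (\<lambda>\<omega>. affexp (- 1) 0 p (Z (real n) \<omega>)) - 2"
      using \<kappa> n by simp
    then show False using range[of "2 * real n"] range[of "real n"] by simp
  qed
  then show ?thesis using \<kappa> by (intro that[of "2 / \<kappa>"]) auto
qed

lemma vanishing_dominated:
  assumes p: "p $ 1 < 0" "p $ 2 < 0" and van: "vanishes_at_infinity f" and B: "\<And>z. z \<in> quadrant \<Longrightarrow> \<bar>f z\<bar> \<le> B" and e: "0 < e"
  obtains C where "0 \<le> C" "\<And>z. z \<in> quadrant \<Longrightarrow> \<bar>f z\<bar> \<le> e + C * affexp 1 0 p z"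
proof -
  obtain R where R: "\<And>z. z \<in> quadrant \<Longrightarrow> R \<le> z $ 1 + z $ 2 \<Longrightarrow> \<bar>f z\<bar> \<le> e"
    using van e unfolding vanishes_at_infinity_def by meson
  have B0: "0 \<le> B" using B[OF zero_in_quadrant] by simp
  define m where "m = max (- p $ 1) (- p $ 2)"
  define C where "C = B * exp (m * R)"
  have "\<bar>f z\<bar> \<le> e + C * affexp 1 0 p z" if z: "z \<in> quadrant" for z
  proof (cases "R \<le> z $ 1 + z $ 2")
    case True
    then show ?thesis using R[OF z] B0 by (simp add: C_def affexp_def add_increasing2)
  next
    case False
    have "- (m * z $ 1) - m * z $ 2 \<le> p \<bullet> z"
      using z mult_right_mono[of "- p $ 1" m "z $ 1"] mult_right_mono[of "- p $ 2" m "z $ 2"]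
      by (simp add: inner_vec_def sum_2 quadrant_def m_def)
    moreover have "m * (z $ 1 + z $ 2) \<le> m * R" using False p by (intro mult_left_mono) (auto simp: m_def)
    ultimately have "0 \<le> m * R + p \<bullet> z" by (simp add: algebra_simps)
    then have "1 \<le> exp (m * R) * exp (p \<bullet> z)" by (simp flip: exp_add)
    then have "B * 1 \<le> B * (exp (m * R) * exp (p \<bullet> z))" using B0 by (rule mult_left_mono)
    then show ?thesis using B[OF z] e by (simp add: C_def affexp_def mult.assoc)
  qed
  then show ?thesis using B0 by (intro that[of C]) (auto simp: C_def)
qed

text \<open>At the times given by \<open>occupation_small\<close>, the part of the expectation of \<open>f(Z)\<close> coming from paths not yet
absorbed is small, since \<open>f\<close> is dominated by a small constant plus a multiple of \<open>exp (p \<bullet> z)\<close>. The rest is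
\<open>f(0)\<close> times the probability of having been absorbed.\<close>

theorem hitting_probability:
  assumes tb: "taylor_bounded K f g H" and van: "vanishes_at_infinity f"
    and harm: "\<And>z. z \<in> quadrant \<Longrightarrow> generator \<Sigma> \<mu> g H z = 0"
    and bd: "\<And>z j. z \<in> quadrant \<Longrightarrow> z $ j = 0 \<Longrightarrow> g z \<bullet> refl_dir r1 r2 j = 0"
    and dr: "draining_exponent \<Sigma> \<mu> r1 r2 p"
  shows "f z0 = f 0 * prob {\<omega> \<in> space M. vertex_time z0 Z \<omega> < \<infinity>}"
proof -
  have p: "p $ 1 < 0" "p $ 2 < 0" using dr by (auto simp: draining_exponent_def)
  let ?A = "\<lambda>s. {\<omega> \<in> space M. Z s \<omega> = 0}"
  have meas: "?A s \<in> events" if "0 \<le> s" for s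
    using Z_borel[OF that] by measurable
  let ?P = "prob {\<omega> \<in> space M. vertex_time z0 Z \<omega> < \<infinity>}"
  have hit: "{\<omega> \<in> space M. vertex_time z0 Z \<omega> < \<infinity>} = (\<Union>n. ?A (real n))"
    using hit_iff by auto
  have hit_meas: "{\<omega> \<in> space M. vertex_time z0 Z \<omega> < \<infinity>} \<in> events"
    unfolding hit using meas by auto
  have lim: "(\<lambda>n. prob (?A (real n))) \<longlonglongrightarrow> ?P"
    unfolding hit
  proof (rule finite_Lim_measure_incseq)
    show "range (\<lambda>n. ?A (real n)) \<subseteq> events" using meas by auto
    show "incseq (\<lambda>n. ?A (real n))"
    proof (rule incseq_SucI, rule subsetI)
      fix n \<omega> assume "\<omega> \<in> ?A (real n)"
      then show "\<omega> \<in> ?A (real (Suc n))" using Z_absorbed[of \<omega> "real n" "real (Suc n)"] by simp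
    qed
  qed
  obtain c where c: "0 < c"
    "\<And>n::nat. 0 < n \<Longrightarrow> \<exists>s\<ge>real n. expectation (\<lambda>\<omega>. of_bool (Z s \<omega> \<noteq> 0) * affexp 1 0 p (Z s \<omega>)) \<le> c / real n"
    by (rule occupation_small[OF dr]) blast
  obtain Kp where Kp: "taylor_bounded Kp (affexp 1 0 p) (affexp_grad 1 0 p) (affexp_hess 1 0 p)"
    using taylor_bounded_affexp[OF p] by metis
  have bound: "\<bar>f z0 - f 0 * prob (?A s)\<bar> \<le> e + C * expectation (\<lambda>\<omega>. of_bool (Z s \<omega> \<noteq> 0) * affexp 1 0 p (Z s \<omega>))"
    if s: "0 \<le> s" and e: "0 < e" and C: "\<And>z. z \<in> quadrant \<Longrightarrow> \<bar>f z\<bar> \<le> e + C * affexp 1 0 p z" for s e C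
  proof -
    have fi: "integrable M (\<lambda>\<omega>. of_bool (Z s \<omega> \<noteq> 0) * f (Z s \<omega>))"
      by (rule integrable_of_Z[OF s taylor_boundedD(2,5)[OF tb] nonzero_measurable[OF s]]) auto
    have xi: "integrable M (\<lambda>\<omega>. of_bool (Z s \<omega> \<noteq> 0) * affexp 1 0 p (Z s \<omega>))"
      by (rule integrable_of_Z[OF s taylor_boundedD(2,5)[OF Kp] nonzero_measurable[OF s]]) auto
    have Ii: "integrable M (indicator (?A s) :: _ \<Rightarrow> real)"
    proof (rule integrable_const_bound[where B = 1])
      show "indicator (?A s) \<in> borel_measurable M" by (rule borel_measurable_indicator[OF meas[OF s]])
      show "AE \<omega> in M. norm (indicator (?A s) \<omega> :: real) \<le> 1" by (rule AE_I2) (simp add: indicator_def)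
    qed
    have "f z0 = expectation (\<lambda>\<omega>. f (Z s \<omega>))" by (rule harmonic_mean[OF tb harm bd s, symmetric])
    also have "\<dots> = expectation (\<lambda>\<omega>. f 0 * indicator (?A s) \<omega> + of_bool (Z s \<omega> \<noteq> 0) * f (Z s \<omega>))"
      by (intro Bochner_Integration.integral_cong) (auto simp: indicator_def)
    also have "\<dots> = f 0 * prob (?A s) + expectation (\<lambda>\<omega>. of_bool (Z s \<omega> \<noteq> 0) * f (Z s \<omega>))"
      using fi Ii meas[OF s] by simp
    finally have "\<bar>f z0 - f 0 * prob (?A s)\<bar> = \<bar>expectation (\<lambda>\<omega>. of_bool (Z s \<omega> \<noteq> 0) * f (Z s \<omega>))\<bar>" by simp
    also have "\<dots> \<le> expectation (\<lambda>\<omega>. \<bar>of_bool (Z s \<omega> \<noteq> 0) * f (Z s \<omega>)\<bar>)" by (rule integral_abs_bound)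
    also have "\<dots> \<le> expectation (\<lambda>\<omega>. e + C * (of_bool (Z s \<omega> \<noteq> 0) * affexp 1 0 p (Z s \<omega>)))"
    proof (intro integral_mono integrable_abs fi Bochner_Integration.integrable_add integrable_mult_right xi)
      fix \<omega> assume "\<omega> \<in> space M"
      then show "\<bar>of_bool (Z s \<omega> \<noteq> 0) * f (Z s \<omega>)\<bar> \<le> e + C * (of_bool (Z s \<omega> \<noteq> 0) * affexp 1 0 p (Z s \<omega>))"
        using C[OF Z_quadrant[OF _ s]] e by (auto simp: of_bool_def)
    qed auto
    also have "\<dots> = e + C * expectation (\<lambda>\<omega>. of_bool (Z s \<omega> \<noteq> 0) * affexp 1 0 p (Z s \<omega>))"
      using xi by (simp add: prob_space)
    finally show ?thesis .
  qed
  have "\<bar>f z0 - f 0 * ?P\<bar> \<le> 0"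
  proof (rule field_le_epsilon)
    fix e :: real assume e: "0 < e"
    obtain C where C: "0 \<le> C" "\<And>z. z \<in> quadrant \<Longrightarrow> \<bar>f z\<bar> \<le> e + C * affexp 1 0 p z"
      using vanishing_dominated[OF p van taylor_boundedD(5)[OF tb] e] by metis
    have "\<bar>f z0 - f 0 * ?P\<bar> \<le> e + C * (c / real n) + \<bar>f 0\<bar> * (?P - prob (?A (real n)))" if n: "0 < n" for n :: nat
    proof -
      obtain s where s: "real n \<le> s" "expectation (\<lambda>\<omega>. of_bool (Z s \<omega> \<noteq> 0) * affexp 1 0 p (Z s \<omega>)) \<le> c / real n"
        using c(2)[OF n] by auto
      have s0: "0 \<le> s" using s(1) by (meson of_nat_0_le_iff order_trans)
      have "\<bar>f z0 - f 0 * prob (?A s)\<bar> \<le> e + C * (c / real n)"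
        using bound[OF s0 e C(2)] mult_left_mono[OF s(2) C(1)] by linarith
      moreover have lo: "prob (?A (real n)) \<le> prob (?A s)"
      proof (rule finite_measure_mono[OF _ meas[OF s0]], rule subsetI)
        fix \<omega> assume "\<omega> \<in> ?A (real n)"
        then show "\<omega> \<in> ?A s" using Z_absorbed[of \<omega> "real n" s] s(1) by simp
      qed
      have hi: "prob (?A s) \<le> ?P"
      proof (rule finite_measure_mono[OF _ hit_meas], rule subsetI)
        fix \<omega> assume "\<omega> \<in> ?A s"
        then show "\<omega> \<in> {\<omega> \<in> space M. vertex_time z0 Z \<omega> < \<infinity>}"
          using vertex_time_le[OF _ s0, of \<omega>] by (auto intro: le_less_trans)
      qed
      have "\<bar>f 0 * prob (?A s) - f 0 * ?P\<bar> = \<bar>f 0\<bar> * (?P - prob (?A s))"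
      proof -
        have "\<bar>f 0 * a - f 0 * b\<bar> = \<bar>f 0\<bar> * (b - a)" if "a \<le> b" for a b
          unfolding right_diff_distrib[symmetric] abs_mult using that by simp
        then show ?thesis using hi .
      qed
      moreover have "\<bar>f 0\<bar> * (?P - prob (?A s)) \<le> \<bar>f 0\<bar> * (?P - prob (?A (real n)))"
        using lo by (intro mult_left_mono) auto
      ultimately show ?thesis by linarith
    qed
    then have "\<forall>\<^sub>F n in sequentially. \<bar>f z0 - f 0 * ?P\<bar> \<le> e + C * (c / real n) + \<bar>f 0\<bar> * (?P - prob (?A (real n)))"
      by (rule eventually_mono[OF eventually_gt_at_top[of 0]])
    moreover have "(\<lambda>n. e + C * (c / real n) + \<bar>f 0\<bar> * (?P - prob (?A (real n)))) \<longlonglongrightarrow> e + C * 0 + \<bar>f 0\<bar> * (?P - ?P)"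
      by (intro tendsto_intros lim lim_const_over_n)
    ultimately show "\<bar>f z0 - f 0 * ?P\<bar> \<le> 0 + e" by (auto dest: tendsto_lowerbound)
  qed
  then show ?thesis by simp
qed

end

section \<open>Linear independence of affine functions times exponentials\<close>

lemma affine_exp_tendsto_0:
  fixes \<kappa> :: real assumes "\<kappa> < 0"
  shows "((\<lambda>s. (c + d * s) * exp (\<kappa> * s)) \<longlongrightarrow> 0) at_top"
proof -
  have top: "filterlim (\<lambda>s. - \<kappa> * s) at_top at_top"
    using assms by (intro filterlim_tendsto_pos_mult_at_top[OF tendsto_const _ filterlim_ident]) auto
  have "((\<lambda>s. c * ((- \<kappa> * s) ^ 0 / exp (- \<kappa> * s)) + - d / \<kappa> * ((- \<kappa> * s) ^ 1 / exp (- \<kappa> * s))) \<longlongrightarrow> c * 0 + - d / \<kappa> * 0) at_top"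
    by (intro tendsto_intros filterlim_compose[OF tendsto_power_div_exp_0 top])
  moreover have "c * ((- \<kappa> * s) ^ 0 / exp (- \<kappa> * s)) + - d / \<kappa> * ((- \<kappa> * s) ^ 1 / exp (- \<kappa> * s)) = (c + d * s) * exp (\<kappa> * s)" for s
    using assms by (simp add: exp_minus field_simps)
  ultimately show ?thesis by simp
qed

text \<open>After division by the exponential with the largest rate, all other terms decay, so the leading affine factor tends to zero.\<close>

lemma affine_exp_independent:
  fixes \<kappa> c d :: "'i \<Rightarrow> real"
  assumes "finite I"
  shows "inj_on \<kappa> I \<Longrightarrow> (\<And>s. 0 \<le> s \<Longrightarrow> (\<Sum>i\<in>I. (c i + d i * s) * exp (\<kappa> i * s)) = 0) \<Longrightarrow> \<forall>i\<in>I. c i = 0 \<and> d i = 0"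
  using assms
proof (induction I rule: finite_psubset_induct)
  case (psubset I)
  show ?case
  proof (cases "I = {}")
    case False
    then have "Max (\<kappa> ` I) \<in> \<kappa> ` I" using Max_in[of "\<kappa> ` I"] psubset.hyps by simp
    then obtain k where k: "k \<in> I" "\<kappa> k = Max (\<kappa> ` I)" by (elim imageE) simp
    have less: "\<kappa> i - \<kappa> k < 0" if "i \<in> I - {k}" for i
      using that k psubset.prems(1) Max_ge[of "\<kappa> ` I" "\<kappa> i"] psubset.hyps unfolding inj_on_def by fastforce
    have split: "(\<Sum>i\<in>I. (c i + d i * s) * exp (\<kappa> i * s)) =
        (c k + d k * s) * exp (\<kappa> k * s) + (\<Sum>i\<in>I - {k}. (c i + d i * s) * exp (\<kappa> i * s))" for s
      using k(1) psubset.hyps by (simp add: sum.remove)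
    have lead: "c k + d k * s = - (\<Sum>i\<in>I - {k}. (c i + d i * s) * exp ((\<kappa> i - \<kappa> k) * s))" if "0 \<le> s" for s
    proof -
      have "(c k + d k * s) * exp (\<kappa> k * s) = - (\<Sum>i\<in>I - {k}. (c i + d i * s) * exp (\<kappa> i * s))"
        using split[of s] psubset.prems(2)[OF that] by linarith
      then have "(c k + d k * s) * exp (\<kappa> k * s) * exp (- \<kappa> k * s) =
          - (\<Sum>i\<in>I - {k}. (c i + d i * s) * exp (\<kappa> i * s)) * exp (- \<kappa> k * s)" by simp
      then show ?thesis
        by (simp add: sum_distrib_right mult.assoc left_diff_distrib flip: exp_add)
    qed
    have "((\<lambda>s. - (\<Sum>i\<in>I - {k}. (c i + d i * s) * exp ((\<kappa> i - \<kappa> k) * s))) \<longlongrightarrow> - (\<Sum>i\<in>I - {k}. 0)) at_top"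
      by (intro tendsto_minus tendsto_sum affine_exp_tendsto_0 less)
    then have "((\<lambda>s. - (\<Sum>i\<in>I - {k}. (c i + d i * s) * exp ((\<kappa> i - \<kappa> k) * s))) \<longlongrightarrow> 0) at_top" by simp
    then have lim: "((\<lambda>s. c k + d k * s) \<longlongrightarrow> 0) at_top"
      by (rule Lim_transform_eventually) (use lead in \<open>auto simp: eventually_at_top_linorder intro!: exI[of _ 0]\<close>)
    have shift: "filterlim (\<lambda>s. s - 1) at_top (at_top :: real filter)"
      unfolding filterlim_at_top eventually_at_top_linorder
    proof
      fix x :: real show "\<exists>y. \<forall>s\<ge>y. x \<le> s - 1" by (rule exI[of _ "x + 1"]) auto
    qed
    have "((\<lambda>s. (c k + d k * s) - (c k + d k * (s - 1))) \<longlongrightarrow> 0 - 0) at_top"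
      by (intro tendsto_diff lim filterlim_compose[OF lim shift])
    then have "((\<lambda>s. d k) \<longlongrightarrow> 0) (at_top :: real filter)" by (simp add: algebra_simps)
    then have dk: "d k = 0" by (simp add: tendsto_const_iff)
    with lim have ck: "c k = 0" by (simp add: tendsto_const_iff)
    have "\<forall>i\<in>I - {k}. c i = 0 \<and> d i = 0"
    proof (rule psubset.IH)
      show "I - {k} \<subset> I" using k by auto
      show "inj_on \<kappa> (I - {k})" using psubset.prems(1) by (rule inj_on_subset) auto
      show "(\<Sum>i\<in>I - {k}. (c i + d i * s) * exp (\<kappa> i * s)) = 0" if "0 \<le> s" for s
        using split[of s] psubset.prems(2)[OF that] ck dk by simp
    qed
    then show ?thesis using ck dk by auto
  qed auto
qed

lemma finite_orthogonal_slopes: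
  fixes v :: "real^2" assumes "v \<noteq> 0" shows "finite {t. v \<bullet> vector [1, t] = 0}"
proof (cases "v $ 2 = 0")
  case True
  then have "v $ 1 \<noteq> 0" using assms by (auto simp: vec_eq_iff forall_2)
  then have "{t. v \<bullet> vector [1, t] = 0} = {}" using True by (simp add: inner_vec_def sum_2)
  then show ?thesis by simp
next
  case False
  have "{t. v \<bullet> vector [1, t] = 0} \<subseteq> {- v $ 1 / v $ 2}"
    using False by (auto simp: inner_vec_def sum_2 field_simps)
  then show ?thesis by (rule finite_subset) simp
qed

text \<open>Restriction to a ray reduces the claim to one variable. The ray must separate the exponents and must not be orthogonal to
\<open>d i\<close>; this excludes finitely many slopes.\<close>

lemma affexp_independent:
  fixes p d :: "'i \<Rightarrow> real^2"
  assumes I: "finite I" and inj: "inj_on p I"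
    and zero: "\<And>z. z \<in> quadrant \<Longrightarrow> (\<Sum>i\<in>I. affexp (c i) (d i) (p i) z) = 0" and i: "i \<in> I"
  shows "d i = 0"
proof (rule ccontr)
  assume di: "d i \<noteq> 0"
  define Bad where "Bad = {t. d i \<bullet> vector [1, t] = 0} \<union> (\<Union>(j, k)\<in>I \<times> I - Id. {t. (p j - p k) \<bullet> vector [1, t] = 0})"
  have "finite Bad"
    unfolding Bad_def
  proof (intro finite_UnI finite_orthogonal_slopes di finite_UN_I)
    show "finite (I \<times> I - Id)" using I by simp
    fix jk assume "jk \<in> I \<times> I - Id"
    then have "p (fst jk) - p (snd jk) \<noteq> 0" using inj by (auto simp: inj_on_def)
    from finite_orthogonal_slopes[OF this] show "finite (case jk of (j, k) \<Rightarrow> {t. (p j - p k) \<bullet> vector [1, t] = 0})"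
      by (simp add: case_prod_beta)
  qed
  moreover have "infinite {0<..<1::real}" by simp
  ultimately obtain t where t: "0 < t" "t \<notin> Bad" by (metis finite_subset greaterThanLessThan_iff subsetI)
  define z :: "real^2" where "z = vector [1, t]"
  have z: "z $ 1 = 1" "z $ 2 = t" by (simp_all add: z_def)
  have "\<forall>j\<in>I. c j = 0 \<and> d j \<bullet> z = 0"
  proof (rule affine_exp_independent[OF I, where \<kappa> = "\<lambda>j. p j \<bullet> z"])
    show "inj_on (\<lambda>j. p j \<bullet> z) I"
      using t(2) unfolding Bad_def inj_on_def z_def by (auto simp: inner_diff_left)
    fix s :: real assume "0 \<le> s"
    then have "s *\<^sub>R z \<in> quadrant" using t z by (simp add: quadrant_def)
    from zero[OF this] show "(\<Sum>j\<in>I. (c j + d j \<bullet> z * s) * exp (p j \<bullet> z * s)) = 0"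
      by (simp add: affexp_def mult.commute)
  qed
  then show False using i t(2) by (auto simp: Bad_def z_def)
qed

section \<open>The ellipse of harmonic exponents\<close>

lemma has_tangent_cross:
  assumes "has_tangent \<phi> p q" "p \<noteq> 0" shows "q * sin \<phi> = p * cos \<phi>"
proof (cases "q = 0")
  case False
  then have t: "sin \<phi> / cos \<phi> = p / q" using assms by (simp add: has_tangent_def tan_def)
  then have "cos \<phi> \<noteq> 0" using False assms(2) by auto
  then show ?thesis using t False by (simp add: field_simps)
next
  case True
  then have "\<phi> = pi / 2" using assms by (simp add: has_tangent_def)
  then show ?thesis unfolding True by (simp only: cos_pi_half)
qed

lemma has_tangent_sin_cos:
  assumes t: "has_tangent \<phi> p q" and p: "0 < p" and \<phi>: "0 < \<phi>" "\<phi> < pi" and r: "0 < r" "r\<^sup>2 = p\<^sup>2 + q\<^sup>2"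
  shows "sin \<phi> = p / r" "cos \<phi> = q / r"
proof -
  have c: "q * sin \<phi> = p * cos \<phi>" using has_tangent_cross[OF t] p by simp
  have s: "0 < sin \<phi>" using \<phi> by (rule sin_gt_zero)
  have "(r * sin \<phi>)\<^sup>2 = p\<^sup>2 * (sin \<phi>)\<^sup>2 + (q * sin \<phi>)\<^sup>2" by (simp add: power_mult_distrib r(2) algebra_simps)
  also have "\<dots> = p\<^sup>2 * ((sin \<phi>)\<^sup>2 + (cos \<phi>)\<^sup>2)" unfolding c by (simp only: power_mult_distrib distrib_left)
  finally have "(r * sin \<phi>)\<^sup>2 = p\<^sup>2" by simp
  then have "r * sin \<phi> = p" by (rule power2_eq_imp_eq) (use r s p in auto)
  then show "sin \<phi> = p / r" using r by (simp add: field_simps)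
  have "p * (r * cos \<phi>) = p * q" using c \<open>r * sin \<phi> = p\<close> by algebra
  then show "cos \<phi> = q / r" using p r by (simp add: field_simps)
qed

text \<open>The square roots \<open>sa, sb, sm, se\<close> below are the natural lengths of the problem: in terms of them the angles
have rational sines and cosines, and the branch points of the uniformization become \<open>xr\<close> and \<open>yr\<close>
times trigonometric expressions.\<close>

locale wedge =
  fixes \<Sigma> :: "real^2^2" and \<mu> :: "real^2" and r1 r2 \<beta> \<theta> \<delta> \<epsilon> :: real
  assumes symmetric: "transpose \<Sigma> = \<Sigma>"
    and positive_definite: "\<And>c. c \<noteq> 0 \<Longrightarrow> 0 < c \<bullet> (\<Sigma> *v c)"
    and drift: "0 < \<mu>$1" "0 < \<mu>$2"
    and beta: "\<beta> \<in> {0<..<pi}" "cos \<beta> = - \<Sigma>$1$2 / sqrt (\<Sigma>$1$1 * \<Sigma>$2$2)"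
    and theta: "\<theta> \<in> {0<..<\<beta>}"
      "has_tangent \<theta> (\<mu>$2 * sqrt (det \<Sigma>)) (\<Sigma>$2$2 * \<mu>$1 - \<Sigma>$1$2 * \<mu>$2)"
    and delta: "\<delta> \<in> {0<..<pi}" "has_tangent \<delta> (- sqrt (det \<Sigma>)) (r2 * \<Sigma>$2$2 + \<Sigma>$1$2)"
    and epsilon: "\<epsilon> \<in> {0<..<pi}" "has_tangent \<epsilon> (- sqrt (det \<Sigma>)) (\<Sigma>$1$1 * r1 + \<Sigma>$1$2)"
begin

definition sa where "sa = sqrt (\<Sigma>$1$1)"
definition sb where "sb = sqrt (\<Sigma>$2$2)"
definition sc where "sc = \<Sigma>$1$2"
definition sm where "sm = sqrt (det \<Sigma>)"
definition se where "se = sqrt (sb\<^sup>2 * (\<mu>$1)\<^sup>2 - 2 * sc * \<mu>$1 * \<mu>$2 + sa\<^sup>2 * (\<mu>$2)\<^sup>2)"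

lemma entries: "\<Sigma>$1$1 = sa\<^sup>2" "\<Sigma>$2$2 = sb\<^sup>2" "\<Sigma>$1$2 = sc" "\<Sigma>$2$1 = sc" "sqrt (det \<Sigma>) = sm" "det \<Sigma> = sm\<^sup>2"
  and roots_pos: "0 < sa" "0 < sb" "0 < sm" and sm_sq: "sm\<^sup>2 = sa\<^sup>2 * sb\<^sup>2 - sc\<^sup>2"
proof -
  note d = pos_def_minors[OF symmetric positive_definite]
  have det: "det \<Sigma> = \<Sigma>$1$1 * \<Sigma>$2$2 - (\<Sigma>$1$2)\<^sup>2" by (simp add: det_2 d(1) power2_eq_square)
  show 1: "\<Sigma>$1$1 = sa\<^sup>2" "\<Sigma>$2$2 = sb\<^sup>2" "\<Sigma>$1$2 = sc" "\<Sigma>$2$1 = sc" "sqrt (det \<Sigma>) = sm" "det \<Sigma> = sm\<^sup>2"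
    using d det by (simp_all add: sa_def sb_def sc_def sm_def)
  show "0 < sa" "0 < sb" "0 < sm" using d det by (simp_all add: sa_def sb_def sm_def)
  show "sm\<^sup>2 = sa\<^sup>2 * sb\<^sup>2 - sc\<^sup>2" using det unfolding 1 .
qed

lemma se_pos: "0 < se" and se_sq: "se\<^sup>2 = sb\<^sup>2 * (\<mu>$1)\<^sup>2 - 2 * sc * \<mu>$1 * \<mu>$2 + sa\<^sup>2 * (\<mu>$2)\<^sup>2"
proof -
  define v :: "real^2" where "v = vector [\<mu>$2, - \<mu>$1]"
  have v: "v$1 = \<mu>$2" "v$2 = - \<mu>$1" by (simp_all add: v_def)
  have "v \<noteq> 0"
  proof
    assume "v = 0"
    then have "v$1 = 0" by simp
    then show False using v(1) drift by simp
  qed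
  then have "0 < v \<bullet> (\<Sigma> *v v)" by (rule positive_definite)
  also have "v \<bullet> (\<Sigma> *v v) = sb\<^sup>2 * (\<mu>$1)\<^sup>2 - 2 * sc * \<mu>$1 * \<mu>$2 + sa\<^sup>2 * (\<mu>$2)\<^sup>2"
    by (simp add: inner_vec_def matrix_vector_mult_def sum_2 v entries) (simp add: power2_eq_square algebra_simps)
  finally show "0 < se" "se\<^sup>2 = sb\<^sup>2 * (\<mu>$1)\<^sup>2 - 2 * sc * \<mu>$1 * \<mu>$2 + sa\<^sup>2 * (\<mu>$2)\<^sup>2" by (simp_all add: se_def)
qed

lemma beta_cos: "cos \<beta> = - sc / (sa * sb)" and beta_sin: "sin \<beta> = sm / (sa * sb)"
proof -
  have "sqrt (sa\<^sup>2 * sb\<^sup>2) = sa * sb" using roots_pos by (simp add: real_sqrt_mult)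
  then show c: "cos \<beta> = - sc / (sa * sb)" using beta(2) by (simp add: entries)
  have "(sin \<beta>)\<^sup>2 = 1 - (cos \<beta>)\<^sup>2" by (simp add: sin_squared_eq)
  also have "\<dots> = (sm / (sa * sb))\<^sup>2" unfolding c using roots_pos by (simp add: power_divide sm_sq field_simps)
  finally show "sin \<beta> = sm / (sa * sb)"
    by (rule power2_eq_imp_eq) (use beta roots_pos in \<open>auto simp: sin_ge_zero\<close>)
qed

lemma theta_range: "0 < \<theta>" "\<theta> < \<beta>" "\<beta> < pi" using theta beta by auto

lemma theta_sin: "sin \<theta> = \<mu>$2 * sm / (sb * se)" and theta_cos: "cos \<theta> = (sb\<^sup>2 * \<mu>$1 - sc * \<mu>$2) / (sb * se)"
proof -
  have "(sb * se)\<^sup>2 = (\<mu>$2 * sm)\<^sup>2 + (sb\<^sup>2 * \<mu>$1 - sc * \<mu>$2)\<^sup>2"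
    unfolding power_mult_distrib se_sq sm_sq by (simp add: power2_eq_square algebra_simps)
  then show "sin \<theta> = \<mu>$2 * sm / (sb * se)" "cos \<theta> = (sb\<^sup>2 * \<mu>$1 - sc * \<mu>$2) / (sb * se)"
    using has_tangent_sin_cos[OF theta(2), of "sb * se"] roots_pos se_pos drift theta_range
    by (auto simp: entries)
qed

definition xr where "xr = sb * se / sm\<^sup>2"
definition yr where "yr = sa * se / sm\<^sup>2"

lemma radii_pos: "0 < xr" "0 < yr" using roots_pos se_pos by (simp_all add: xr_def yr_def)

text \<open>The uniformization on the unit circle, \<open>s = cis w\<close>. The angle \<open>\<theta>\<close> corresponds to the exponent \<open>0\<close>, which
explains the constants subtracted in both coordinates.\<close>

definition point :: "real \<Rightarrow> real^2" where
  "point w = vector [xr * (cos w - cos \<theta>), yr * (cos (w - \<beta>) - cos (\<theta> - \<beta>))]"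

definition tangent :: "real \<Rightarrow> real^2" where
  "tangent w = vector [- xr * sin w, - yr * sin (w - \<beta>)]"

lemma point_simps: "point w $ 1 = xr * (cos w - cos \<theta>)" "point w $ 2 = yr * (cos (w - \<beta>) - cos (\<theta> - \<beta>))"
  and tangent_simps: "tangent w $ 1 = - xr * sin w" "tangent w $ 2 = - yr * sin (w - \<beta>)"
  by (simp_all add: point_def tangent_def)

lemma unif_point: "x_unif \<Sigma> \<mu> (cis w) = of_real (point w $ 1)" "y_unif \<Sigma> \<mu> \<beta> (cis w) = of_real (point w $ 2)"
proof -
  have cosform: "cis \<phi> + 1 / cis \<phi> = of_real (2 * cos \<phi>)" for \<phi>
    by (simp add: complex_eq_iff flip: inverse_eq_divide)
  have 1: "sqrt ((\<mu>$2 * sc - \<mu>$1 * sb\<^sup>2)\<^sup>2 + sm\<^sup>2 * (\<mu>$2)\<^sup>2) = sb * se"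
  proof (rule real_sqrt_unique)
    show "(sb * se)\<^sup>2 = (\<mu>$2 * sc - \<mu>$1 * sb\<^sup>2)\<^sup>2 + sm\<^sup>2 * (\<mu>$2)\<^sup>2"
      unfolding power_mult_distrib se_sq sm_sq by (simp add: power2_eq_square algebra_simps)
  qed (use roots_pos se_pos in simp)
  have 2: "sqrt ((\<mu>$1 * sc - \<mu>$2 * sa\<^sup>2)\<^sup>2 + sm\<^sup>2 * (\<mu>$1)\<^sup>2) = sa * se"
  proof (rule real_sqrt_unique)
    show "(sa * se)\<^sup>2 = (\<mu>$1 * sc - \<mu>$2 * sa\<^sup>2)\<^sup>2 + sm\<^sup>2 * (\<mu>$1)\<^sup>2"
      unfolding power_mult_distrib se_sq sm_sq by (simp add: power2_eq_square algebra_simps)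
  qed (use roots_pos se_pos in simp)
  have x1: "(x_branch \<Sigma> \<mu> 1 - x_branch \<Sigma> \<mu> (- 1)) / 4 = xr / 2"
    and x2: "(x_branch \<Sigma> \<mu> 1 + x_branch \<Sigma> \<mu> (- 1)) / 2 = - xr * cos \<theta>"
    using roots_pos se_pos unfolding x_branch_def entries 1 xr_def theta_cos by (simp_all add: field_simps)
  have shifted: "cos (\<theta> - \<beta>) = (sa\<^sup>2 * \<mu>$2 - sc * \<mu>$1) / (sa * se)"
    unfolding cos_diff theta_cos theta_sin beta_cos beta_sin
    using roots_pos se_pos sm_sq by (simp add: field_simps) algebra
  have y1: "(y_branch \<Sigma> \<mu> 1 - y_branch \<Sigma> \<mu> (- 1)) / 4 = yr / 2"
    and y2: "(y_branch \<Sigma> \<mu> 1 + y_branch \<Sigma> \<mu> (- 1)) / 2 = - yr * cos (\<theta> - \<beta>)"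
    using roots_pos se_pos unfolding y_branch_def entries 2 yr_def shifted by (simp_all add: field_simps)
  show "x_unif \<Sigma> \<mu> (cis w) = of_real (point w $ 1)"
    unfolding x_unif_def x1 x2 cosform by (simp add: point_simps algebra_simps)
  have "cis w / cis \<beta> + cis \<beta> / cis w = of_real (2 * cos (w - \<beta>))"
    using cosform[of "w - \<beta>"] by (simp add: cis_divide[symmetric])
  then show "y_unif \<Sigma> \<mu> \<beta> (cis w) = of_real (point w $ 2)"
    unfolding y_unif_def y1 y2 by (simp add: point_simps algebra_simps)
qed

lemma point_coords:
  fixes w defines "U \<equiv> cos w - cos \<theta>" and "S \<equiv> sin w - sin \<theta>"
  shows "point w $ 1 = se / sm\<^sup>2 * (sb * U)" "point w $ 2 = se / sm\<^sup>2 * ((sm * S - sc * U) / sb)"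
proof -
  show "point w $ 1 = se / sm\<^sup>2 * (sb * U)" by (simp add: point_simps xr_def U_def)
  have eq: "cos (w - \<beta>) - cos (\<theta> - \<beta>) = cos \<beta> * U + sin \<beta> * S"
    by (simp add: cos_diff U_def S_def algebra_simps)
  then show "point w $ 2 = se / sm\<^sup>2 * ((sm * S - sc * U) / sb)"
    unfolding point_simps(2) eq yr_def beta_cos beta_sin using roots_pos by (simp add: field_simps)
qed

text \<open>In the coordinates \<open>U = cos w - cos \<theta>\<close> and \<open>S = sin w - sin \<theta>\<close> the expression is a multiple of
\<open>(U\<^sup>2 + S\<^sup>2) / 2 + cos \<theta> U + sin \<theta> S\<close>, the equation of the unit circle seen from its point \<open>\<theta>\<close>.\<close>

lemma kernel_point: "point w \<bullet> (\<Sigma> *v point w) / 2 + point w \<bullet> \<mu> = 0"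
proof -
  define U where "U = cos w - cos \<theta>"
  define S where "S = sin w - sin \<theta>"
  have p: "point w $ 1 = se / sm\<^sup>2 * (sb * U)" "point w $ 2 = se / sm\<^sup>2 * ((sm * S - sc * U) / sb)"
    using point_coords[of w] by (simp_all add: U_def S_def)
  have "point w \<bullet> (\<Sigma> *v point w) = sa\<^sup>2 * (point w $ 1)\<^sup>2 + 2 * sc * (point w $ 1) * (point w $ 2) + sb\<^sup>2 * (point w $ 2)\<^sup>2"
    by (simp add: inner_vec_def matrix_vector_mult_def sum_2 entries) (simp add: power2_eq_square algebra_simps)
  also have "\<dots> = (se / sm\<^sup>2)\<^sup>2 * (sa\<^sup>2 * (sb * U)\<^sup>2 + 2 * sc * (sb * U) * ((sm * S - sc * U) / sb) + sb\<^sup>2 * ((sm * S - sc * U) / sb)\<^sup>2)"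
  proof -
    have "sa\<^sup>2 * (k * A)\<^sup>2 + 2 * sc * (k * A) * (k * B) + sb\<^sup>2 * (k * B)\<^sup>2 = k\<^sup>2 * (sa\<^sup>2 * A\<^sup>2 + 2 * sc * A * B + sb\<^sup>2 * B\<^sup>2)" for k A B
      by (simp add: power2_eq_square algebra_simps)
    then show ?thesis unfolding p .
  qed
  also have "sa\<^sup>2 * (sb * U)\<^sup>2 + 2 * sc * (sb * U) * ((sm * S - sc * U) / sb) + sb\<^sup>2 * ((sm * S - sc * U) / sb)\<^sup>2
      = (sa\<^sup>2 * sb\<^sup>2 - sc\<^sup>2) * U\<^sup>2 + sm\<^sup>2 * S\<^sup>2"
    using roots_pos by (simp add: power_divide power_mult_distrib) (simp add: power2_eq_square algebra_simps)
  also have "\<dots> = sm\<^sup>2 * (U\<^sup>2 + S\<^sup>2)" by (simp add: sm_sq[symmetric] distrib_left)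
  also have "(se / sm\<^sup>2)\<^sup>2 * (sm\<^sup>2 * (U\<^sup>2 + S\<^sup>2)) = se\<^sup>2 / sm\<^sup>2 * (U\<^sup>2 + S\<^sup>2)"
    using roots_pos by (simp add: power2_eq_square field_simps)
  finally have q: "point w \<bullet> (\<Sigma> *v point w) = se\<^sup>2 / sm\<^sup>2 * (U\<^sup>2 + S\<^sup>2)" .
  have "point w \<bullet> \<mu> = se / sm\<^sup>2 * ((sb\<^sup>2 * \<mu>$1 - sc * \<mu>$2) / sb * U + \<mu>$2 * sm / sb * S)"
  proof -
    have "k * (b * U) * m1 + k * ((n * S - c * U) / b) * m2 = k * ((b\<^sup>2 * m1 - c * m2) / b * U + m2 * n / b * S)"
      if "0 < b" for k b c n m1 m2 :: real
      using that by (simp add: field_simps power2_eq_square)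
    from this[OF roots_pos(2)] show ?thesis by (simp only: inner_vec_def sum_2 p inner_real_def)
  qed
  also have "(sb\<^sup>2 * \<mu>$1 - sc * \<mu>$2) / sb = se * cos \<theta>" using se_pos roots_pos by (simp add: theta_cos)
  also have "\<mu>$2 * sm / sb = se * sin \<theta>" using se_pos roots_pos by (simp add: theta_sin)
  finally have l: "point w \<bullet> \<mu> = se\<^sup>2 / sm\<^sup>2 * (cos \<theta> * U + sin \<theta> * S)"
    by (simp add: power2_eq_square algebra_simps add_divide_distrib)
  have "(U\<^sup>2 + S\<^sup>2) / 2 + (cos \<theta> * U + sin \<theta> * S) = ((cos w)\<^sup>2 + (sin w)\<^sup>2) / 2 - ((cos \<theta>)\<^sup>2 + (sin \<theta>)\<^sup>2) / 2"
    unfolding U_def S_def by (simp add: power2_eq_square algebra_simps add_divide_distrib diff_divide_distrib)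
  also have "\<dots> = 0" by simp
  finally show ?thesis unfolding q l
    by (metis (no_types, lifting) distrib_left mult_zero_right times_divide_eq_right)
qed

lemma point_deriv: "((\<lambda>w. point w $ j) has_real_derivative tangent w $ j) (at w)"
proof -
  have "((\<lambda>w. point w $ 1) has_real_derivative tangent w $ 1) (at w)" "((\<lambda>w. point w $ 2) has_real_derivative tangent w $ 2) (at w)"
    unfolding point_simps tangent_simps by (auto intro!: derivative_eq_intros)
  then show ?thesis using exhaust_2[of j] by auto
qed

lemma tangent_kernel: "tangent w \<bullet> (\<Sigma> *v point w + \<mu>) = 0"
proof -
  define k where "k w = sa\<^sup>2 * (point w $ 1)\<^sup>2 / 2 + sc * (point w $ 1) * (point w $ 2) + sb\<^sup>2 * (point w $ 2)\<^sup>2 / 2 + \<mu>$1 * point w $ 1 + \<mu>$2 * point w $ 2" for w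
  have "k w = point w \<bullet> (\<Sigma> *v point w) / 2 + point w \<bullet> \<mu>" for w
    unfolding k_def by (simp add: inner_vec_def matrix_vector_mult_def sum_2 entries) (simp add: power2_eq_square field_simps)
  then have "k = (\<lambda>w. 0)" using kernel_point by (intro ext) simp
  moreover have "(k has_real_derivative tangent w \<bullet> (\<Sigma> *v point w + \<mu>)) (at w)"
  proof -
    have "((\<lambda>w. a * (X w)\<^sup>2 / 2 + c * X w * Y w + b * (Y w)\<^sup>2 / 2 + m1 * X w + m2 * Y w) has_real_derivative
        (a * X w * X' + c * (X' * Y w + X w * Y') + b * Y w * Y' + m1 * X' + m2 * Y')) (at w)"
      if "(X has_real_derivative X') (at w)" "(Y has_real_derivative Y') (at w)" for X Y X' Y' a b c m1 m2
      by (auto intro!: derivative_eq_intros that simp: algebra_simps)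
    from this[OF point_deriv[of 1 w] point_deriv[of 2 w]] show ?thesis
      unfolding k_def
      by (rule back_subst) (simp add: inner_vec_def matrix_vector_mult_def sum_2 entries, simp add: power2_eq_square algebra_simps)
  qed
  ultimately show ?thesis using DERIV_unique[of k _ w 0] by simp
qed

end

section \<open>Solutions supported on a chain of exponents\<close>

lemma taylor_bounded_sum:
  assumes "\<And>r. r \<le> N \<Longrightarrow> \<exists>K. taylor_bounded K (f r) (g r) (H r)"
  shows "\<exists>K. taylor_bounded K (\<lambda>z. \<Sum>r\<le>N. f r z) (\<lambda>z. \<Sum>r\<le>N. g r z) (\<lambda>z. \<Sum>r\<le>(N::nat). H r z)"
  using assms
proof (induction N)
  case 0
  then show ?case by simp
next
  case (Suc N)
  then obtain K1 K2 where "taylor_bounded K1 (\<lambda>z. \<Sum>r\<le>N. f r z) (\<lambda>z. \<Sum>r\<le>N. g r z) (\<lambda>z. \<Sum>r\<le>N. H r z)"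
    "taylor_bounded K2 (f (Suc N)) (g (Suc N)) (H (Suc N))" by fastforce
  from taylor_bounded_add[OF this] show ?case by auto
qed

lemma generator_sum:
  "generator \<Sigma> \<mu> (\<lambda>z. \<Sum>r\<le>N. g r z) (\<lambda>z. \<Sum>r\<le>(N::nat). H r z) z = (\<Sum>r\<le>N. generator \<Sigma> \<mu> (g r) (H r) z)"
  by (induction N) (simp_all add: generator_add)

lemma vanishes_sum:
  "(\<And>r. r \<le> N \<Longrightarrow> vanishes_at_infinity (f r)) \<Longrightarrow> vanishes_at_infinity (\<lambda>z. \<Sum>r\<le>(N::nat). f r z)"
  by (induction N) (simp_all add: vanishes_add)

text \<open>The contributions to the boundary condition at axis \<open>j\<close> cancel along the edges of type \<open>j\<close>. The first and the
last node are not matched in this way at the axis where they lack a neighbour, and must vanish there by themselves.\<close>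

lemma alternating_sum:
  fixes U :: "2 \<Rightarrow> nat \<Rightarrow> real" and e :: "nat \<Rightarrow> 2"
  assumes alt: "\<And>r. e (Suc r) \<noteq> e r" and fold: "k \<noteq> e 0" "U k 0 = 0"
    and pair: "\<And>r. r < N \<Longrightarrow> U (e r) r + U (e r) (Suc r) = 0" and last: "U (e N) N = 0"
  shows "(\<Sum>r\<le>N. U j r) = 0"
proof -
  have two: "a \<noteq> b \<Longrightarrow> c \<noteq> b \<Longrightarrow> a = c" for a b c :: 2
    using exhaust_2[of a] exhaust_2[of b] exhaust_2[of c] by auto
  have "n \<le> N \<Longrightarrow> (\<Sum>r\<le>n. U j r) = (if e n = j then U j n else 0)" for n
  proof (induction n)
    case 0
    then show ?case using fold two[of k "e 0" j] by auto
  next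
    case (Suc n)
    then show ?case using pair[of n] alt[of n] two[of "e (Suc n)" "e n" j] by auto
  qed
  from this[of N] show ?thesis using last by auto
qed

lemma chain_coefficients:
  fixes p q p' q' :: "nat \<Rightarrow> real"
  assumes "\<And>r. r < N \<Longrightarrow> q r \<noteq> 0"
  obtains C D where "C 0 = c" "D 0 = d"
    "\<And>r. r < N \<Longrightarrow> D r * p r = D (Suc r) * q r"
    "\<And>r. r < N \<Longrightarrow> C r * p r + D r * p' r + C (Suc r) * q r + D (Suc r) * q' r = 0"
proof -
  define step where "step r cd = (let d = snd cd * p r / q r in (- (fst cd * p r + snd cd * p' r + d * q' r) / q r, d))"
    for r cd
  define CD where "CD = rec_nat (c, d) step"
  have CD: "CD 0 = (c, d)" "CD (Suc r) = step r (CD r)" for r by (simp_all add: CD_def)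
  show ?thesis
  proof (rule that[of "\<lambda>r. fst (CD r)" "\<lambda>r. snd (CD r)"])
    fix r assume "r < N"
    then have q: "q r \<noteq> 0" by (rule assms)
    then show "snd (CD r) * p r = snd (CD (Suc r)) * q r" by (simp add: CD step_def Let_def)
    from q show "fst (CD r) * p r + snd (CD r) * p' r + fst (CD (Suc r)) * q r + snd (CD (Suc r)) * q' r = 0"
      by (simp add: CD step_def Let_def)
  qed (simp_all add: CD)
qed

lemma cos_minus_cos:
  fixes a b :: real
  assumes "(a + b) / 2 = A" "(a - b) / 2 = B"
  shows "cos a - cos b = - 2 * (sin A * sin B)"
proof -
  have "(b - a) / 2 = - B" unfolding assms(2)[symmetric] by (simp add: field_simps)
  then show ?thesis unfolding cos_diff_cos assms(1) by (simp only: sin_minus)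
qed

context wedge begin

text \<open>The angles whose exponents have two negative coordinates: the open arc of the ellipse between its two
intersections with the coordinate axes other than the origin.\<close>

definition arc :: "real set" where "arc = {2 * \<beta> - \<theta><..<2 * pi - \<theta>}"

lemma arc_sines:
  assumes "w \<in> arc"
  shows "0 < sin ((w - \<theta>) / 2)" "0 < sin ((w + \<theta>) / 2)" "0 < sin ((w + \<theta>) / 2 - \<beta>)"
proof -
  have "2 * \<beta> - \<theta> < w" "w < 2 * pi - \<theta>" using assms by (auto simp: arc_def)
  then show "0 < sin ((w - \<theta>) / 2)" "0 < sin ((w + \<theta>) / 2)" "0 < sin ((w + \<theta>) / 2 - \<beta>)"
    using theta_range by (auto intro!: sin_gt_zero simp: field_simps)
qed

lemma point_negative: "w \<in> arc \<Longrightarrow> point w $ j < 0"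
proof -
  assume w: "w \<in> arc"
  have "cos w - cos \<theta> = - 2 * (sin ((w + \<theta>) / 2) * sin ((w - \<theta>) / 2))"
    by (rule cos_minus_cos) simp_all
  moreover have "cos (w - \<beta>) - cos (\<theta> - \<beta>) = - 2 * (sin ((w + \<theta>) / 2 - \<beta>) * sin ((w - \<theta>) / 2))"
    by (rule cos_minus_cos) (simp_all add: field_simps)
  ultimately have "point w $ 1 < 0" "point w $ 2 < 0"
    using arc_sines[OF w] radii_pos by (simp_all add: point_simps mult_less_0_iff zero_less_mult_iff)
  then show "point w $ j < 0" using exhaust_2[of j] by auto
qed

text \<open>The derivative of \<open>exp (p \<bullet> z)\<close> along \<open>R\<^sup>j\<close> is \<open>obliq j w\<close> times this exponential, for \<open>p = point w\<close>.\<close>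

definition obliq :: "2 \<Rightarrow> real \<Rightarrow> real" where "obliq j w = point w \<bullet> refl_dir r1 r2 j"
definition dobliq :: "2 \<Rightarrow> real \<Rightarrow> real" where "dobliq j w = tangent w \<bullet> refl_dir r1 r2 j"

lemma delta_range: "0 < \<delta>" "\<delta> < pi" "0 < sin \<delta>" and epsilon_range: "0 < \<epsilon>" "\<epsilon> < pi" "0 < sin \<epsilon>"
  using delta epsilon by (auto intro: sin_gt_zero)

lemma delta_cross: "(r2 * sb\<^sup>2 + sc) * sin \<delta> = - sm * cos \<delta>"
  and epsilon_cross: "(r1 * sa\<^sup>2 + sc) * sin \<epsilon> = - sm * cos \<epsilon>"
  using has_tangent_cross[OF delta(2)] has_tangent_cross[OF epsilon(2)] roots_pos by (auto simp: entries mult.commute)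

text \<open>The angle \<open>\<delta>\<close> is chosen such that the line of exponents orthogonal to \<open>R\<^sup>2\<close> cuts the ellipse
in the angles \<open>\<theta>\<close> and \<open>2 \<delta> - \<theta>\<close>; likewise \<open>\<epsilon>\<close> for \<open>R\<^sup>1\<close>, with angles measured from \<open>\<beta>\<close>.\<close>

lemma obliq_2: "obliq 2 w * sin \<delta> = se / (sm * sb) * (cos (w - \<delta>) - cos (\<theta> - \<delta>))"
proof -
  define U where "U = cos w - cos \<theta>"
  define S where "S = sin w - sin \<theta>"
  have p: "point w $ 1 = se / sm\<^sup>2 * (sb * U)" "point w $ 2 = se / sm\<^sup>2 * ((sm * S - sc * U) / sb)"
    using point_coords[of w] by (simp_all add: U_def S_def)
  have "obliq 2 w * sin \<delta> = se / (sm\<^sup>2 * sb) * (sm * S * sin \<delta> - U * ((r2 * sb\<^sup>2 + sc) * sin \<delta>))"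
    using roots_pos by (simp add: obliq_def refl_dir_simps inner_vec_def sum_2 p power2_eq_square field_simps)
  also have "\<dots> = se / (sm * sb) * (S * sin \<delta> + U * cos \<delta>)"
    unfolding delta_cross using roots_pos by (simp add: power2_eq_square field_simps)
  also have "S * sin \<delta> + U * cos \<delta> = cos (w - \<delta>) - cos (\<theta> - \<delta>)"
    by (simp add: U_def S_def cos_diff algebra_simps)
  finally show ?thesis .
qed

lemma obliq_1: "obliq 1 w * sin \<epsilon> = se / (sm * sa) * (cos (w - \<beta> + \<epsilon>) - cos (\<theta> - \<beta> + \<epsilon>))"
proof -
  define U where "U = cos (w - \<beta>) - cos (\<theta> - \<beta>)"
  define S where "S = sin (w - \<beta>) - sin (\<theta> - \<beta>)"
  have "cos w - cos \<theta> = cos ((w - \<beta>) + \<beta>) - cos ((\<theta> - \<beta>) + \<beta>)" by simp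
  also have "\<dots> = cos \<beta> * U - sin \<beta> * S" unfolding cos_add U_def S_def by (simp add: algebra_simps)
  finally have eq: "cos w - cos \<theta> = cos \<beta> * U - sin \<beta> * S" .
  have p: "point w $ 1 = - se / (sm\<^sup>2 * sa) * (sc * U + sm * S)" "point w $ 2 = se / sm\<^sup>2 * (sa * U)"
    unfolding point_simps(1) eq xr_def beta_cos beta_sin
    using roots_pos by (simp_all add: point_simps(2) yr_def U_def field_simps)
  have "obliq 1 w * sin \<epsilon> = - se / (sm\<^sup>2 * sa) * (sm * S * sin \<epsilon> + U * ((r1 * sa\<^sup>2 + sc) * sin \<epsilon>))"
    using roots_pos by (simp add: obliq_def refl_dir_simps inner_vec_def sum_2 p power2_eq_square field_simps)
  also have "\<dots> = se / (sm * sa) * (U * cos \<epsilon> - S * sin \<epsilon>)"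
    unfolding epsilon_cross using roots_pos by (simp add: power2_eq_square field_simps)
  also have "U * cos \<epsilon> - S * sin \<epsilon> = cos (w - \<beta> + \<epsilon>) - cos (\<theta> - \<beta> + \<epsilon>)"
    unfolding U_def S_def cos_add[of "w - \<beta>" \<epsilon>] cos_add[of "\<theta> - \<beta>" \<epsilon>] by algebra
  finally show ?thesis .
qed

lemma obliq_2_zero: assumes w: "w \<in> arc" shows "obliq 2 w = 0 \<longleftrightarrow> w = 2 * \<delta> - \<theta>"
proof -
  have "obliq 2 w = 0 \<longleftrightarrow> cos (w - \<delta>) - cos (\<theta> - \<delta>) = 0"
    using obliq_2[of w] delta_range roots_pos se_pos by (metis divide_eq_0_iff less_irrefl mult_eq_0_iff)
  also have "cos (w - \<delta>) - cos (\<theta> - \<delta>) = - 2 * (sin ((w + \<theta>) / 2 - \<delta>) * sin ((w - \<theta>) / 2))"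
    by (rule cos_minus_cos) (simp_all add: field_simps)
  also have "\<dots> = 0 \<longleftrightarrow> sin ((w + \<theta>) / 2 - \<delta>) = 0" using arc_sines(1)[OF w] by simp
  also have "\<dots> \<longleftrightarrow> (w + \<theta>) / 2 - \<delta> = 0"
  proof
    assume z: "sin ((w + \<theta>) / 2 - \<delta>) = 0"
    have "- pi < (w + \<theta>) / 2 - \<delta>" "(w + \<theta>) / 2 - \<delta> < pi"
      using w theta_range delta_range by (auto simp: arc_def field_simps)
    then show "(w + \<theta>) / 2 - \<delta> = 0" using z sin_eq_0_pi by blast
  qed simp
  finally show ?thesis by (auto simp: field_simps)
qed

lemma obliq_1_zero: assumes w: "w \<in> arc" shows "obliq 1 w = 0 \<longleftrightarrow> w = 2 * pi + 2 * \<beta> - 2 * \<epsilon> - \<theta>"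
proof -
  have "obliq 1 w = 0 \<longleftrightarrow> cos (w - \<beta> + \<epsilon>) - cos (\<theta> - \<beta> + \<epsilon>) = 0"
    using obliq_1[of w] epsilon_range roots_pos se_pos by (metis divide_eq_0_iff less_irrefl mult_eq_0_iff)
  also have "cos (w - \<beta> + \<epsilon>) - cos (\<theta> - \<beta> + \<epsilon>) = - 2 * (sin ((w + \<theta>) / 2 - \<beta> + \<epsilon>) * sin ((w - \<theta>) / 2))"
    by (rule cos_minus_cos) (simp_all add: field_simps)
  also have "\<dots> = 0 \<longleftrightarrow> sin ((w + \<theta>) / 2 - \<beta> + \<epsilon> - pi) = 0" using arc_sines(1)[OF w] by (simp add: sin_diff)
  also have "\<dots> \<longleftrightarrow> (w + \<theta>) / 2 - \<beta> + \<epsilon> - pi = 0"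
  proof
    assume z: "sin ((w + \<theta>) / 2 - \<beta> + \<epsilon> - pi) = 0"
    have "- pi < (w + \<theta>) / 2 - \<beta> + \<epsilon> - pi" "(w + \<theta>) / 2 - \<beta> + \<epsilon> - pi < pi"
      using w theta_range epsilon_range by (auto simp: arc_def field_simps)
    then show "(w + \<theta>) / 2 - \<beta> + \<epsilon> - pi = 0" using z sin_eq_0_pi by blast
  qed simp
  finally show ?thesis by (auto simp: field_simps)
qed

text \<open>The reflection \<open>w \<mapsto> 2 axis_angle j - w\<close> preserves the coordinate of the exponent that is visible on the axis
\<open>z\<^sub>j = 0\<close> and reverses its derivative.\<close>

definition axis_angle :: "2 \<Rightarrow> real" where "axis_angle j = (if j = 1 then \<beta> else 0)"

lemma reflect:
  assumes "w' = 2 * axis_angle j - w + 2 * pi" "z $ j = 0"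
  shows "point w' \<bullet> z = point w \<bullet> z" "tangent w' \<bullet> z = - (tangent w \<bullet> z)"
proof -
  have "point w' \<bullet> z = point w \<bullet> z \<and> tangent w' \<bullet> z = - (tangent w \<bullet> z)"
  proof (cases "j = 1")
    case True
    have "w' - \<beta> = 2 * pi - (w - \<beta>)" using assms(1) True by (simp add: axis_angle_def)
    then have "cos (w' - \<beta>) = cos (w - \<beta>)" "sin (w' - \<beta>) = - sin (w - \<beta>)"
      by (simp_all only: cos_2pi_minus sin_2pi_minus)
    then show ?thesis using assms(2) True by (simp add: inner_vec_def sum_2 point_simps tangent_simps)
  next
    case False
    then have j: "j = 2" using exhaust_2[of j] by simp
    have "w' = 2 * pi - w" using assms(1) j by (simp add: axis_angle_def)
    then have "cos w' = cos w" "sin w' = - sin w" by (simp_all only: cos_2pi_minus sin_2pi_minus)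
    then show ?thesis using assms(2) j by (simp add: inner_vec_def sum_2 point_simps tangent_simps)
  qed
  then show "point w' \<bullet> z = point w \<bullet> z" "tangent w' \<bullet> z = - (tangent w \<bullet> z)" by auto
qed

lemma harmonic_term: "generator \<Sigma> \<mu> (affexp_grad C (D *\<^sub>R tangent w) (point w)) (affexp_hess C (D *\<^sub>R tangent w) (point w)) z = 0"
  by (simp add: generator_affexp[OF symmetric] kernel_point tangent_kernel)

definition bdry_term :: "real \<Rightarrow> real \<Rightarrow> real \<Rightarrow> 2 \<Rightarrow> real^2 \<Rightarrow> real" where
  "bdry_term C D w j z = affexp_grad C (D *\<^sub>R tangent w) (point w) z \<bullet> refl_dir r1 r2 j"

lemma bdry_term: "bdry_term C D w j z = exp (point w \<bullet> z) * (D * dobliq j w + (C + D * (tangent w \<bullet> z)) * obliq j w)"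
  by (simp add: bdry_term_def affexp_grad_def obliq_def dobliq_def inner_add_left)

lemma bdry_term_pair:
  assumes w': "w' = 2 * axis_angle j - w + 2 * pi" and z: "z $ j = 0"
    and D: "D * obliq j w = D' * obliq j w'"
    and C: "C * obliq j w + D * dobliq j w + C' * obliq j w' + D' * dobliq j w' = 0"
  shows "bdry_term C D w j z + bdry_term C' D' w' j z = 0"
proof -
  have "bdry_term C D w j z + bdry_term C' D' w' j z = exp (point w \<bullet> z) *
     ((C * obliq j w + D * dobliq j w + C' * obliq j w' + D' * dobliq j w') + (tangent w \<bullet> z) * (D * obliq j w - D' * obliq j w'))"
    unfolding bdry_term reflect[OF w' z] by (simp add: algebra_simps)
  then show ?thesis using C D by simp
qed

text \<open>At a fixed point of the reflection the affine term has derivative zero along the axis, so one linear condition on the two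
coefficients remains. This is where an affine coefficient enters the chain.\<close>

lemma bdry_term_fold:
  assumes w: "w = 2 * axis_angle j - w + 2 * pi" and z: "z $ j = 0"
  shows "bdry_term (- dobliq j w) (obliq j w) w j z = 0"
  using reflect(2)[OF w z] unfolding bdry_term by (simp add: algebra_simps)

lemma arc_inj:
  assumes w: "w \<in> arc" "w' \<in> arc" and eq: "point w = point w'"
  shows "w = w'"
proof -
  have c: "cos w = cos w'" using arg_cong[OF eq, of "\<lambda>p. p $ 1"] radii_pos by (simp add: point_simps)
  have "cos (w - \<beta>) = cos (w' - \<beta>)" using arg_cong[OF eq, of "\<lambda>p. p $ 2"] radii_pos by (simp add: point_simps)
  then have s: "sin w = sin w'" using c beta_sin roots_pos by (simp add: cos_diff)
  have "cos (w - w') = (cos w')\<^sup>2 + (sin w')\<^sup>2" unfolding cos_diff c s by (simp only: power2_eq_square)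
  then have "cos (w - w') = 1" by simp
  moreover define h where "h = (w - w') / 2"
  then have "w - w' = 2 * h" by simp
  ultimately have "cos (2 * h) = 1" by simp
  then have "sin h = 0" unfolding cos_double_sin by simp
  then have "sin ((w - w') / 2) = 0" by (simp add: h_def)
  moreover have "- pi < (w - w') / 2" "(w - w') / 2 < pi"
    using w theta_range by (auto simp: arc_def field_simps)
  ultimately have "(w - w') / 2 = 0" using sin_eq_0_pi by blast
  then show ?thesis by simp
qed

lemma tangent_nonzero: "tangent w \<noteq> 0"
proof
  assume "tangent w = 0"
  then have "tangent w $ 1 = 0" "tangent w $ 2 = 0" by simp_all
  then have s: "sin w = 0" "sin (w - \<beta>) = 0" using radii_pos by (auto simp: tangent_simps)
  then have "cos w = 0" using beta_sin roots_pos by (simp add: sin_diff)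
  then show False using s(1) sin_cos_squared_add[of w] by simp
qed

text \<open>The angle \<open>w 0\<close> is the fold, \<open>e r\<close> the axis that links node \<open>r\<close> to node \<open>r + 1\<close>, and \<open>k\<close> the
axis whose reflection fixes \<open>w 0\<close>. At node \<open>rc\<close> the oblique derivative at the axis
of the next edge vanishes, so the recursion for \<open>D\<close> yields zero from there on; \<open>w N\<close> then needs no further partner.\<close>

lemma chain_solution:
  fixes e :: "nat \<Rightarrow> 2" and w :: "nat \<Rightarrow> real"
  assumes alt: "\<And>r. e (Suc r) \<noteq> e r" and k: "k \<noteq> e 0"
    and arc: "\<And>r. r \<le> N \<Longrightarrow> w r \<in> arc" and inj: "inj_on w {..N}"
    and link: "\<And>r. r < N \<Longrightarrow> w (Suc r) = 2 * axis_angle (e r) - w r + 2 * pi"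
    and fold: "w 0 = 2 * axis_angle k - w 0 + 2 * pi" "obliq k (w 0) \<noteq> 0"
    and nz: "\<And>r. r < N \<Longrightarrow> obliq (e r) (w (Suc r)) \<noteq> 0"
    and cut: "rc < N" "obliq (e rc) (w rc) = 0" and last: "obliq (e N) (w N) = 0"
    and dr: "draining_exponent \<Sigma> \<mu> r1 r2 p"
  obtains C D K g H where
    "taylor_bounded K (\<lambda>z. \<Sum>r\<le>N. affexp (C r) (D r *\<^sub>R tangent (w r)) (point (w r)) z) g H"
    "vanishes_at_infinity (\<lambda>z. \<Sum>r\<le>N. affexp (C r) (D r *\<^sub>R tangent (w r)) (point (w r)) z)"
    "\<And>z. generator \<Sigma> \<mu> g H z = 0"
    "\<And>z j. z $ j = 0 \<Longrightarrow> g z \<bullet> refl_dir r1 r2 j = 0"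
    "(\<Sum>r\<le>N. C r) \<noteq> 0"
proof -
  obtain C D where C0: "C 0 = - dobliq k (w 0)" and D0: "D 0 = obliq k (w 0)"
    and DD: "\<And>r. r < N \<Longrightarrow> D r * obliq (e r) (w r) = D (Suc r) * obliq (e r) (w (Suc r))"
    and CC: "\<And>r. r < N \<Longrightarrow> C r * obliq (e r) (w r) + D r * dobliq (e r) (w r)
        + C (Suc r) * obliq (e r) (w (Suc r)) + D (Suc r) * dobliq (e r) (w (Suc r)) = 0"
    using chain_coefficients[where q = "\<lambda>r. obliq (e r) (w (Suc r))" and N = N and p = "\<lambda>r. obliq (e r) (w r)"
        and p' = "\<lambda>r. dobliq (e r) (w r)" and q' = "\<lambda>r. dobliq (e r) (w (Suc r))" and c = "- dobliq k (w 0)" and d = "obliq k (w 0)"] nz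
    by blast
  have "rc < r \<Longrightarrow> r \<le> N \<Longrightarrow> D r = 0" for r
  proof (induction r)
    case (Suc r)
    then have "D r * obliq (e r) (w r) = 0" using cut by (cases "r = rc") auto
    then show ?case using DD[of r] nz[of r] Suc.prems by simp
  qed simp
  then have DN: "D N = 0" using cut by simp
  let ?f = "\<lambda>r. affexp (C r) (D r *\<^sub>R tangent (w r)) (point (w r))"
  let ?g = "\<lambda>r. affexp_grad (C r) (D r *\<^sub>R tangent (w r)) (point (w r))"
  let ?H = "\<lambda>r. affexp_hess (C r) (D r *\<^sub>R tangent (w r)) (point (w r))"
  have each: "\<exists>K. taylor_bounded K (?f r) (?g r) (?H r)" if "r \<le> N" for r
    using taylor_bounded_affexp[OF point_negative[OF arc[OF that]] point_negative[OF arc[OF that]]] by metis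
  have "\<exists>K. taylor_bounded K (\<lambda>z. \<Sum>r\<le>N. ?f r z) (\<lambda>z. \<Sum>r\<le>N. ?g r z) (\<lambda>z. \<Sum>r\<le>N. ?H r z)"
    by (rule taylor_bounded_sum) (rule each)
  then obtain K where
    tb: "taylor_bounded K (\<lambda>z. \<Sum>r\<le>N. ?f r z) (\<lambda>z. \<Sum>r\<le>N. ?g r z) (\<lambda>z. \<Sum>r\<le>N. ?H r z)" by (elim exE)
  have van: "vanishes_at_infinity (\<lambda>z. \<Sum>r\<le>N. ?f r z)"
    by (intro vanishes_sum vanishes_affexp point_negative arc)
  have harm: "generator \<Sigma> \<mu> (\<lambda>z. \<Sum>r\<le>N. ?g r z) (\<lambda>z. \<Sum>r\<le>N. ?H r z) z = 0" for z
    by (simp add: generator_sum harmonic_term)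
  have bd: "(\<Sum>r\<le>N. ?g r z) \<bullet> refl_dir r1 r2 j = 0" if z: "z $ j = 0" for z j
  proof -
    define U where "U i r = (if z $ i = 0 then bdry_term (C r) (D r) (w r) i z else 0)" for i r
    have "(\<Sum>r\<le>N. U j r) = 0"
    proof (rule alternating_sum[where e = e and k = k])
      show "U k 0 = 0" using bdry_term_fold[OF fold(1)] by (simp add: U_def C0 D0)
      show "U (e r) r + U (e r) (Suc r) = 0" if "r < N" for r
        using bdry_term_pair[OF link[OF that] _ DD[OF that] CC[OF that]] by (simp add: U_def)
      show "U (e N) N = 0" using last DN by (simp add: U_def bdry_term)
    qed (use alt k in auto)
    then show ?thesis using z by (simp add: U_def bdry_term_def inner_sum_left)
  qed
  have "(\<Sum>r\<le>N. C r) \<noteq> 0"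
  proof
    assume "(\<Sum>r\<le>N. C r) = 0"
    then have f0: "(\<Sum>r\<le>N. ?f r 0) = 0" by (simp add: affexp_def)
    have "(\<Sum>r\<le>N. ?f r z) = 0" if "z \<in> quadrant" for z
      by (rule zero_at_vertex_imp_zero[OF symmetric positive_definite tb van harm bd dr f0 that])
    moreover have "inj_on (\<lambda>r. point (w r)) {..N}"
      using inj arc_inj[OF arc arc] unfolding inj_on_def by simp
    ultimately have "D 0 *\<^sub>R tangent (w 0) = 0"
      by (intro affexp_independent[of "{..N}" "\<lambda>r. point (w r)" C "\<lambda>r. D r *\<^sub>R tangent (w r)" 0]) auto
    then show False using fold(2) D0 tangent_nonzero[of "w 0"] by simp
  qed
  then show ?thesis using that[OF tb van harm bd] by blast
qed

text \<open>With \<open>x = a \<beta>\<close>, one has \<open>r1 r2 sin \<delta> sin \<epsilon> = sin (\<delta> - \<beta>) sin (\<epsilon> - \<beta>)\<close>, and the comparison of the two products of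
sines amounts to \<open>cos x < cos (x - 2 \<beta>)\<close>, true for \<open>\<beta> < x < \<pi>\<close>.\<close>

lemma reflection_strong:
  assumes "\<delta> + \<epsilon> - pi = a * \<beta>" "1 < a"
  shows "0 < r1" "0 < r2" "1 < r1 * r2"
proof -
  have ab: "\<beta> < a * \<beta>" using assms(2) theta_range by simp
  then have de: "\<beta> < \<delta>" "\<beta> < \<epsilon>" using assms(1) delta_range epsilon_range by linarith+
  have sb': "0 < sin \<beta>" using theta_range by (intro sin_gt_zero) auto
  have s: "0 < sin (\<delta> - \<beta>)" "0 < sin (\<epsilon> - \<beta>)" using de delta_range epsilon_range theta_range by (auto intro!: sin_gt_zero)
  have sm: "sm = sin \<beta> * (sa * sb)" "sc = - cos \<beta> * (sa * sb)" using beta_sin beta_cos roots_pos by (simp_all add: field_simps)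
  have e2: "r2 * sb * sin \<delta> = sa * sin (\<delta> - \<beta>)"
  proof -
    have "sb * (r2 * sb * sin \<delta>) = sb * (sa * sin (\<delta> - \<beta>))"
      using delta_cross unfolding sm by (simp add: sin_diff power2_eq_square algebra_simps)
    then show ?thesis using roots_pos by simp
  qed
  have e1: "r1 * sa * sin \<epsilon> = sb * sin (\<epsilon> - \<beta>)"
  proof -
    have "sa * (r1 * sa * sin \<epsilon>) = sa * (sb * sin (\<epsilon> - \<beta>))"
      using epsilon_cross unfolding sm by (simp add: sin_diff power2_eq_square algebra_simps)
    then show ?thesis using roots_pos by simp
  qed
  have "0 < r2 * sb * sin \<delta>" unfolding e2 using s roots_pos by simp
  then show r2: "0 < r2" using roots_pos delta_range by (simp add: zero_less_mult_iff)
  have "0 < r1 * sa * sin \<epsilon>" unfolding e1 using s roots_pos by simp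
  then show r1: "0 < r1" using roots_pos epsilon_range by (simp add: zero_less_mult_iff)
  have "(r1 * r2) * (sin \<delta> * sin \<epsilon>) * (sa * sb) = (sin (\<delta> - \<beta>) * sin (\<epsilon> - \<beta>)) * (sa * sb)"
    using e1 e2 by algebra
  then have e: "(r1 * r2) * (sin \<delta> * sin \<epsilon>) = sin (\<delta> - \<beta>) * sin (\<epsilon> - \<beta>)" using roots_pos by simp
  have "cos (a * \<beta>) < cos \<bar>a * \<beta> - 2 * \<beta>\<bar>"
  proof (rule cos_monotone_0_pi)
    show "\<bar>a * \<beta> - 2 * \<beta>\<bar> < a * \<beta>" using ab theta_range(1,2) by linarith
    show "a * \<beta> \<le> pi" using assms(1) delta_range epsilon_range by linarith
  qed simp
  then have "cos (a * \<beta>) < cos (a * \<beta> - 2 * \<beta>)" by simp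
  moreover have "cos (\<delta> + \<epsilon>) = - cos (a * \<beta>)" "cos (\<delta> + \<epsilon> - 2 * \<beta>) = - cos (a * \<beta> - 2 * \<beta>)"
  proof -
    have "\<delta> + \<epsilon> = a * \<beta> + pi" "\<delta> + \<epsilon> - 2 * \<beta> = a * \<beta> - 2 * \<beta> + pi" using assms(1) by simp_all
    then show "cos (\<delta> + \<epsilon>) = - cos (a * \<beta>)" "cos (\<delta> + \<epsilon> - 2 * \<beta>) = - cos (a * \<beta> - 2 * \<beta>)"
      by (simp_all only: cos_periodic_pi)
  qed
  moreover have "sin \<delta> * sin \<epsilon> = (cos (\<delta> - \<epsilon>) - cos (\<delta> + \<epsilon>)) / 2" by (rule sin_times_sin)
  moreover have "sin (\<delta> - \<beta>) * sin (\<epsilon> - \<beta>) = (cos (\<delta> - \<epsilon>) - cos (\<delta> + \<epsilon> - 2 * \<beta>)) / 2"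
    using sin_times_sin[of "\<delta> - \<beta>" "\<epsilon> - \<beta>"] by (simp add: algebra_simps)
  ultimately have "1 * (sin \<delta> * sin \<epsilon>) < (r1 * r2) * (sin \<delta> * sin \<epsilon>)" unfolding e by simp
  then show "1 < r1 * r2" using delta_range epsilon_range by (simp only: mult_less_cancel_right_pos mult_pos_pos)
qed

section \<open>The resonant chain\<close>

lemma hitting_probability_chain:
  assumes tb: "taylor_bounded K f g H" and van: "vanishes_at_infinity f"
    and harm: "\<And>z. generator \<Sigma> \<mu> g H z = 0"
    and bd: "\<And>z j. z $ j = 0 \<Longrightarrow> g z \<bullet> refl_dir r1 r2 j = 0"
    and dr: "draining_exponent \<Sigma> \<mu> r1 r2 p" and f0: "f 0 \<noteq> 0"
    and rbm: "absorbed_rbm \<Sigma> \<mu> r1 r2 z M F W L Z"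
  shows "measure M {\<omega> \<in> space M. vertex_time z Z \<omega> < \<infinity>} = f z / f 0"
proof (cases "z = 0")
  case True
  have "prob_space M" using rbm by (simp add: absorbed_rbm_def brownian_motion_cov_def)
  then show ?thesis using True f0 by (simp add: vertex_time_def prob_space.prob_space)
next
  case False
  interpret absorbed_process M F \<Sigma> W \<mu> r1 r2 z L Z
  proof unfold_locales
    show "brownian_motion_cov M F \<Sigma> W" using rbm by (simp only: absorbed_rbm_def)
  qed (fact symmetric positive_definite rbm False)+
  have "f z = f 0 * measure M {\<omega> \<in> space M. vertex_time z Z \<omega> < \<infinity>}"
    by (rule hitting_probability[OF tb van harm bd dr])
  then show ?thesis using f0 by (simp add: field_simps)
qed

text \<open>A congruence modulo \<open>\<pi>\<close> becomes an equation: \<open>2 \<delta> - \<theta> - j \<beta>\<close> lies strictly between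
\<open>0\<close> and \<open>2 \<pi>\<close>, because \<open>\<alpha> \<beta> < \<delta> < \<pi>\<close>. The index is \<open>l = 2 \<alpha> - j\<close>.\<close>

lemma resonance_index:
  fixes \<alpha> :: nat
  assumes \<alpha>: "real \<alpha> = (\<delta> + \<epsilon> - pi) / \<beta>"
    and res: "\<exists>j\<in>{1..2 * \<alpha> - 2}. \<exists>n::int. \<theta> - 2 * \<delta> + real j * \<beta> = of_int n * pi"
  obtains l :: nat where "2 \<le> l" "l \<le> 2 * \<alpha> - 1" "2 \<le> \<alpha>"
    "\<theta> + 2 * \<epsilon> = pi + real l * \<beta>" "2 * \<delta> - \<theta> = pi + (2 * real \<alpha> - real l) * \<beta>"
proof -
  obtain j and n :: int where j: "1 \<le> j" "j \<le> 2 * \<alpha> - 2" and n: "\<theta> - 2 * \<delta> + real j * \<beta> = of_int n * pi"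
    using res by auto
  have sum: "\<delta> + \<epsilon> - pi = real \<alpha> * \<beta>" using \<alpha> theta_range by (simp add: field_simps)
  have \<alpha>2: "2 \<le> \<alpha>" using j by auto
  have "real j \<le> 2 * real \<alpha> - 2" using j \<alpha>2 by linarith
  then have jb: "real j * \<beta> \<le> (2 * real \<alpha> - 2) * \<beta>" using theta_range by (intro mult_right_mono) auto
  have jpos: "0 < real j * \<beta>" using j theta_range by simp
  have dl: "real \<alpha> * \<beta> < \<delta>" using sum epsilon_range by linarith
  have n_pos: "0 < - of_int n * pi" using n jb dl theta_range by (simp add: algebra_simps)
  have n_less: "- of_int n * pi < 2 * pi" using n jpos theta_range delta_range by linarith
  have "0 < - real_of_int n" using n_pos pi_gt_zero by (rule zero_less_mult_pos2)
  moreover have "- real_of_int n < 2" by (rule mult_right_less_imp_less[OF n_less]) simp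
  ultimately have n1: "n = - 1" by linarith
  show ?thesis
  proof (rule that[of "2 * \<alpha> - j"])
    have l: "real (2 * \<alpha> - j) = 2 * real \<alpha> - real j" using j by (simp add: of_nat_diff)
    have d: "2 * \<delta> - \<theta> = pi + real j * \<beta>" using n by (simp add: n1)
    then show "2 * \<delta> - \<theta> = pi + (2 * real \<alpha> - real (2 * \<alpha> - j)) * \<beta>" unfolding l by simp
    have "2 * \<epsilon> = 2 * (real \<alpha> * \<beta>) + 2 * pi - 2 * \<delta>" using sum by linarith
    then show "\<theta> + 2 * \<epsilon> = pi + real (2 * \<alpha> - j) * \<beta>" unfolding l using d by (simp add: algebra_simps)
  qed (use j \<alpha>2 in auto)
qed

text \<open>At resonance every angle of the chain is \<open>\<pi>\<close> plus an integer multiple \<open>m\<close> of \<open>\<beta>\<close>, the two reflections being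
\<open>m \<mapsto> - m\<close> and \<open>m \<mapsto> 2 - m\<close>. Starting from the fixed point \<open>m = 0\<close> (for even \<open>l\<close>) or \<open>m = 1\<close> (for
odd \<open>l\<close>) they produce \<open>0, 2, -2, 4, \<dots>\<close> or \<open>1, -1, 3, -3, \<dots>\<close>.\<close>

definition edge :: "nat \<Rightarrow> nat \<Rightarrow> 2" where "edge l r = (if odd (l + r) then 2 else 1)"

definition node :: "nat \<Rightarrow> nat \<Rightarrow> real" where
  "node l r = pi + (if odd (l + r) then real r + 1 else - real r) * \<beta>"

text \<open>The zeros of the oblique derivatives are \<open>m = 2 - l\<close> for axis \<open>1\<close> and \<open>m = 2 \<alpha> - l\<close> for axis \<open>2\<close>. They are met at the nodes
\<open>l - 2\<close> and \<open>2 \<alpha> - 1 - l\<close>, the numbers of steps from the fold to the two ends of the chain; the smaller one is the node at which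
the affine coefficients die out, the larger one the end of the solution.\<close>

lemma folded_chain:
  fixes \<alpha> l :: nat
  assumes l: "2 \<le> l" "l \<le> 2 * \<alpha> - 1"
    and e: "\<theta> + 2 * \<epsilon> = pi + real l * \<beta>" and d: "2 * \<delta> - \<theta> = pi + (2 * real \<alpha> - real l) * \<beta>"
    and N: "N = max (l - 2) (2 * \<alpha> - 1 - l)" and dr: "draining_exponent \<Sigma> \<mu> r1 r2 p"
  obtains C D K g H where
    "taylor_bounded K (\<lambda>z. \<Sum>r\<le>N. affexp (C r) (D r *\<^sub>R tangent (node l r)) (point (node l r)) z) g H"
    "vanishes_at_infinity (\<lambda>z. \<Sum>r\<le>N. affexp (C r) (D r *\<^sub>R tangent (node l r)) (point (node l r)) z)"
    "\<And>z. generator \<Sigma> \<mu> g H z = 0"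
    "\<And>z j. z $ j = 0 \<Longrightarrow> g z \<bullet> refl_dir r1 r2 j = 0"
    "(\<Sum>r\<le>N. C r) \<noteq> (0::real)"
proof -
  define m where "m r = (if odd (l + r) then real r + 1 else - real r)" for r
  have node: "node l r = pi + m r * \<beta>" for r by (simp add: node_def m_def)
  have b0: "0 < \<beta>" using theta_range by simp
  have le: "x * \<beta> \<le> y * \<beta>" if "x \<le> y" for x y using that b0 by simp
  have lr: "real (l - 2) = real l - 2" using l by simp
  have ar: "real (2 * \<alpha> - 1 - l) = 2 * real \<alpha> - 1 - real l" using l by (simp add: of_nat_diff)
  have parity: "even (l + (l - 2))" "odd (l + (2 * \<alpha> - 1 - l))" using l by auto
  have up: "m r \<le> real l - 2 \<or> m r \<le> 2 * real \<alpha> - real l"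
    and lo: "- (real l - 2) \<le> m r \<or> - (2 * real \<alpha> - 2 - real l) \<le> m r" if r: "r \<le> N" for r
  proof -
    consider "r \<le> l - 2" | "r \<le> 2 * \<alpha> - 1 - l" using r unfolding N by linarith
    then have "(m r \<le> real l - 2 \<or> m r \<le> 2 * real \<alpha> - real l) \<and>
      (- (real l - 2) \<le> m r \<or> - (2 * real \<alpha> - 2 - real l) \<le> m r)"
    proof cases
      case 1
      have "odd (l + r) \<Longrightarrow> r \<noteq> l - 2" using parity(1) by auto
      then have "odd (l + r) \<Longrightarrow> real r + 1 \<le> real (l - 2)" using 1 by linarith
      then show ?thesis using 1 lr by (auto simp: m_def)
    next
      case 2
      have "even (l + r) \<Longrightarrow> r \<noteq> 2 * \<alpha> - 1 - l" using parity(2) by auto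
      then have "even (l + r) \<Longrightarrow> real r + 1 \<le> real (2 * \<alpha> - 1 - l)" using 2 by linarith
      then show ?thesis using 2 ar by (auto simp: m_def)
    qed
    then show "m r \<le> real l - 2 \<or> m r \<le> 2 * real \<alpha> - real l"
      "- (real l - 2) \<le> m r \<or> - (2 * real \<alpha> - 2 - real l) \<le> m r" by auto
  qed
  have arc: "node l r \<in> arc" if r: "r \<le> N" for r
  proof -
    have "m r * \<beta> < pi - \<theta>"
      using up[OF r]
    proof
      assume "m r \<le> real l - 2"
      from le[OF this] show ?thesis using e epsilon_range theta_range by (simp add: algebra_simps)
    next
      assume "m r \<le> 2 * real \<alpha> - real l"
      from le[OF this] show ?thesis using d delta_range by linarith
    qed
    moreover have "2 * \<beta> - \<theta> - pi < m r * \<beta>"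
      using lo[OF r]
    proof
      assume "- (real l - 2) \<le> m r"
      from le[OF this] show ?thesis using e epsilon_range theta_range by (simp add: algebra_simps)
    next
      assume "- (2 * real \<alpha> - 2 - real l) \<le> m r"
      from le[OF this] show ?thesis using d delta_range theta_range by (simp add: algebra_simps)
    qed
    ultimately show ?thesis by (simp add: arc_def node)
  qed
  have z2: "obliq 2 (node l r) = 0 \<longleftrightarrow> m r = 2 * real \<alpha> - real l" if "r \<le> N" for r
  proof -
    have "obliq 2 (node l r) = 0 \<longleftrightarrow> node l r = 2 * \<delta> - \<theta>" by (rule obliq_2_zero[OF arc[OF that]])
    also have "\<dots> \<longleftrightarrow> m r = 2 * real \<alpha> - real l" unfolding d node using b0 by simp
    finally show ?thesis .
  qed
  have start: "2 * pi + 2 * \<beta> - 2 * \<epsilon> - \<theta> = pi + (2 - real l) * \<beta>" using e by (simp add: algebra_simps)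
  have z1: "obliq 1 (node l r) = 0 \<longleftrightarrow> m r = 2 - real l" if "r \<le> N" for r
  proof -
    have "obliq 1 (node l r) = 0 \<longleftrightarrow> node l r = 2 * pi + 2 * \<beta> - 2 * \<epsilon> - \<theta>" by (rule obliq_1_zero[OF arc[OF that]])
    also have "\<dots> \<longleftrightarrow> m r = 2 - real l" unfolding start node using b0 by simp
    finally show ?thesis .
  qed
  have ends: "obliq (edge l r) (node l r) = 0" if "r \<le> N" "r = l - 2 \<or> r = 2 * \<alpha> - 1 - l" for r
    using that(2)
  proof
    assume r: "r = l - 2"
    then have "even (l + r)" using parity(1) by simp
    then have "edge l r = 1" "m r = 2 - real l" using r lr by (simp_all add: edge_def m_def)
    then show ?thesis using z1[OF that(1)] by simp
  next
    assume r: "r = 2 * \<alpha> - 1 - l"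
    then have "odd (l + r)" using parity(2) by simp
    then have "edge l r = 2" "m r = 2 * real \<alpha> - real l" using r ar by (simp_all add: edge_def m_def)
    then show ?thesis using z2[OF that(1)] by simp
  qed
  define k :: 2 where "k = (if odd l then 1 else 2)"
  show ?thesis
  proof (rule chain_solution[where e = "edge l" and w = "node l" and k = k and N = N and rc = "min (l - 2) (2 * \<alpha> - 1 - l)", OF _ _ arc])
    show "edge l (Suc r) \<noteq> edge l r" for r by (simp add: edge_def)
    show "k \<noteq> edge l 0" by (simp add: edge_def k_def)
    have "inj m" unfolding inj_def m_def by (auto split: if_splits)
    then show "inj_on (node l) {..N}" using b0 by (auto simp: inj_on_def node)
    show "node l (Suc r) = 2 * axis_angle (edge l r) - node l r + 2 * pi" for r
      by (simp add: node_def axis_angle_def edge_def algebra_simps)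
    show "node l 0 = 2 * axis_angle k - node l 0 + 2 * pi"
      by (simp add: node_def axis_angle_def k_def)
    show "obliq k (node l 0) \<noteq> 0"
      using z1[of 0] z2[of 0] l by (cases "odd l") (auto simp: k_def m_def)
    show "obliq (edge l r) (node l (Suc r)) \<noteq> 0" if "r < N" for r
      using z1[of "Suc r"] z2[of "Suc r"] l that by (cases "odd (l + r)") (auto simp: edge_def m_def)
    have "l - 2 \<noteq> 2 * \<alpha> - 1 - l"
    proof
      assume eq: "l - 2 = 2 * \<alpha> - 1 - l"
      show False using parity unfolding eq by blast
    qed
    then show "min (l - 2) (2 * \<alpha> - 1 - l) < N" by (auto simp: N)
    then show "obliq (edge l (min (l - 2) (2 * \<alpha> - 1 - l))) (node l (min (l - 2) (2 * \<alpha> - 1 - l))) = 0"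
      by (intro ends) (auto simp: min_def)
    show "obliq (edge l N) (node l N) = 0" by (intro ends) (auto simp: N max_def)
    show "draining_exponent \<Sigma> \<mu> r1 r2 p" by (rule dr)
  qed (auto intro: that)
qed

text \<open>The exponents with index at least \<open>l\<close> run through the nodes outwards, those with smaller index through the same
nodes in the opposite order. For odd index the two coordinates are given at two different parameters, the
two reflections of the node.\<close>

lemma exponents_on_chain:
  fixes \<alpha> l k :: nat
  assumes e: "\<theta> + 2 * \<epsilon> = pi + real l * \<beta>"
    and q_def: "q = cis (2 * \<beta>)" and s1_def: "s1 = cis (\<theta> + 2 * \<epsilon>)"
    and even_exponents: "\<And>k. k \<in> {1..\<alpha> - 1} \<Longrightarrow>
      (a (2 * k), b (2 * k)) = (x_unif \<Sigma> \<mu> (s1 / q ^ k), y_unif \<Sigma> \<mu> \<beta> (s1 / q ^ k))"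
    and odd_exponents: "\<And>k. k \<in> {0..\<alpha> - 1} \<Longrightarrow>
      (a (2 * k + 1), b (2 * k + 1)) =
        (x_unif \<Sigma> \<mu> (s1 / q ^ (k + 1)), y_unif \<Sigma> \<mu> \<beta> (s1 / q ^ k))"
    and k: "1 \<le> k" "k \<le> 2 * \<alpha> - 1"
    and r: "l \<le> k \<and> r = k - l \<or> k < l \<and> r = l - 1 - k"
  shows "a k = of_real (point (node l r) $ 1)" "b k = of_real (point (node l r) $ 2)"
proof -
  have s: "s1 / q ^ i = cis (pi + (real l - 2 * real i) * \<beta>)" for i
    unfolding s1_def q_def e Complex.DeMoivre cis_divide by (rule arg_cong[where f = cis]) (simp add: algebra_simps)
  have cpi: "cos (pi + x) = - cos x" for x :: real by (simp add: cos_add)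
  have x: "x_unif \<Sigma> \<mu> (s1 / q ^ i) = of_real (xr * (- cos ((real l - 2 * real i) * \<beta>) - cos \<theta>))" for i
    unfolding s unif_point point_simps cpi ..
  have y: "y_unif \<Sigma> \<mu> \<beta> (s1 / q ^ i) = of_real (yr * (- cos ((real l - 2 * real i - 1) * \<beta>) - cos (\<theta> - \<beta>)))" for i
  proof -
    have "pi + (real l - 2 * real i) * \<beta> - \<beta> = pi + (real l - 2 * real i - 1) * \<beta>" by (simp add: algebra_simps)
    then show ?thesis unfolding s unif_point point_simps by (simp only: cpi)
  qed
  have node: "node l r = pi + (if odd k then real k + 1 - real l else real l - real k) * \<beta>"
    using r k by (auto simp: node_def of_nat_diff algebra_simps)
  have px: "point (pi + x * \<beta>) $ 1 = xr * (- cos (x * \<beta>) - cos \<theta>)"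
    and py: "point (pi + x * \<beta>) $ 2 = yr * (- cos ((x - 1) * \<beta>) - cos (\<theta> - \<beta>))" for x
  proof -
    show "point (pi + x * \<beta>) $ 1 = xr * (- cos (x * \<beta>) - cos \<theta>)" unfolding point_simps cpi ..
    have "pi + x * \<beta> - \<beta> = pi + (x - 1) * \<beta>" by (simp add: algebra_simps)
    then show "point (pi + x * \<beta>) $ 2 = yr * (- cos ((x - 1) * \<beta>) - cos (\<theta> - \<beta>))" unfolding point_simps by (simp only: cpi)
  qed
  have neg: "cos (x * \<beta>) = cos (y * \<beta>)" if "y = - x" for x y using that by simp
  show "a k = of_real (point (node l r) $ 1)" "b k = of_real (point (node l r) $ 2)"
  proof -
    have "a k = of_real (point (node l r) $ 1) \<and> b k = of_real (point (node l r) $ 2)"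
    proof (cases "odd k")
      case True
      then obtain i where i: "k = 2 * i + 1" by (auto elim: oddE)
      have "i \<in> {0..\<alpha> - 1}" using i k by auto
      from odd_exponents[OF this] have ab: "a k = x_unif \<Sigma> \<mu> (s1 / q ^ (i + 1))" "b k = y_unif \<Sigma> \<mu> \<beta> (s1 / q ^ i)"
        unfolding i by auto
      have n: "node l r = pi + (real k + 1 - real l) * \<beta>" using node True by simp
      have "cos ((real l - 2 * real (i + 1)) * \<beta>) = cos ((real k + 1 - real l) * \<beta>)" by (rule neg) (simp add: i)
      moreover have "cos ((real l - 2 * real i - 1) * \<beta>) = cos ((real k + 1 - real l - 1) * \<beta>)" by (rule neg) (simp add: i)
      ultimately show ?thesis unfolding ab x y n px py by (simp only: simp_thms)
    next
      case False
      then obtain i where i: "k = 2 * i" by (auto elim: evenE)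
      have "i \<in> {1..\<alpha> - 1}" using i k by auto
      from even_exponents[OF this] have ab: "a k = x_unif \<Sigma> \<mu> (s1 / q ^ i)" "b k = y_unif \<Sigma> \<mu> \<beta> (s1 / q ^ i)"
        unfolding i by auto
      have n: "node l r = pi + (real l - 2 * real i) * \<beta>" using node False by (simp add: i)
      show ?thesis unfolding ab x y n px py by simp
    qed
    then show "a k = of_real (point (node l r) $ 1)" "b k = of_real (point (node l r) $ 2)" by auto
  qed
qed

end

theorem mainTheorem4:
  fixes \<Sigma> :: "real^2^2" and \<mu> :: "real^2" and r1 r2 \<beta> \<theta> \<delta> \<epsilon> :: real
    and \<alpha> :: nat and q s1 :: complex and a b :: "nat \<Rightarrow> complex"
  assumes symmetric: "transpose \<Sigma> = \<Sigma>"
    and positive_definite: "\<And>c. c \<noteq> 0 \<Longrightarrow> 0 < c \<bullet> (\<Sigma> *v c)"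
    and drift: "0 < \<mu>$1" "0 < \<mu>$2"
    and beta: "\<beta> \<in> {0<..<pi}" "cos \<beta> = - \<Sigma>$1$2 / sqrt (\<Sigma>$1$1 * \<Sigma>$2$2)"
    and theta: "\<theta> \<in> {0<..<\<beta>}"
      "has_tangent \<theta> (\<mu>$2 * sqrt (det \<Sigma>)) (\<Sigma>$2$2 * \<mu>$1 - \<Sigma>$1$2 * \<mu>$2)"
    and delta: "\<delta> \<in> {0<..<pi}" "has_tangent \<delta> (- sqrt (det \<Sigma>)) (r2 * \<Sigma>$2$2 + \<Sigma>$1$2)"
    and epsilon: "\<epsilon> \<in> {0<..<pi}" "has_tangent \<epsilon> (- sqrt (det \<Sigma>)) (\<Sigma>$1$1 * r1 + \<Sigma>$1$2)"
    and alpha: "real \<alpha> = (\<delta> + \<epsilon> - pi) / \<beta>" "1 \<le> \<alpha>"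
    and resonance: "\<exists>j\<in>{1..2 * \<alpha> - 2}. \<exists>n::int. \<theta> - 2 * \<delta> + real j * \<beta> = of_int n * pi"
    and q_def: "q = cis (2 * \<beta>)"
    and s1_def: "s1 = cis (\<theta> + 2 * \<epsilon>)"
    and even_exponents: "\<And>k. k \<in> {1..\<alpha> - 1} \<Longrightarrow>
      (a (2 * k), b (2 * k)) = (x_unif \<Sigma> \<mu> (s1 / q ^ k), y_unif \<Sigma> \<mu> \<beta> (s1 / q ^ k))"
    and odd_exponents: "\<And>k. k \<in> {0..\<alpha> - 1} \<Longrightarrow>
      (a (2 * k + 1), b (2 * k + 1)) =
        (x_unif \<Sigma> \<mu> (s1 / q ^ (k + 1)), y_unif \<Sigma> \<mu> \<beta> (s1 / q ^ k))"
  shows "\<exists>A :: nat \<Rightarrow> real \<Rightarrow> real \<Rightarrow> real.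
    (\<forall>k\<in>{1..2 * \<alpha> - 1}. \<exists>c d e. \<forall>u v. A k u v = c + d * u + e * v) \<and>
    (\<forall>u v. 0 \<le> u \<longrightarrow> 0 \<le> v \<longrightarrow>
      (\<forall>(M :: 'w measure) F W L Z. absorbed_rbm \<Sigma> \<mu> r1 r2 (vector [u, v]) M F W L Z \<longrightarrow>
        complex_of_real (measure M {\<omega> \<in> space M. vertex_time (vector [u, v]) Z \<omega> < \<infinity>}) =
          (\<Sum>k = 1..2 * \<alpha> - 1.
            complex_of_real (A k u v) * exp (a k * of_real u + b k * of_real v))))"
proof -
  interpret wedge \<Sigma> \<mu> r1 r2 \<beta> \<theta> \<delta> \<epsilon>
    by unfold_locales (fact symmetric positive_definite drift beta theta delta epsilon)+
  obtain l :: nat where l: "2 \<le> l" "l \<le> 2 * \<alpha> - 1" and \<alpha>: "2 \<le> \<alpha>"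
    and e: "\<theta> + 2 * \<epsilon> = pi + real l * \<beta>" and d: "2 * \<delta> - \<theta> = pi + (2 * real \<alpha> - real l) * \<beta>"
    using resonance_index[OF alpha(1) resonance] by metis
  have "\<delta> + \<epsilon> - pi = real \<alpha> * \<beta>" using alpha(1) theta_range by (simp add: field_simps)
  then have r: "0 < r1" "0 < r2" "1 < r1 * r2" using reflection_strong[of "real \<alpha>"] \<alpha> by auto
  obtain p where dr: "draining_exponent \<Sigma> \<mu> r1 r2 p" by (rule draining_exponent_exists[OF positive_definite r])
  define N where "N = max (l - 2) (2 * \<alpha> - 1 - l)"
  obtain C D K g H where
    tb: "taylor_bounded K (\<lambda>z. \<Sum>r\<le>N. affexp (C r) (D r *\<^sub>R tangent (node l r)) (point (node l r)) z) g H"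
    and van: "vanishes_at_infinity (\<lambda>z. \<Sum>r\<le>N. affexp (C r) (D r *\<^sub>R tangent (node l r)) (point (node l r)) z)"
    and harm: "\<And>z. generator \<Sigma> \<mu> g H z = 0"
    and bd: "\<And>z j. z $ j = 0 \<Longrightarrow> g z \<bullet> refl_dir r1 r2 j = 0"
    and f0: "(\<Sum>r\<le>N. C r) \<noteq> (0::real)"
    by (rule folded_chain[OF l e d N_def dr]) blast
  let ?f = "\<lambda>z. \<Sum>r\<le>N. affexp (C r) (D r *\<^sub>R tangent (node l r)) (point (node l r)) z"
  define c0 where "c0 = (\<Sum>r\<le>N. C r)"
  have f0': "?f 0 = c0" by (simp add: affexp_def c0_def)
  have f_vertex: "?f 0 \<noteq> 0" unfolding f0' c0_def by (rule f0)
  \<comment> \<open>the longer half of the folded chain; the exponents of the other half repeat some of these\<close>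
  define I where "I = (if N = 2 * \<alpha> - 1 - l then {l..2 * \<alpha> - 1} else {1..l - 1})"
  define ix where "ix k = (if N = 2 * \<alpha> - 1 - l then k - l else l - 1 - k)" for k
  have I: "I \<subseteq> {1..2 * \<alpha> - 1}" using l by (auto simp: I_def)
  have ix: "l \<le> k \<and> ix k = k - l \<or> k < l \<and> ix k = l - 1 - k" if "k \<in> I" for k
    using that l by (auto simp: I_def ix_def split: if_splits)
  have bij: "bij_betw ix I {..N}"
  proof (cases "N = 2 * \<alpha> - 1 - l")
    case True
    then show ?thesis using l unfolding I_def ix_def
      by (intro bij_betw_byWitness[where f' = "\<lambda>r. r + l"]) auto
  next
    case False
    then have "N = l - 2" by (auto simp: N_def max_def split: if_splits)
    then show ?thesis using False l unfolding I_def ix_def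
      by (intro bij_betw_byWitness[where f' = "\<lambda>r. l - 1 - r"]) auto
  qed
  define A where "A k u v = (if k \<in> I then
      (C (ix k) + D (ix k) * (tangent (node l (ix k)) $ 1 * u + tangent (node l (ix k)) $ 2 * v)) / c0 else 0)" for k u v
  show ?thesis
  proof (intro exI[of _ A] conjI ballI allI impI)
    fix k
    show "\<exists>c d e. \<forall>u v. A k u v = c + d * u + e * v"
    proof (cases "k \<in> I")
      case True
      then show ?thesis
        by (intro exI[of _ "C (ix k) / c0"] exI[of _ "D (ix k) * tangent (node l (ix k)) $ 1 / c0"]
            exI[of _ "D (ix k) * tangent (node l (ix k)) $ 2 / c0"])
          (simp add: A_def add_divide_distrib algebra_simps)
    next
      case False
      then show ?thesis by (intro exI[of _ 0]) (simp add: A_def)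
    qed
  next
    fix u v :: real and M :: "'w measure" and F W L Z
    assume rbm: "absorbed_rbm \<Sigma> \<mu> r1 r2 (vector [u, v]) M F W L Z"
    let ?z = "vector [u, v] :: real^2"
    have z: "x \<bullet> ?z = x $ 1 * u + x $ 2 * v" for x by (simp add: inner_vec_def sum_2)
    have "measure M {\<omega> \<in> space M. vertex_time ?z Z \<omega> < \<infinity>} = ?f ?z / ?f 0"
      by (rule hitting_probability_chain[OF tb van harm bd dr f_vertex rbm])
    also have "\<dots> = (\<Sum>r\<le>N. affexp (C r) (D r *\<^sub>R tangent (node l r)) (point (node l r)) ?z / c0)"
      unfolding f0' by (rule sum_divide_distrib)
    also have "\<dots> = (\<Sum>k\<in>I. affexp (C (ix k)) (D (ix k) *\<^sub>R tangent (node l (ix k))) (point (node l (ix k))) ?z / c0)"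
      by (rule sum.reindex_bij_betw[OF bij, symmetric])
    finally have prob: "measure M {\<omega> \<in> space M. vertex_time ?z Z \<omega> < \<infinity>} =
      (\<Sum>k\<in>I. affexp (C (ix k)) (D (ix k) *\<^sub>R tangent (node l (ix k))) (point (node l (ix k))) ?z / c0)" .
    have summand: "complex_of_real (A k u v) * exp (a k * of_real u + b k * of_real v) =
      of_real (affexp (C (ix k)) (D (ix k) *\<^sub>R tangent (node l (ix k))) (point (node l (ix k))) ?z / c0)" if k: "k \<in> I" for k
    proof -
      have k': "1 \<le> k" "k \<le> 2 * \<alpha> - 1" using k I by auto
      have "a k = of_real (point (node l (ix k)) $ 1)" "b k = of_real (point (node l (ix k)) $ 2)"
        using exponents_on_chain[OF e q_def s1_def even_exponents odd_exponents k' ix[OF k]] by auto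
      then have "exp (a k * of_real u + b k * of_real v) = of_real (exp (point (node l (ix k)) \<bullet> ?z))"
        unfolding z by (simp flip: exp_of_real)
      moreover have "A k u v = (C (ix k) + (D (ix k) *\<^sub>R tangent (node l (ix k))) \<bullet> ?z) / c0"
        using k by (simp add: A_def z algebra_simps)
      ultimately show ?thesis by (simp add: affexp_def)
    qed
    have "(\<Sum>k = 1..2 * \<alpha> - 1. complex_of_real (A k u v) * exp (a k * of_real u + b k * of_real v)) =
        (\<Sum>k\<in>I. complex_of_real (A k u v) * exp (a k * of_real u + b k * of_real v))"
      by (rule sum.mono_neutral_right) (use I in \<open>auto simp: A_def\<close>)
    also have "\<dots> = (\<Sum>k\<in>I. of_real (affexp (C (ix k)) (D (ix k) *\<^sub>R tangent (node l (ix k))) (point (node l (ix k))) ?z / c0))"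
      by (rule sum.cong) (simp_all only: summand)
    finally show "complex_of_real (measure M {\<omega> \<in> space M. vertex_time ?z Z \<omega> < \<infinity>}) =
        (\<Sum>k = 1..2 * \<alpha> - 1. complex_of_real (A k u v) * exp (a k * of_real u + b k * of_real v))"
      unfolding prob by simp
  qed
qed

end
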